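(* Let $i\in\{1,2\}$. The transformation defined by $$\mathcal{T}^{(i)}_t(M) := \int^T_0\left(\beta^{M,i} 1_{[0,t)}\right)(s)\,dM_s,\quad t\in [0,T],$$ is measure-preserving, i.e. $\mathcal{T}^{(i)}(M)$ is a martingale with respect to its own completed natural filtration $\mathbb{F}_{T}^{\mathcal{T}^{(i)}(M)}$, with $\mathcal{T}^{(i)}_0(M)=0$ a.s. and $\langle\mathcal{T}^{(i)}(M)\rangle_{\cdot}=\langle M\rangle_{\cdot}$. Furthermore, the process $$\mathcal{B}^{(i)}_t(M) := \int^T_0 \left(\alpha^{M,i}1_{[0,t)}\right)(s)\,dM_s,\quad t\in[0,T],$$ is a bridge of $M$ (from $0$ to $0$ on $[0,T]$).
   Context: Fix $T>0$. $M=(M_t)_{t\in[0,T]}$ is the continuous Gaussian martingale $M_t=\int_0^tz_M(s)\,dW_s$, where $W$ is a standard Brownian motion and $z_M\in L^2([0,T])$ with $z_M\ne0$ Lebesgue-a.e.; the probability space is the (completed) coordinate space $C([0,T])$ of $M$. Its quadratic variation $\langle M\rangle_t=\int_0^tz_M^2(s)\,ds$ is deterministic and strictly increasing. Write $\langle M\rangle_{T,t}:=\langle M\rangle_T-\langle M\rangle_t$ and $L^2_T(M):=L^2([0,T],d\langle M\rangle)$; for $f\in L^2_T(M)$, $\int_0^Tf(s)\,dM_s$ is the usual Wiener integral. For $f\in L^2_T(M)$ define $$(\alpha^{M,1}f)(s)=f(s)-\tfrac1{\langle M\rangle_s}\int_0^sf(u)\,d\langle M\rangle_u,\qquad(\alpha^{M,2}f)(s)=f(s)-\tfrac1{\langle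 M\rangle_{T,s}}\int_s^Tf(u)\,d\langle M\rangle_u,$$ $$(\beta^{M,1}f)(s)=f(s)-\int_s^T\tfrac{f(u)}{\langle M\rangle_u}\,d\langle M\rangle_u,\qquad(\beta^{M,2}f)(s)=f(s)-\int_0^s\tfrac{f(u)}{\langle M\rangle_{T,u}}\,d\langle M\rangle_u.$$ These are bounded operators on $L^2_T(M)$. A process is a bridge of $M$ (from $0$ to $0$ on $[0,T]$) if its law equals the law of $M$ conditioned on $M_T=0$; equivalently, it has the same finite-dimensional distributions as $\widehat M^T_t:=M_t-\frac{\langle M\rangle_t}{\langle M\rangle_T}M_T$, i.e. it is centered Gaussian with covariance $\langle M\rangle_{s\wedge t}-\frac{\langle M\rangle_s\langle M\rangle_t}{\langle M\rangle_T}$. *)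

theory Defs
  imports "HOL-Probability.Probability"
begin

section \<open>Processes on a compact time interval\<close>

text \<open>
  A real process indexed by \<open>[0, T]\<close> is a function \<open>X :: real \<Rightarrow> 'a \<Rightarrow> real\<close> of which only the
  values \<open>X t\<close> with \<open>t \<in> {0..T}\<close> matter.
\<close>

definition path :: "real \<Rightarrow> (real \<Rightarrow> 'a \<Rightarrow> real) \<Rightarrow> 'a \<Rightarrow> real \<Rightarrow> real" where
  "path T X \<omega> = (\<lambda>t\<in>{0..T}. X t \<omega>)"

text \<open>
  The law lives on the product \<open>\<sigma>\<close>-algebra of \<open>\<real>\<^bsup>[0,T]\<^esup>\<close>, so that equality of laws is equality of
  all finite-dimensional distributions.
\<close>

definition law :: "'a measure \<Rightarrow> real \<Rightarrow> (real \<Rightarrow> 'a \<Rightarrow> real) \<Rightarrow> (real \<Rightarrow> real) measure" where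
  "law P T X = distr P (Pi\<^sub>M {0..T} (\<lambda>_. borel)) (path T X)"

definition continuous_modification ::
    "'a measure \<Rightarrow> real \<Rightarrow> (real \<Rightarrow> 'a \<Rightarrow> real) \<Rightarrow> (real \<Rightarrow> 'a \<Rightarrow> real) \<Rightarrow> bool" where
  "continuous_modification P T X Y \<longleftrightarrow>
     (\<forall>t\<in>{0..T}. Y t \<in> borel_measurable P \<and> (AE \<omega> in P. Y t \<omega> = X t \<omega>)) \<and>
     (\<forall>\<omega>\<in>space P. continuous_on {0..T} (\<lambda>t. Y t \<omega>))"

text \<open>
  The space \<open>C([0,T])\<close> with the \<open>\<sigma>\<close>-algebra generated by the coordinate maps; a path is
  represented by its extensional extension to \<open>real\<close>.  Only the space and the \<open>\<sigma>\<close>-algebra of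
  this measure are used.
\<close>

definition path_space :: "real \<Rightarrow> (real \<Rightarrow> real) measure" where
  "path_space T =
     restrict_space (Pi\<^sub>M {0..T} (\<lambda>_. borel)) {\<omega>. continuous_on {0..T} \<omega>}"

definition coord :: "real \<Rightarrow> (real \<Rightarrow> real) \<Rightarrow> real" where
  "coord t \<omega> = \<omega> t"

definition brownian_motion :: "'a measure \<Rightarrow> real \<Rightarrow> (real \<Rightarrow> 'a \<Rightarrow> real) \<Rightarrow> bool" where
  "brownian_motion P T W \<longleftrightarrow>
     (\<forall>t\<in>{0..T}. W t \<in> borel_measurable P) \<and>
     (AE \<omega> in P. W 0 \<omega> = 0) \<and>
     (AE \<omega> in P. continuous_on {0..T} (\<lambda>t. W t \<omega>)) \<and>
     (\<forall>s\<in>{0..T}. \<forall>t\<in>{0..T}. s < t \<longrightarrow>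
        distributed P lborel (\<lambda>\<omega>. W t \<omega> - W s \<omega>) (\<lambda>x. ennreal (normal_density 0 (sqrt (t - s)) x))) \<and>
     (\<forall>(n::nat) (\<tau>::nat \<Rightarrow> real). mono \<tau> \<longrightarrow> range \<tau> \<subseteq> {0..T} \<longrightarrow>
        prob_space.indep_vars P (\<lambda>_. borel) (\<lambda>k \<omega>. W (\<tau> (Suc k)) \<omega> - W (\<tau> k) \<omega>) {..<n})"


section \<open>Wiener integrals\<close>

text \<open>A list of triples \<open>(c, a, b)\<close> encodes the step function \<open>\<Sum> c 1\<^bsub>(a,b]\<^esub>\<close>.\<close>

type_synonym step = "(real \<times> real \<times> real) list"

definition step_fun :: "step \<Rightarrow> real \<Rightarrow> real" where
  "step_fun \<phi> s = (\<Sum>(c, a, b)\<leftarrow>\<phi>. c * indicator {a<..b} s)"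

definition step_integral :: "(real \<Rightarrow> 'a \<Rightarrow> real) \<Rightarrow> step \<Rightarrow> 'a \<Rightarrow> real" where
  "step_integral X \<phi> \<omega> = (\<Sum>(c, a, b)\<leftarrow>\<phi>. c * (X b \<omega> - X a \<omega>))"

definition step_on :: "real \<Rightarrow> step \<Rightarrow> bool" where
  "step_on T \<phi> \<longleftrightarrow> (\<forall>(c, a, b)\<in>set \<phi>. 0 \<le> a \<and> a \<le> b \<and> b \<le> T)"

text \<open>
  Here \<open>\<mu>\<close> is the measure \<open>d\<langle>X\<rangle>\<close> on \<open>[0,T]\<close>: \<open>I\<close> is a version of \<open>\<integral>\<^sub>0\<^sup>T f(s) dX\<^sub>s\<close> if it is an
  \<open>L\<^sup>2(P)\<close>-limit of integrals of step functions that converge to \<open>f\<close> in \<open>L\<^sup>2(\<mu>)\<close>.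
\<close>

definition is_wiener_integral ::
    "'a measure \<Rightarrow> real measure \<Rightarrow> real \<Rightarrow> (real \<Rightarrow> 'a \<Rightarrow> real) \<Rightarrow> (real \<Rightarrow> real) \<Rightarrow> ('a \<Rightarrow> real) \<Rightarrow> bool"
  where
  "is_wiener_integral P \<mu> T X f I \<longleftrightarrow>
     f \<in> borel_measurable \<mu> \<and> I \<in> borel_measurable P \<and>
     (\<exists>\<phi>::nat \<Rightarrow> step. (\<forall>n. step_on T (\<phi> n)) \<and>
        (\<lambda>n. \<integral>\<^sup>+ s. ennreal ((f s - step_fun (\<phi> n) s)\<^sup>2) \<partial>\<mu>) \<longlonglongrightarrow> 0 \<and>
        (\<lambda>n. \<integral>\<^sup>+ \<omega>. ennreal ((I \<omega> - step_integral X (\<phi> n) \<omega>)\<^sup>2) \<partial>P) \<longlonglongrightarrow> 0)"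

text \<open>An unspecified version of the integral, which is only determined almost surely.\<close>

definition wiener_integral ::
    "'a measure \<Rightarrow> real measure \<Rightarrow> real \<Rightarrow> (real \<Rightarrow> 'a \<Rightarrow> real) \<Rightarrow> (real \<Rightarrow> real) \<Rightarrow> 'a \<Rightarrow> real" where
  "wiener_integral P \<mu> T X f = (SOME I. is_wiener_integral P \<mu> T X f I)"


section \<open>Martingales and quadratic variation\<close>

definition completed_natural_filtration ::
    "'a measure \<Rightarrow> (real \<Rightarrow> 'a \<Rightarrow> real) \<Rightarrow> real \<Rightarrow> 'a measure" where
  "completed_natural_filtration P X t =
     sigma (space P)
       ({X s -` B \<inter> space P | s B. 0 \<le> s \<and> s \<le> t \<and> B \<in> sets borel} \<union> null_sets (completion P))"

definition martingale_on ::
    "'a measure \<Rightarrow> real \<Rightarrow> (real \<Rightarrow> 'a measure) \<Rightarrow> (real \<Rightarrow> 'a \<Rightarrow> real) \<Rightarrow> bool" where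
  "martingale_on P T F X \<longleftrightarrow>
     (\<forall>t\<in>{0..T}. subalgebra P (F t)) \<and>
     (\<forall>s\<in>{0..T}. \<forall>t\<in>{0..T}. s \<le> t \<longrightarrow> sets (F s) \<subseteq> sets (F t)) \<and>
     (\<forall>t\<in>{0..T}. X t \<in> borel_measurable (F t) \<and> integrable P (X t)) \<and>
     (\<forall>s\<in>{0..T}. \<forall>t\<in>{0..T}. s \<le> t \<longrightarrow> (AE \<omega> in P. real_cond_exp P (F s) (X t) \<omega> = X s \<omega>))"

text \<open>
  \<open>A\<close> is the quadratic variation \<open>\<langle>X\<rangle>\<close> of the continuous square-integrable martingale \<open>X\<close>: the
  (up to indistinguishability unique) continuous increasing adapted process started at \<open>0\<close> for
  which \<open>X\<^sup>2 - A\<close> is a martingale.  As Wiener integrals are only defined up to modification,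
  continuity of \<open>X\<close> means having a continuous modification.
\<close>

definition is_quadratic_variation ::
    "'a measure \<Rightarrow> real \<Rightarrow> (real \<Rightarrow> 'a measure) \<Rightarrow> (real \<Rightarrow> 'a \<Rightarrow> real) \<Rightarrow> (real \<Rightarrow> 'a \<Rightarrow> real) \<Rightarrow> bool"
  where
  "is_quadratic_variation P T F X A \<longleftrightarrow>
     martingale_on P T F X \<and>
     (\<forall>t\<in>{0..T}. integrable P (\<lambda>\<omega>. (X t \<omega>)\<^sup>2)) \<and>
     (\<exists>Y. continuous_modification P T X Y) \<and>
     (\<forall>t\<in>{0..T}. A t \<in> borel_measurable (F t)) \<and>
     (AE \<omega> in P. A 0 \<omega> = 0 \<and> continuous_on {0..T} (\<lambda>t. A t \<omega>) \<and> mono_on {0..T} (\<lambda>t. A t \<omega>)) \<and>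
     martingale_on P T F (\<lambda>t \<omega>. (X t \<omega>)\<^sup>2 - A t \<omega>)"


section \<open>Bridges\<close>

text \<open>
  The law of \<open>X\<close> conditioned on the null event \<open>X\<^sub>T = x\<close> is \<open>K x\<close> for a regular conditional
  distribution \<open>K\<close> of \<open>X\<close> given \<open>X\<^sub>T\<close>.  Weak continuity at \<open>0\<close> selects the version there:
  if \<open>0\<close> lies in the support of \<open>X\<^sub>T\<close>, then \<open>K 0\<close> does not depend on \<open>K\<close>.  Weak continuity is
  required for the marginals \<open>(\<omega>(\<tau>\<^sub>0), \<omega>(\<tau>\<^sub>1), \<dots>)\<close>, which include all finite-dimensional ones.
\<close>

definition conditional_law_given_end ::
    "'a measure \<Rightarrow> real \<Rightarrow> (real \<Rightarrow> 'a \<Rightarrow> real) \<Rightarrow> (real \<Rightarrow> (real \<Rightarrow> real) measure) \<Rightarrow> bool" where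
  "conditional_law_given_end P T X K \<longleftrightarrow>
     K \<in> borel \<rightarrow>\<^sub>M prob_algebra (Pi\<^sub>M {0..T} (\<lambda>_. borel)) \<and>
     (\<forall>A\<in>sets (Pi\<^sub>M {0..T} (\<lambda>_. borel)). \<forall>B\<in>sets borel.
        emeasure P {\<omega>\<in>space P. path T X \<omega> \<in> A \<and> X T \<omega> \<in> B} =
        (\<integral>\<^sup>+ x. emeasure (K x) A * indicator B x \<partial>distr P borel (X T)))"

definition weakly_continuous_at_0 :: "real \<Rightarrow> (real \<Rightarrow> (real \<Rightarrow> real) measure) \<Rightarrow> bool" where
  "weakly_continuous_at_0 T K \<longleftrightarrow>
     (\<forall>(\<tau>::nat \<Rightarrow> real) (g::(nat \<Rightarrow> real) \<Rightarrow> real).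
        range \<tau> \<subseteq> {0..T} \<longrightarrow> continuous_on UNIV g \<longrightarrow> bounded (range g) \<longrightarrow>
        ((\<lambda>x. \<integral>\<omega>. g (\<lambda>n. \<omega> (\<tau> n)) \<partial>K x) \<longlongrightarrow> (\<integral>\<omega>. g (\<lambda>n. \<omega> (\<tau> n)) \<partial>K 0)) (at 0))"

definition is_bridge ::
    "'a measure \<Rightarrow> real \<Rightarrow> (real \<Rightarrow> 'a \<Rightarrow> real) \<Rightarrow> (real \<Rightarrow> 'a \<Rightarrow> real) \<Rightarrow> bool" where
  "is_bridge P T M X \<longleftrightarrow>
     (\<forall>t\<in>{0..T}. X t \<in> borel_measurable P) \<and>
     (\<exists>K. conditional_law_given_end P T M K \<and> weakly_continuous_at_0 T K \<and> law P T X = K 0)"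


section \<open>The operators and the transformations\<close>

text \<open>
  In the following \<open>z\<close> is the function \<open>z\<^sub>M\<close>, \<open>qv z t\<close> is \<open>\<langle>M\<rangle>\<^sub>t\<close>, and \<open>qv_measure T z\<close> is the
  measure \<open>d\<langle>M\<rangle>\<close> on \<open>[0,T]\<close>.  The conventions \<open>x / 0 = 0\<close> and \<open>\<integral> f = 0\<close> for non-integrable \<open>f\<close>
  affect the operators applied to \<open>L\<^sup>2\<close> functions only at the endpoints \<open>s \<in> {0, T}\<close>.
\<close>

definition qv :: "(real \<Rightarrow> real) \<Rightarrow> real \<Rightarrow> real" where
  "qv z t = (LINT s:{0..t}|lborel. (z s)\<^sup>2)"

definition qv_measure :: "real \<Rightarrow> (real \<Rightarrow> real) \<Rightarrow> real measure" where
  "qv_measure T z = density (restrict_space lborel {0..T}) (\<lambda>s. ennreal ((z s)\<^sup>2))"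

definition alpha :: "real \<Rightarrow> (real \<Rightarrow> real) \<Rightarrow> nat \<Rightarrow> (real \<Rightarrow> real) \<Rightarrow> real \<Rightarrow> real" where
  "alpha T z i f s =
     (if i = 1
      then f s - 1 / qv z s * (LINT u:{0..s}|qv_measure T z. f u)
      else f s - 1 / (qv z T - qv z s) * (LINT u:{s..T}|qv_measure T z. f u))"

definition beta :: "real \<Rightarrow> (real \<Rightarrow> real) \<Rightarrow> nat \<Rightarrow> (real \<Rightarrow> real) \<Rightarrow> real \<Rightarrow> real" where
  "beta T z i f s =
     (if i = 1
      then f s - (LINT u:{s..T}|qv_measure T z. f u / qv z u)
      else f s - (LINT u:{0..s}|qv_measure T z. f u / (qv z T - qv z u)))"

definition T_transform ::
    "'a measure \<Rightarrow> real \<Rightarrow> (real \<Rightarrow> real) \<Rightarrow> (real \<Rightarrow> 'a \<Rightarrow> real) \<Rightarrow> nat \<Rightarrow> real \<Rightarrow> 'a \<Rightarrow> real" where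
  "T_transform P T z M i t =
     wiener_integral P (qv_measure T z) T M (beta T z i (indicator {0..<t}))"

definition B_transform ::
    "'a measure \<Rightarrow> real \<Rightarrow> (real \<Rightarrow> real) \<Rightarrow> (real \<Rightarrow> 'a \<Rightarrow> real) \<Rightarrow> nat \<Rightarrow> real \<Rightarrow> 'a \<Rightarrow> real" where
  "B_transform P T z M i t =
     wiener_integral P (qv_measure T z) T M (alpha T z i (indicator {0..<t}))"

end

theory Submission
  imports Defs "HOL-Real_Asymp.Real_Asymp"
begin

text \<open>
  Why the theorem holds.  The Wiener integral is an isometry from \<open>L\<^sup>2(d\<langle>M\<rangle>)\<close> into the centered
  Gaussian variables, so every process \<open>t \<mapsto> \<integral> f\<^sub>t dM\<close> is centered Gaussian with covariance
  \<open>\<langle>f\<^sub>s, f\<^sub>t\<rangle>\<close>, and its law is determined by these inner products.  The theorem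
  therefore reduces to two computations in \<open>L\<^sup>2(d\<langle>M\<rangle>)\<close>, lemmas \<open>beta_inner\<close> and \<open>alpha_inner\<close>:

    \<open>\<langle>\<beta> 1\<^bsub>[0,s)\<^esub>, \<beta> 1\<^bsub>[0,t)\<^esub>\<rangle> = q (min s t)\<close> and
    \<open>\<langle>\<alpha> 1\<^bsub>[0,s)\<^esub>, \<alpha> 1\<^bsub>[0,t)\<^esub>\<rangle> = q (min s t) - q s q t / q T\<close> with \<open>q = \<langle>M\<rangle>\<close>.

  The first is the covariance of \<open>M\<close> and the second that of \<open>M\<^sub>t - (q t / q T) M\<^sub>T\<close>.

  The inner products become elementary in the time scale of the clock \<open>q\<close>, which carries \<open>d\<langle>M\<rangle>\<close> to
  Lebesgue measure on \<open>[0, Q]\<close>, \<open>Q = q T\<close> (\<open>qv_measure_preserving\<close>).  There the operators of index 1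
  turn indicators into the kernels \<open>kernel_A\<close> and \<open>kernel_B\<close>.  The map \<open>s \<mapsto> Q - q s\<close> carries \<open>d\<langle>M\<rangle>\<close>
  to the same Lebesgue measure, and in these reversed coordinates the operators of index 2 are
  expressed by the same two kernels (\<open>alpha_kernel\<close>, \<open>beta_kernel\<close>).  So only
  \<open>kernel_A_inner\<close> and \<open>kernel_B_inner\<close> have to be integrated, each with an explicit primitive.

  Consequences for \<open>\<T>(M)\<close>.  Its increments are independent of the past because they are orthogonal
  to it, with variance \<open>q t - q s\<close>; hence \<open>\<T>(M)\<close> and \<open>\<T>(M)\<^sup>2 - q\<close> are martingales in the completed
  natural filtration (locale \<open>independent_increments\<close>).  A continuous modification exists because
  \<open>\<T>(M)\<close> has the law of the continuous process \<open>M\<close>: uniform continuity on the rationals is an event of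
  countably many coordinates, so it has the same probability for both (\<open>continuous_modification_of_law\<close>).

  Consequences for \<open>\<B>(M)\<close>.  The process \<open>Y\<^sub>t = M\<^sub>t - (q t / Q) M\<^sub>T\<close> is independent of \<open>M\<^sub>T\<close>, so the law of
  \<open>Y + (q / Q) x\<close> is a regular conditional law of \<open>M\<close> given \<open>M\<^sub>T = x\<close>; it is weakly continuous in \<open>x\<close>
  and equals the law of \<open>Y\<close>, that is of \<open>\<B>(M)\<close>, at \<open>x = 0\<close> (\<open>bridge_of_independent_end\<close>).

  Two tools carry the argument.  That a law on a product space is determined by
  the characteristic functions of finite linear combinations (\<open>law_eq_of_cos_moments\<close>) is reduced to
  Levy's uniqueness theorem on the line.  The Wiener integral is constructed for an abstract
  integrator (locale \<open>gaussian_integrator\<close>), which covers Brownian motion, used to define \<open>M\<close>, and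
  \<open>M\<close> itself.
\<close>

section \<open>Laws determined by cosine moments\<close>

text \<open>
  The characteristic function, rather than a density, is prescribed, so that variance \<open>0\<close> is
  included and limits in mean square stay in the class.
\<close>

definition centered_normal :: "'a measure \<Rightarrow> ('a \<Rightarrow> real) \<Rightarrow> real \<Rightarrow> bool" where
  "centered_normal P Y v \<longleftrightarrow> Y \<in> borel_measurable P \<and>
     (\<forall>u. char (distr P borel Y) u = complex_of_real (exp (- (u\<^sup>2 * v / 2))))"

text \<open>
  All moments of a centered normal variable can be read off the standard normal distribution scaled
  by \<open>sqrt v\<close>; this form also covers the degenerate case.
\<close>

lemma centered_normal_distr:
  assumes "prob_space P" "centered_normal P Y v" "0 \<le> v"
  shows "distr P borel Y = distr std_normal_distribution borel (\<lambda>x. sqrt v * x)"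
proof (rule Levy_uniqueness)
  interpret prob_space P by fact
  have Y[measurable]: "Y \<in> borel_measurable P" using assms(2) by (simp add: centered_normal_def)
  show "real_distribution (distr P borel Y)" by (rule real_distribution_distr) simp
  interpret S: prob_space std_normal_distribution
    by (rule prob_space_normal_density) simp
  show "real_distribution (distr std_normal_distribution borel (\<lambda>x. sqrt v * x))"
    by (rule S.real_distribution_distr) simp
  show "char (distr P borel Y) = char (distr std_normal_distribution borel (\<lambda>x. sqrt v * x))"
  proof
    fix u
    have "char (distr std_normal_distribution borel (\<lambda>x. sqrt v * x)) u
        = char std_normal_distribution (u * sqrt v)"
      unfolding char_def by (subst integral_distr) (auto simp: mult.assoc)
    also have "\<dots> = complex_of_real (exp (- (u\<^sup>2 * v / 2)))"
      using assms(3) by (simp add: char_std_normal_distribution power_mult_distrib)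
    finally show "char (distr P borel Y) u
        = char (distr std_normal_distribution borel (\<lambda>x. sqrt v * x)) u"
      using assms(2) by (simp add: centered_normal_def)
  qed
qed

lemma centered_normal_moments:
  assumes "prob_space P" "centered_normal P Y v" "0 \<le> v"
  shows "integrable P (\<lambda>\<omega>. (Y \<omega>)\<^sup>2)" "(\<integral>\<omega>. (Y \<omega>)\<^sup>2 \<partial>P) = v"
        "integrable P Y" "(\<integral>\<omega>. Y \<omega> \<partial>P) = 0"
proof -
  have Y[measurable]: "Y \<in> borel_measurable P" using assms(2) by (simp add: centered_normal_def)
  note D = centered_normal_distr[OF assms]
  have m2: "integrable std_normal_distribution (\<lambda>x. x\<^sup>2)" "(\<integral>x. x\<^sup>2 \<partial>std_normal_distribution) = 1"
    using std_normal_distribution_even_moments[of 1] by (auto simp: fact_numeral)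
  have m1: "integrable std_normal_distribution (\<lambda>x. x)" "(\<integral>x. x \<partial>std_normal_distribution) = 0"
    using integral_std_normal_distribution_moment_odd[of 1] integrable_std_normal_moment[of 1]
    by (auto simp: integrable_density normal_density_nonneg)
  have "integrable (distr P borel Y) (\<lambda>y. y\<^sup>2)" "(\<integral>y. y\<^sup>2 \<partial>distr P borel Y) = v"
    unfolding D using m2 assms(3)
    by (auto simp: integrable_distr_eq integral_distr power_mult_distrib)
  then show "integrable P (\<lambda>\<omega>. (Y \<omega>)\<^sup>2)" "(\<integral>\<omega>. (Y \<omega>)\<^sup>2 \<partial>P) = v"
    by (auto simp: integrable_distr_eq integral_distr)
  have "integrable (distr P borel Y) (\<lambda>y. y)" "(\<integral>y. y \<partial>distr P borel Y) = 0"
    unfolding D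
     apply (subst integrable_distr_eq, simp, simp, rule integrable_mult_right, rule m1(1))
    apply (subst integral_distr, simp, simp)
    using m1(2) by simp
  note m = this
  show "integrable P Y" using integrable_distr[OF Y m(1)] by assumption
  show "(\<integral>\<omega>. Y \<omega> \<partial>P) = 0"
    using trans[OF integral_distr[OF Y, symmetric, of "\<lambda>y. y"] m(2)] by simp
qed

lemma centered_normal_0_AE:
  assumes "prob_space P" "centered_normal P Y 0"
  shows "AE \<omega> in P. Y \<omega> = 0"
  using centered_normal_moments(1,2)[OF assms order_refl]
    integral_nonneg_eq_0_iff_AE[of P "\<lambda>\<omega>. (Y \<omega>)\<^sup>2"] by simp

text \<open>
  Levy's uniqueness theorem is about probability measures.  The total mass of a finite measure is the
  value of its characteristic function at \<open>0\<close>, so both measures may be divided by the same number.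
\<close>

lemma finite_measure_char_unique:
  fixes M N :: "real measure"
  assumes "finite_measure M" "finite_measure N" and [measurable_cong]: "sets M = sets borel" "sets N = sets borel"
    and eq: "char M = char N"
  shows "M = N"
proof -
  interpret M: finite_measure M by fact
  interpret N: finite_measure N by fact
  have spM: "space M = UNIV" and spN: "space N = UNIV"
    using assms(3,4)[THEN sets_eq_imp_space_eq] by auto
  define c where "c = measure M UNIV"
  have c': "c = measure N UNIV"
    using fun_cong[OF eq, of 0] by (simp add: c_def char_def spM spN)
  have eM: "emeasure M UNIV = ennreal c" and eN: "emeasure N UNIV = ennreal c"
    using c' by (simp_all add: c_def M.emeasure_eq_measure N.emeasure_eq_measure)
  show ?thesis
  proof (cases "c = 0")
    case True
    then have "emeasure M A = 0" "emeasure N A = 0" for A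
      using emeasure_space[of M A] emeasure_space[of N A] eM eN spM spN by auto
    then show ?thesis by (intro measure_eqI) (auto simp: assms)
  next
    case False
    then have c: "0 < c" by (simp add: c_def zero_less_measure_iff) 
    define norm where "norm L = density L (\<lambda>_::real. ennreal (1 / c))" for L
    have nd: "real_distribution (norm L)"
      if [measurable_cong]: "sets L = sets borel" and "emeasure L UNIV = ennreal c" for L
    proof -
      have "emeasure (norm L) (space (norm L)) = 1"
        using that sets_eq_imp_space_eq[OF that(1)] c
        by (simp add: norm_def emeasure_density ennreal_mult[symmetric])
      then show ?thesis
        by (intro real_distribution.intro real_distribution_axioms.intro prob_spaceI) (simp_all add: norm_def that)
    qed
    have ch: "char (norm L) u = (1 / c) *\<^sub>R char L u" if [measurable_cong]: "sets L = sets borel" for L u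
      using c unfolding char_def norm_def by (subst integral_density) auto
    have "norm M = norm N"
      by (rule Levy_uniqueness) (auto simp: nd assms eM eN ch eq fun_eq_iff)
    then have E: "emeasure (norm M) A = emeasure (norm N) A" for A by simp
    show ?thesis
    proof (rule measure_eqI)
      fix A assume "A \<in> sets M"
      then have [measurable]: "A \<in> sets borel" by (simp add: assms)
      have r: "emeasure L A = ennreal c * emeasure (norm L) A" if [measurable_cong]: "sets L = sets borel" for L
        using c by (simp add: norm_def emeasure_density nn_integral_cmult mult.assoc[symmetric] ennreal_mult[symmetric])
      show "emeasure M A = emeasure N A" using E[of A] by (simp add: r assms)
    qed (simp add: assms)
  qed
qed

lemma weighted_distribution:
  fixes W Z :: "'a \<Rightarrow> real"
  assumes "prob_space Q" and [measurable]: "W \<in> borel_measurable Q" "Z \<in> borel_measurable Q" "A \<in> sets borel"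
    and W: "\<And>\<omega>. 0 \<le> W \<omega> \<and> W \<omega> \<le> (c::real)"
  defines "L \<equiv> distr (density Q (\<lambda>\<omega>. ennreal (W \<omega>))) borel Z"
  shows "finite_measure L"
    and "char L v = Complex (\<integral>\<omega>. W \<omega> * cos (v * Z \<omega> + 0) \<partial>Q) (\<integral>\<omega>. W \<omega> * cos (v * Z \<omega> + (- (pi / 2))) \<partial>Q)"
    and "measure L A = (\<integral>\<omega>. W \<omega> * indicator A (Z \<omega>) \<partial>Q)"
proof -
  interpret prob_space Q by fact
  have "emeasure (density Q (\<lambda>\<omega>. ennreal (W \<omega>))) (space Q) = (\<integral>\<^sup>+\<omega>. ennreal (W \<omega>) \<partial>Q)"
    by (auto simp: emeasure_density intro!: nn_integral_cong)
  also have "\<dots> \<le> (\<integral>\<^sup>+\<omega>. ennreal c \<partial>Q)" using W by (intro nn_integral_mono) (auto intro: ennreal_leI)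
  also have "\<dots> < \<infinity>" by (simp add: emeasure_space_1)
  finally have "finite_measure (density Q (\<lambda>\<omega>. ennreal (W \<omega>)))" by (intro finite_measureI) auto
  then show fin: "finite_measure L" unfolding L_def by (rule finite_measure.finite_measure_distr) simp
  have "char L v = (\<integral>\<omega>. W \<omega> *\<^sub>R iexp (v * Z \<omega>) \<partial>Q)"
    unfolding char_def L_def using W
    by (subst integral_distr, simp, simp, subst integral_density) auto
  also have "\<dots> = Complex (\<integral>\<omega>. W \<omega> * cos (v * Z \<omega> + 0) \<partial>Q) (\<integral>\<omega>. W \<omega> * cos (v * Z \<omega> + (- (pi / 2))) \<partial>Q)"
  proof -
    have i: "integrable Q (\<lambda>\<omega>. W \<omega> *\<^sub>R iexp (v * Z \<omega>))"
      using W by (intro integrable_const_bound[where B=c]) (auto intro!: AE_I2)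
    have s: "cos (y + (- (pi / 2))) = sin y" for y :: real
      by (simp only: cos_add cos_minus sin_minus cos_pi_half sin_pi_half)
    have "Re (\<integral>\<omega>. W \<omega> *\<^sub>R iexp (v * Z \<omega>) \<partial>Q) = (\<integral>\<omega>. W \<omega> * cos (v * Z \<omega>) \<partial>Q)"
      using integral_Re[OF i] by (simp add: Re_exp)
    moreover have "Im (\<integral>\<omega>. W \<omega> *\<^sub>R iexp (v * Z \<omega>) \<partial>Q) = (\<integral>\<omega>. W \<omega> * sin (v * Z \<omega>) \<partial>Q)"
      using integral_Im[OF i] by (simp add: Im_exp)
    ultimately show ?thesis
      unfolding s add_0_right by (intro complex_eqI) (simp_all only: complex.sel)
  qed
  finally show "char L v = Complex (\<integral>\<omega>. W \<omega> * cos (v * Z \<omega> + 0) \<partial>Q) (\<integral>\<omega>. W \<omega> * cos (v * Z \<omega> + (- (pi / 2))) \<partial>Q)" .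
  interpret F: finite_measure L by (rule fin)
  have "measure L A = (\<integral>x. indicator A x \<partial>L)"
    by (simp add: L_def)
  also have "\<dots> = (\<integral>\<omega>. W \<omega> * indicator A (Z \<omega>) \<partial>Q)"
    unfolding L_def using W by (subst integral_distr, simp, simp, subst integral_density) auto
  finally show "measure L A = (\<integral>\<omega>. W \<omega> * indicator A (Z \<omega>) \<partial>Q)" .
qed

text \<open>
  A bounded nonnegative weight turns the distribution of \<open>Y\<close> into a finite measure on the line whose
  characteristic function has the weighted cosine moments as real (\<open>\<theta> = 0\<close>) and imaginary
  (\<open>\<theta> = - \<pi> / 2\<close>) parts.
\<close>

lemma weighted_distribution_eq:
  assumes "prob_space P" "prob_space P'"
    and meas: "w \<in> borel_measurable P" "w' \<in> borel_measurable P'"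
      "Y \<in> borel_measurable P" "Y' \<in> borel_measurable P'" "A \<in> sets borel"
    and w: "\<And>\<omega>. 0 \<le> w \<omega> \<and> w \<omega> \<le> c" "\<And>\<omega>. 0 \<le> w' \<omega> \<and> w' \<omega> \<le> (c::real)"
    and eq: "\<And>v \<theta>. (\<integral>\<omega>. w \<omega> * cos (v * Y \<omega> + \<theta>) \<partial>P) = (\<integral>\<omega>. w' \<omega> * cos (v * Y' \<omega> + \<theta>) \<partial>P')"
  shows "(\<integral>\<omega>. w \<omega> * indicator A (Y \<omega>) \<partial>P) = (\<integral>\<omega>. w' \<omega> * indicator A (Y' \<omega>) \<partial>P')"
proof -
  note l = weighted_distribution[OF assms(1) meas(1,3,5) w(1)] and l' = weighted_distribution[OF assms(2) meas(2,4,5) w(2)]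
  have "distr (density P (\<lambda>\<omega>. ennreal (w \<omega>))) borel Y = distr (density P' (\<lambda>\<omega>. ennreal (w' \<omega>))) borel Y'"
    by (rule finite_measure_char_unique) (use l(1) l'(1) in \<open>simp_all only: fun_eq_iff l(2) l'(2) eq sets_distr simp_thms\<close>)
  then show ?thesis using l(3) l'(3) by simp
qed

lemma integral_with_halves:
  fixes a b c :: "'a \<Rightarrow> real"
  assumes "integrable Q a" "integrable Q b" "integrable Q c"
  shows "(\<integral>\<omega>. a \<omega> + (b \<omega> / 2 + c \<omega> / 2) \<partial>Q) = (\<integral>\<omega>. a \<omega> \<partial>Q) + ((\<integral>\<omega>. b \<omega> \<partial>Q) / 2 + (\<integral>\<omega>. c \<omega> \<partial>Q) / 2)"
  using assms by simp

text \<open>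
  Cosine factors are replaced by indicators one coordinate at a time.  Let \<open>Z\<close> be the product of
  the indicators obtained so far and \<open>S\<close> a linear combination.  The weight \<open>Z (1 + cos (S + \<theta>))\<close> is
  nonnegative, and by the product formula for cosines its cosine moments in \<open>X k\<close> are again of the
  form covered by the induction hypothesis.  One-dimensional uniqueness therefore allows the
  indicator of \<open>X k\<close> next to this weight.  The case \<open>S = 0, \<theta> = 0\<close>, where the weight is \<open>2 Z\<close>, permits
  the removal of the summand \<open>Z\<close>, which leaves \<open>Z cos (S + \<theta>)\<close>.
\<close>

lemma indicator_cos_moments_eq:
  fixes X :: "'i \<Rightarrow> 'a \<Rightarrow> real" and X' :: "'i \<Rightarrow> 'b \<Rightarrow> real"
  assumes P: "prob_space P" "prob_space P'"
    and meas: "\<And>i. i \<in> I \<Longrightarrow> X i \<in> borel_measurable P" "\<And>i. i \<in> I \<Longrightarrow> X' i \<in> borel_measurable P'"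
    and eq: "\<And>J u \<theta>. finite J \<Longrightarrow> J \<subseteq> I \<Longrightarrow>
      (\<integral>\<omega>. cos ((\<Sum>j\<in>J. u j * X j \<omega>) + \<theta>) \<partial>P) = (\<integral>\<omega>. cos ((\<Sum>j\<in>J. u j * X' j \<omega>) + \<theta>) \<partial>P')"
    and K: "finite K" "K \<subseteq> I" and A: "\<And>k. k \<in> K \<Longrightarrow> A k \<in> sets borel"
    and J: "finite J" "J \<subseteq> I"
  shows "(\<integral>\<omega>. (\<Prod>k\<in>K. indicator (A k) (X k \<omega>)) * cos ((\<Sum>j\<in>J. u j * X j \<omega>) + \<theta>) \<partial>P) =
         (\<integral>\<omega>. (\<Prod>k\<in>K. indicator (A k) (X' k \<omega>)) * cos ((\<Sum>j\<in>J. u j * X' j \<omega>) + \<theta>) \<partial>P')"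
  using K A J
proof (induction K arbitrary: J u \<theta> rule: finite_induct)
  case empty
  then show ?case using eq by simp
next
  case (insert k K)
  interpret P: prob_space P by fact
  interpret P': prob_space P' by fact
  define Z where "Z \<omega> = (\<Prod>k\<in>K. indicator (A k) (X k \<omega>) :: real)" for \<omega>
  define Z' where "Z' \<omega> = (\<Prod>k\<in>K. indicator (A k) (X' k \<omega>) :: real)" for \<omega>
  have kI: "k \<in> I" using insert by simp
  note [measurable] = meas(1)[OF kI] meas(2)[OF kI]
  have Ak[measurable]: "A k \<in> sets borel" using insert by simp
  have [measurable]: "Z \<in> borel_measurable P" "Z' \<in> borel_measurable P'"
    unfolding Z_def Z'_def using insert meas
    by (auto intro!: borel_measurable_prod borel_measurable_indicator' measurable_compose[OF _ borel_measurable_indicator])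
  have Z01: "0 \<le> Z \<omega>" "Z \<omega> \<le> 1" for \<omega>
    unfolding Z_def by (auto intro!: prod_nonneg prod_le_1)
  have Z'01: "0 \<le> Z' \<omega>" "Z' \<omega> \<le> 1" for \<omega>
    unfolding Z'_def by (auto intro!: prod_nonneg prod_le_1)
  have lin: "(\<integral>\<omega>. Z \<omega> * cos (v * X k \<omega> + c * (\<Sum>j\<in>J. u j * X j \<omega>) + \<theta>) \<partial>P) =
             (\<integral>\<omega>. Z' \<omega> * cos (v * X' k \<omega> + c * (\<Sum>j\<in>J. u j * X' j \<omega>) + \<theta>) \<partial>P')"
    if J: "finite J" "J \<subseteq> I" for J u v c \<theta>
  proof -
    \<comment> \<open>The coordinate \<open>k\<close> may already occur in \<open>J\<close>, so its coefficients are added.\<close>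
    define u' where "u' j = (if j = k then v else 0) + (if j \<in> J then c * u j else 0)" for j
    have s: "(\<Sum>j\<in>insert k J. u' j * x j) = v * x k + c * (\<Sum>j\<in>J. u j * x j)" for x
    proof -
      have "(\<Sum>j\<in>insert k J. u' j * x j) =
         (\<Sum>j\<in>insert k J. if j = k then v * x j else 0) + (\<Sum>j\<in>insert k J. if j \<in> J then c * u j * x j else 0)"
        unfolding u'_def sum.distrib[symmetric] by (intro sum.cong) (auto simp: distrib_right)
      also have "(\<Sum>j\<in>insert k J. if j = k then v * x j else 0) = v * x k"
        using J by (subst sum.delta) auto
      also have "(\<Sum>j\<in>insert k J. if j \<in> J then c * u j * x j else 0) = (\<Sum>j\<in>J. c * u j * x j)"
        using J by (intro sum.mono_neutral_cong_right) auto
      finally show ?thesis by (simp add: sum_distrib_left mult.assoc)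
    qed
    show ?thesis
      using insert.IH[of "insert k J" u' \<theta>] insert.prems J kI unfolding s Z_def Z'_def by auto
  qed
  have main: "(\<integral>\<omega>. Z \<omega> * (1 + cos (S \<omega> + \<theta>)) * indicator (A k) (X k \<omega>) \<partial>P) =
     (\<integral>\<omega>. Z' \<omega> * (1 + cos (S' \<omega> + \<theta>)) * indicator (A k) (X' k \<omega>) \<partial>P')"
    if J: "finite J" "J \<subseteq> I" and S: "S = (\<lambda>\<omega>. \<Sum>j\<in>J. u j * X j \<omega>)" and S': "S' = (\<lambda>\<omega>. \<Sum>j\<in>J. u j * X' j \<omega>)"
    for J u \<theta> S S'
  proof (rule weighted_distribution_eq[where c = 2, OF P])
    have [measurable]: "S \<in> borel_measurable P" "S' \<in> borel_measurable P'"
      unfolding S S' using meas J by (auto intro!: borel_measurable_sum borel_measurable_times)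
    show "(\<lambda>\<omega>. Z \<omega> * (1 + cos (S \<omega> + \<theta>))) \<in> borel_measurable P"
      "(\<lambda>\<omega>. Z' \<omega> * (1 + cos (S' \<omega> + \<theta>))) \<in> borel_measurable P'" by measurable
    have b: "0 \<le> 1 + cos y" "1 + cos y \<le> 2" for y :: real
      using cos_ge_minus_one[of y] cos_le_one[of y] by linarith+
    show "0 \<le> Z \<omega> * (1 + cos (S \<omega> + \<theta>)) \<and> Z \<omega> * (1 + cos (S \<omega> + \<theta>)) \<le> 2" for \<omega>
      using mult_mono[OF Z01(2) b(2) _ b(1)] Z01 b by auto
    show "0 \<le> Z' \<omega> * (1 + cos (S' \<omega> + \<theta>)) \<and> Z' \<omega> * (1 + cos (S' \<omega> + \<theta>)) \<le> 2" for \<omega>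
      using mult_mono[OF Z'01(2) b(2) _ b(1)] Z'01 b by auto
    fix v \<eta>
    have tr: "z * (1 + cos (s + \<theta>)) * cos (v * x + \<eta>) =
        z * cos (v * x + 0 * s + \<eta>) + (z * cos (v * x + 1 * s + (\<eta> + \<theta>)) / 2 + z * cos (v * x + (-1) * s + (\<eta> - \<theta>)) / 2)"
      for z s x :: real
    proof -
      have "cos (s + \<theta>) * cos (v * x + \<eta>) = (cos (v * x + \<eta> - (s + \<theta>)) + cos (v * x + \<eta> + (s + \<theta>))) / 2"
        using cos_times_cos[of "v * x + \<eta>" "s + \<theta>"] by (simp add: mult.commute)
      then show ?thesis by (simp add: algebra_simps add_divide_distrib)
    qed
    have i: "integrable P (\<lambda>\<omega>. Z \<omega> * cos (v * X k \<omega> + c * S \<omega> + t))" for c t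
      using Z01 by (intro P.integrable_const_bound[where B=1])
        (auto simp: abs_mult intro!: AE_I2 mult_le_one)
    have i': "integrable P' (\<lambda>\<omega>. Z' \<omega> * cos (v * X' k \<omega> + c * S' \<omega> + t))" for c t
      using Z'01 by (intro P'.integrable_const_bound[where B=1])
        (auto simp: abs_mult intro!: AE_I2 mult_le_one)
    show "(\<integral>\<omega>. Z \<omega> * (1 + cos (S \<omega> + \<theta>)) * cos (v * X k \<omega> + \<eta>) \<partial>P) =
          (\<integral>\<omega>. Z' \<omega> * (1 + cos (S' \<omega> + \<theta>)) * cos (v * X' k \<omega> + \<eta>) \<partial>P')"
      unfolding tr integral_with_halves[OF i i i] integral_with_halves[OF i' i' i']
      using lin[OF J] by (simp only: S S')
  qed (use Ak in simp_all)
  define S where "S = (\<lambda>\<omega>. \<Sum>j\<in>J. u j * X j \<omega>)"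
  define S' where "S' = (\<lambda>\<omega>. \<Sum>j\<in>J. u j * X' j \<omega>)"
  have [measurable]: "S \<in> borel_measurable P" "S' \<in> borel_measurable P'"
    unfolding S_def S'_def using meas insert.prems by (auto intro!: borel_measurable_sum borel_measurable_times)
  have i1: "integrable P (\<lambda>\<omega>. Z \<omega> * indicator (A k) (X k \<omega>))"
    using Z01 by (intro P.integrable_const_bound[where B=1]) (auto simp: abs_mult intro!: AE_I2 mult_le_one)
  have i1': "integrable P' (\<lambda>\<omega>. Z' \<omega> * indicator (A k) (X' k \<omega>))"
    using Z'01 by (intro P'.integrable_const_bound[where B=1]) (auto simp: abs_mult intro!: AE_I2 mult_le_one)
  have i2: "integrable P (\<lambda>\<omega>. indicator (A k) (X k \<omega>) * Z \<omega> * cos (S \<omega> + \<theta>))"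
    using Z01 by (intro P.integrable_const_bound[where B=1]) (auto simp: abs_mult intro!: AE_I2 mult_le_one)
  have i2': "integrable P' (\<lambda>\<omega>. indicator (A k) (X' k \<omega>) * Z' \<omega> * cos (S' \<omega> + \<theta>))"
    using Z'01 by (intro P'.integrable_const_bound[where B=1]) (auto simp: abs_mult intro!: AE_I2 mult_le_one)
  have "2 * (\<integral>\<omega>. Z \<omega> * indicator (A k) (X k \<omega>) \<partial>P) = 2 * (\<integral>\<omega>. Z' \<omega> * indicator (A k) (X' k \<omega>) \<partial>P')"
  proof -
    \<comment> \<open>For \<open>S = 0\<close> and \<open>\<theta> = 0\<close> the weight is \<open>2 Z\<close>.\<close>
    have t: "z * (1 + cos (0 + 0 :: real)) * y = 2 * (z * y)" for z y :: real by simp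
    show ?thesis using main[of "{}" "\<lambda>_. 0" u "\<lambda>_. 0" 0] unfolding t by simp
  qed
  moreover
  have "(\<integral>\<omega>. Z \<omega> * (1 + cos (S \<omega> + \<theta>)) * indicator (A k) (X k \<omega>) \<partial>P) =
        (\<integral>\<omega>. Z \<omega> * indicator (A k) (X k \<omega>) \<partial>P) + (\<integral>\<omega>. indicator (A k) (X k \<omega>) * Z \<omega> * cos (S \<omega> + \<theta>) \<partial>P)"
    by (subst Bochner_Integration.integral_add[OF i1 i2, symmetric]) (simp add: algebra_simps)
  moreover
  have "(\<integral>\<omega>. Z' \<omega> * (1 + cos (S' \<omega> + \<theta>)) * indicator (A k) (X' k \<omega>) \<partial>P') =
        (\<integral>\<omega>. Z' \<omega> * indicator (A k) (X' k \<omega>) \<partial>P') + (\<integral>\<omega>. indicator (A k) (X' k \<omega>) * Z' \<omega> * cos (S' \<omega> + \<theta>) \<partial>P')"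
    by (subst Bochner_Integration.integral_add[OF i1' i2', symmetric]) (simp add: algebra_simps)
  ultimately have "(\<integral>\<omega>. indicator (A k) (X k \<omega>) * Z \<omega> * cos (S \<omega> + \<theta>) \<partial>P) = (\<integral>\<omega>. indicator (A k) (X' k \<omega>) * Z' \<omega> * cos (S' \<omega> + \<theta>) \<partial>P')"
    using main[of J S u S' \<theta>] insert.prems S_def S'_def by simp
  then show ?case
    using insert.hyps by (simp add: Z_def Z'_def S_def S'_def)
qed

lemma emeasure_distr_cylinder:
  fixes Y :: "'i \<Rightarrow> 'a \<Rightarrow> real"
  assumes "prob_space Q" and Y: "\<And>i. i \<in> I \<Longrightarrow> Y i \<in> borel_measurable Q"
    and J: "finite J" "J \<subseteq> I" and A: "\<And>i. i \<in> J \<Longrightarrow> A i \<in> sets borel"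
  shows "emeasure (distr Q (Pi\<^sub>M I (\<lambda>_. borel)) (\<lambda>\<omega>. \<lambda>i\<in>I. Y i \<omega>)) (prod_emb I (\<lambda>_. borel) J (Pi\<^sub>E J A)) =
    ennreal (\<integral>\<omega>. (\<Prod>k\<in>J. indicator (A k) (Y k \<omega>)) \<partial>Q)"
proof -
  interpret prob_space Q by fact
  have m: "(\<lambda>\<omega>. \<lambda>i\<in>I. Y i \<omega>) \<in> Q \<rightarrow>\<^sub>M Pi\<^sub>M I (\<lambda>_. borel)"
    using Y by (intro measurable_restrict)
  have emb: "prod_emb I (\<lambda>_. borel) J (Pi\<^sub>E J A) \<in> sets (Pi\<^sub>M I (\<lambda>_. borel :: real measure))"
    using J A by (intro sets_PiM_I) auto
  define E where "E = (\<lambda>\<omega>. \<lambda>i\<in>I. Y i \<omega>) -` prod_emb I (\<lambda>_. borel) J (Pi\<^sub>E J A) \<inter> space Q"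
  have E: "E \<in> sets Q" unfolding E_def by (rule measurable_sets[OF m emb])
  have "(\<Prod>k\<in>J. indicator (A k) (Y k \<omega>)) = (indicator E \<omega> :: real)" if "\<omega> \<in> space Q" for \<omega>
  proof -
    have "(\<forall>k\<in>J. Y k \<omega> \<in> A k) \<longleftrightarrow> \<omega> \<in> E"
      using that J by (auto simp: E_def prod_emb_def PiE_iff restrict_def extensional_def subset_iff)
    moreover have "(\<Prod>k\<in>J. indicator (A k) (Y k \<omega>)) = (if \<forall>k\<in>J. Y k \<omega> \<in> A k then 1 else 0 :: real)"
      using J(1) by (auto simp: indicator_def intro!: prod.neutral)
    ultimately show ?thesis by (simp add: indicator_def)
  qed
  then have "(\<integral>\<omega>. (\<Prod>k\<in>J. indicator (A k) (Y k \<omega>)) \<partial>Q) = (\<integral>\<omega>. (indicator E \<omega> :: real) \<partial>Q)"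
    by (intro Bochner_Integration.integral_cong) auto
  also have "\<dots> = measure Q E" using E by simp
  finally show ?thesis
    by (simp add: emeasure_distr[OF m emb] E_def[symmetric] emeasure_eq_measure)
qed

text \<open>
  Cylinder sets generate the product \<open>\<sigma>\<close>-algebra, and their probabilities are the moments of products
  of indicators, without a cosine factor.
\<close>

lemma law_eq_of_cos_moments:
  fixes X :: "'i \<Rightarrow> 'a \<Rightarrow> real" and X' :: "'i \<Rightarrow> 'b \<Rightarrow> real"
  assumes P: "prob_space P" "prob_space P'"
    and meas: "\<And>i. i \<in> I \<Longrightarrow> X i \<in> borel_measurable P" "\<And>i. i \<in> I \<Longrightarrow> X' i \<in> borel_measurable P'"
    and eq: "\<And>J u \<theta>. finite J \<Longrightarrow> J \<subseteq> I \<Longrightarrow>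
      (\<integral>\<omega>. cos ((\<Sum>j\<in>J. u j * X j \<omega>) + \<theta>) \<partial>P) = (\<integral>\<omega>. cos ((\<Sum>j\<in>J. u j * X' j \<omega>) + \<theta>) \<partial>P')"
  shows "distr P (Pi\<^sub>M I (\<lambda>_. borel)) (\<lambda>\<omega>. \<lambda>i\<in>I. X i \<omega>) = distr P' (Pi\<^sub>M I (\<lambda>_. borel)) (\<lambda>\<omega>. \<lambda>i\<in>I. X' i \<omega>)"
proof (rule measure_eqI_PiM_infinite)
  have "(\<lambda>\<omega>. \<lambda>i\<in>I. X i \<omega>) \<in> P \<rightarrow>\<^sub>M Pi\<^sub>M I (\<lambda>_. borel)" using meas by (intro measurable_restrict)
  then show "finite_measure (distr P (Pi\<^sub>M I (\<lambda>_. borel)) (\<lambda>\<omega>. \<lambda>i\<in>I. X i \<omega>))"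
    using P by (intro finite_measure.finite_measure_distr prob_space.finite_measure)
  fix A :: "'i \<Rightarrow> real set" and J
  assume J: "finite J" "J \<subseteq> I" and A: "\<And>i. i \<in> J \<Longrightarrow> A i \<in> sets borel"
  have "(\<integral>\<omega>. (\<Prod>k\<in>J. indicator (A k) (X k \<omega>)) * cos ((\<Sum>j\<in>{}. 0 * X j \<omega>) + 0) \<partial>P) =
         (\<integral>\<omega>. (\<Prod>k\<in>J. indicator (A k) (X' k \<omega>)) * cos ((\<Sum>j\<in>{}. 0 * X' j \<omega>) + 0) \<partial>P')"
    by (rule indicator_cos_moments_eq[where I=I]) (use assms J A in auto)
  then show "emeasure (distr P (Pi\<^sub>M I (\<lambda>_. borel)) (\<lambda>\<omega>. \<lambda>i\<in>I. X i \<omega>)) (prod_emb I (\<lambda>_. borel) J (Pi\<^sub>E J A)) =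
    emeasure (distr P' (Pi\<^sub>M I (\<lambda>_. borel)) (\<lambda>\<omega>. \<lambda>i\<in>I. X' i \<omega>)) (prod_emb I (\<lambda>_. borel) J (Pi\<^sub>E J A))"
    using emeasure_distr_cylinder[OF P(1) meas(1) J A] emeasure_distr_cylinder[OF P(2) meas(2) J A] by simp
qed simp_all

section \<open>Gaussian families\<close>

lemma centered_normal_cos:
  assumes "prob_space P" "centered_normal P Y v"
  shows "(\<integral>\<omega>. cos (Y \<omega> + \<theta>) \<partial>P) = exp (- (v / 2)) * cos \<theta>"
proof -
  interpret prob_space P by fact
  have Y[measurable]: "Y \<in> borel_measurable P" using assms(2) by (simp add: centered_normal_def)
  have "(\<integral>\<omega>. iexp (Y \<omega>) \<partial>P) = char (distr P borel Y) 1"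
    by (simp add: char_def integral_distr)
  also have "\<dots> = complex_of_real (exp (- (v / 2)))"
    using assms(2) by (simp add: centered_normal_def)
  finally have c: "(\<integral>\<omega>. iexp (Y \<omega>) \<partial>P) = complex_of_real (exp (- (v / 2)))" .
  have i: "integrable P (\<lambda>\<omega>. iexp (Y \<omega>))"
    by (rule integrable_const_bound[where B=1]) auto
  have ic: "integrable P (\<lambda>\<omega>. cos (Y \<omega>))" and is': "integrable P (\<lambda>\<omega>. sin (Y \<omega>))"
    by (rule integrable_const_bound[where B=1]; simp)+
  have "(\<integral>\<omega>. cos (Y \<omega>) \<partial>P) = exp (- (v / 2))"
    using integral_Re[OF i] unfolding c by (simp add: Re_exp)
  moreover have "(\<integral>\<omega>. sin (Y \<omega>) \<partial>P) = 0"
    using integral_Im[OF i] unfolding c by (simp add: Im_exp)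
  ultimately show ?thesis using ic is' by (simp add: cos_add)
qed

text \<open>
  Finite linear combinations describe the joint law also where the covariance is singular and a joint
  density does not exist.
\<close>

definition gaussian_family ::
    "'a measure \<Rightarrow> 'i set \<Rightarrow> ('i \<Rightarrow> 'a \<Rightarrow> real) \<Rightarrow> ('i \<Rightarrow> 'i \<Rightarrow> real) \<Rightarrow> bool" where
  "gaussian_family P K X C \<longleftrightarrow>
     (\<forall>J u. finite J \<longrightarrow> J \<subseteq> K \<longrightarrow>
        centered_normal P (\<lambda>\<omega>. \<Sum>j\<in>J. u j * X j \<omega>) (\<Sum>i\<in>J. \<Sum>j\<in>J. u i * u j * C i j))"

lemma gaussian_family_single:
  assumes "gaussian_family P K X C" "i \<in> K"
  shows "centered_normal P (X i) (C i i)"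
  using assms unfolding gaussian_family_def by (auto dest!: spec[of _ "{i}"] spec[of _ "\<lambda>_. 1"])

lemma gaussian_family_measurable:
  assumes "gaussian_family P K X C" "i \<in> K"
  shows "X i \<in> borel_measurable P"
  using gaussian_family_single[OF assms] by (simp add: centered_normal_def)

lemma gaussian_family_law:
  assumes "prob_space P" "prob_space P'" and X: "gaussian_family P K X C" and X': "gaussian_family P' K X' C'"
    and C: "\<And>i j. i \<in> K \<Longrightarrow> j \<in> K \<Longrightarrow> C i j = C' i j"
  shows "distr P (Pi\<^sub>M K (\<lambda>_. borel)) (\<lambda>\<omega>. \<lambda>i\<in>K. X i \<omega>) = distr P' (Pi\<^sub>M K (\<lambda>_. borel)) (\<lambda>\<omega>. \<lambda>i\<in>K. X' i \<omega>)"
proof (rule law_eq_of_cos_moments[OF assms(1,2)])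
  fix J u \<theta> assume J: "finite J" "J \<subseteq> K"
  have e: "(\<Sum>i\<in>J. \<Sum>j\<in>J. u i * u j * C i j) = (\<Sum>i\<in>J. \<Sum>j\<in>J. u i * u j * C' i j)"
    using J C by (intro sum.cong) auto
  have "centered_normal P (\<lambda>\<omega>. \<Sum>j\<in>J. u j * X j \<omega>) (\<Sum>i\<in>J. \<Sum>j\<in>J. u i * u j * C' i j)"
    unfolding e[symmetric] using X J unfolding gaussian_family_def by blast
  moreover have "centered_normal P' (\<lambda>\<omega>. \<Sum>j\<in>J. u j * X' j \<omega>) (\<Sum>i\<in>J. \<Sum>j\<in>J. u i * u j * C' i j)"
    using X' J unfolding gaussian_family_def by blast
  ultimately show "(\<integral>\<omega>. cos ((\<Sum>j\<in>J. u j * X j \<omega>) + \<theta>) \<partial>P) = (\<integral>\<omega>. cos ((\<Sum>j\<in>J. u j * X' j \<omega>) + \<theta>) \<partial>P')"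
    using assms(1,2) by (simp add: centered_normal_cos)
qed (blast intro: gaussian_family_measurable[OF X] gaussian_family_measurable[OF X'])+

text \<open>
  On \<open>P \<Otimes> P\<close> let the variables with index in \<open>I\<close> depend on the first coordinate and \<open>X j\<close> on the
  second.  As the cross covariances vanish, this family has the same cosine moments as the original
  one, hence the same law; but there \<open>X j\<close> is independent of the others by construction.
\<close>

lemma gaussian_family_indep:
  fixes X :: "'b \<Rightarrow> 'a \<Rightarrow> real"
  assumes "prob_space P" and X: "gaussian_family P (insert j I) X C" and j: "j \<notin> I"
    and C: "\<And>i. i \<in> I \<Longrightarrow> C i j = 0" "\<And>i. i \<in> I \<Longrightarrow> C j i = 0"
  shows "distr P (Pi\<^sub>M I (\<lambda>_. borel) \<Otimes>\<^sub>M borel) (\<lambda>\<omega>. (\<lambda>i\<in>I. X i \<omega>, X j \<omega>)) =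
    distr P (Pi\<^sub>M I (\<lambda>_. borel)) (\<lambda>\<omega>. \<lambda>i\<in>I. X i \<omega>) \<Otimes>\<^sub>M distr P borel (X j)"
proof -
  interpret prob_space P by fact
  interpret PP: pair_prob_space P P ..
  have meas: "X i \<in> borel_measurable P" if "i \<in> insert j I" for i
    using X that by (rule gaussian_family_measurable)
  have mj[measurable]: "X j \<in> borel_measurable P" by (rule meas) simp
  have mI[measurable]: "(\<lambda>\<omega>. \<lambda>i\<in>I. X i \<omega>) \<in> P \<rightarrow>\<^sub>M Pi\<^sub>M I (\<lambda>_. borel)"
    using meas by (intro measurable_restrict) auto
  define X' where "X' i p = (if i = j then X j (snd p) else X i (fst p))" for i and p :: "'a \<times> 'a"
  have meas': "X' i \<in> borel_measurable (P \<Otimes>\<^sub>M P)" if "i \<in> insert j I" for i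
    using meas[OF that] unfolding X'_def by (cases "i = j") auto
  have eq: "distr P (Pi\<^sub>M (insert j I) (\<lambda>_. borel)) (\<lambda>\<omega>. \<lambda>i\<in>insert j I. X i \<omega>) =
      distr (P \<Otimes>\<^sub>M P) (Pi\<^sub>M (insert j I) (\<lambda>_. borel)) (\<lambda>\<omega>. \<lambda>i\<in>insert j I. X' i \<omega>)"
  proof (rule law_eq_of_cos_moments)
    show "prob_space P" "prob_space (P \<Otimes>\<^sub>M P)" by unfold_locales
    fix J and u :: "'b \<Rightarrow> real" and \<theta> assume J: "finite J" "J \<subseteq> insert j I"
    define J' where "J' = J - {j}"
    define a where "a = (if j \<in> J then u j else 0)"
    have J': "finite J'" "J' \<subseteq> I" "j \<notin> J'" using J by (auto simp: J'_def)
    have sJ: "(\<Sum>i\<in>J. u i * x i) = (\<Sum>i\<in>J'. u i * x i) + a * x j" for x :: "_ \<Rightarrow> real"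
      using J(1) by (cases "j \<in> J") (auto simp: J'_def a_def sum.remove[of J j])
    define S where "S \<omega> = (\<Sum>i\<in>J'. u i * X i \<omega>)" for \<omega>
    have [measurable]: "S \<in> borel_measurable P"
      unfolding S_def using meas J' by (auto intro!: borel_measurable_sum borel_measurable_times)
    have nS: "centered_normal P S (\<Sum>i\<in>J'. \<Sum>k\<in>J'. u i * u k * C i k)"
      using X J' unfolding gaussian_family_def S_def by blast
    have nj: "centered_normal P (\<lambda>\<omega>. a * X j \<omega>) (a * a * C j j)"
      using X unfolding gaussian_family_def by (auto dest!: spec[of _ "{j}"] spec[of _ "\<lambda>_. a"])
    have "centered_normal P (\<lambda>\<omega>. \<Sum>i\<in>J. u i * X i \<omega>) (\<Sum>i\<in>J. \<Sum>k\<in>J. u i * u k * C i k)"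
      using X J unfolding gaussian_family_def by blast
    moreover have "(\<Sum>i\<in>J. \<Sum>k\<in>J. u i * u k * C i k) = (\<Sum>i\<in>J'. \<Sum>k\<in>J'. u i * u k * C i k) + a * a * C j j"
    proof -
      have "(\<Sum>i\<in>J. \<Sum>k\<in>J. u i * u k * C i k) = (\<Sum>i\<in>J. u i * (\<Sum>k\<in>J. u k * C i k))"
        by (simp add: sum_distrib_left mult.assoc)
      also have "\<dots> = (\<Sum>i\<in>J'. u i * (\<Sum>k\<in>J. u k * C i k)) + a * (\<Sum>k\<in>J. u k * C j k)"
        by (rule sJ)
      also have "(\<Sum>i\<in>J'. u i * (\<Sum>k\<in>J. u k * C i k)) = (\<Sum>i\<in>J'. u i * (\<Sum>k\<in>J'. u k * C i k))"
        using C J' by (intro sum.cong refl) (auto simp: sJ)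
      also have "(\<Sum>k\<in>J. u k * C j k) = a * C j j"
        using C J' by (subst sJ) (auto intro!: sum.neutral)
      finally show ?thesis by (simp add: sum_distrib_left mult.assoc)
    qed
    ultimately have L: "(\<integral>\<omega>. cos ((\<Sum>i\<in>J. u i * X i \<omega>) + \<theta>) \<partial>P) =
        exp (- (a * a * C j j / 2)) * (exp (- ((\<Sum>i\<in>J'. \<Sum>k\<in>J'. u i * u k * C i k) / 2)) * cos \<theta>)"
      using assms(1) by (simp add: centered_normal_cos exp_add[symmetric] add_divide_distrib)
    have "(\<integral>p. cos ((\<Sum>i\<in>J. u i * X' i p) + \<theta>) \<partial>(P \<Otimes>\<^sub>M P)) =
        (\<integral>p. (case p of (x, y) \<Rightarrow> cos (a * X j y + (S x + \<theta>))) \<partial>(P \<Otimes>\<^sub>M P))"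
    proof (rule Bochner_Integration.integral_cong[OF refl])
      fix p :: "'a \<times> 'a"
      have "(\<Sum>i\<in>J'. u i * X' i p) = S (fst p)"
        unfolding S_def X'_def using J' by (intro sum.cong) auto
      then show "cos ((\<Sum>i\<in>J. u i * X' i p) + \<theta>) = (case p of (x, y) \<Rightarrow> cos (a * X j y + (S x + \<theta>)))"
        unfolding sJ by (simp add: X'_def split: prod.split) (simp add: ac_simps)
    qed
    also have "\<dots> = (\<integral>x. (\<integral>y. cos (a * X j y + (S x + \<theta>)) \<partial>P) \<partial>P)"
    proof -
      have "integrable (P \<Otimes>\<^sub>M P) (\<lambda>(x, y). cos (a * X j y + (S x + \<theta>)))"
        by (rule PP.integrable_const_bound[where B=1]) (auto simp: split_beta')
      from PP.integral_fst'[OF this] show ?thesis by simp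
    qed
    also have "\<dots> = (\<integral>x. exp (- (a * a * C j j / 2)) * cos (S x + \<theta>) \<partial>P)"
      using centered_normal_cos[OF assms(1) nj] by simp
    also have "\<dots> = exp (- (a * a * C j j / 2)) * (exp (- ((\<Sum>i\<in>J'. \<Sum>k\<in>J'. u i * u k * C i k) / 2)) * cos \<theta>)"
      using centered_normal_cos[OF assms(1) nS] by simp
    finally show "(\<integral>\<omega>. cos ((\<Sum>i\<in>J. u i * X i \<omega>) + \<theta>) \<partial>P) = (\<integral>\<omega>. cos ((\<Sum>i\<in>J. u i * X' i \<omega>) + \<theta>) \<partial>(P \<Otimes>\<^sub>M P))"
      using L by simp
  qed (use meas meas' in auto)
  \<comment> \<open>Splitting off the coordinate \<open>j\<close> carries the equality of laws on \<open>insert j I\<close> to the pair.\<close>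
  define h where "h x = (restrict x I, x j)" for x :: "_ \<Rightarrow> real"
  have h[measurable]: "h \<in> Pi\<^sub>M (insert j I) (\<lambda>_. borel) \<rightarrow>\<^sub>M Pi\<^sub>M I (\<lambda>_. borel) \<Otimes>\<^sub>M borel"
    unfolding h_def by (intro measurable_Pair measurable_restrict_subset measurable_component_singleton) auto
  have mX: "(\<lambda>\<omega>. \<lambda>i\<in>insert j I. X i \<omega>) \<in> P \<rightarrow>\<^sub>M Pi\<^sub>M (insert j I) (\<lambda>_. borel)"
    using meas by (intro measurable_restrict) auto
  have mX': "(\<lambda>\<omega>. \<lambda>i\<in>insert j I. X' i \<omega>) \<in> (P \<Otimes>\<^sub>M P) \<rightarrow>\<^sub>M Pi\<^sub>M (insert j I) (\<lambda>_. borel)"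
    using meas' by (intro measurable_restrict) auto
  have "distr P (Pi\<^sub>M I (\<lambda>_. borel) \<Otimes>\<^sub>M borel) (\<lambda>\<omega>. (\<lambda>i\<in>I. X i \<omega>, X j \<omega>)) =
      distr (distr P (Pi\<^sub>M (insert j I) (\<lambda>_. borel)) (\<lambda>\<omega>. \<lambda>i\<in>insert j I. X i \<omega>)) (Pi\<^sub>M I (\<lambda>_. borel) \<Otimes>\<^sub>M borel) h"
    by (subst distr_distr[OF h mX]) (auto simp: h_def o_def restrict_def fun_eq_iff intro!: distr_cong)
  also have "\<dots> = distr (P \<Otimes>\<^sub>M P) (Pi\<^sub>M I (\<lambda>_. borel) \<Otimes>\<^sub>M borel) (\<lambda>p. h (\<lambda>i\<in>insert j I. X' i p))"
    unfolding eq by (subst distr_distr[OF h mX']) (simp add: o_def)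
  also have "\<dots> = distr (P \<Otimes>\<^sub>M P) (Pi\<^sub>M I (\<lambda>_. borel) \<Otimes>\<^sub>M borel) (\<lambda>(x, y). (\<lambda>i\<in>I. X i x, X j y))"
    using j by (intro distr_cong) (auto simp: h_def X'_def restrict_def fun_eq_iff)
  also have "\<dots> = distr P (Pi\<^sub>M I (\<lambda>_. borel)) (\<lambda>\<omega>. \<lambda>i\<in>I. X i \<omega>) \<Otimes>\<^sub>M distr P borel (X j)"
    by (rule pair_measure_distr[symmetric, OF mI mj])
       (rule prob_space_imp_sigma_finite, rule prob_space_distr, rule mj)
  finally show ?thesis .
qed

lemma indep_var_compose_pair:
  assumes "prob_space P" and X[measurable]: "X \<in> P \<rightarrow>\<^sub>M S" and Y[measurable]: "Y \<in> P \<rightarrow>\<^sub>M S'"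
    and eq: "distr P (S \<Otimes>\<^sub>M S') (\<lambda>\<omega>. (X \<omega>, Y \<omega>)) = distr P S X \<Otimes>\<^sub>M distr P S' Y"
    and f[measurable]: "f \<in> S \<rightarrow>\<^sub>M R" and g[measurable]: "g \<in> S' \<rightarrow>\<^sub>M R'"
  shows "prob_space.indep_var P R (\<lambda>\<omega>. f (X \<omega>)) R' (\<lambda>\<omega>. g (Y \<omega>))"
proof -
  interpret prob_space P by fact
  have "distr P R (\<lambda>\<omega>. f (X \<omega>)) \<Otimes>\<^sub>M distr P R' (\<lambda>\<omega>. g (Y \<omega>)) =
      distr (distr P S X) R f \<Otimes>\<^sub>M distr (distr P S' Y) R' g"
    by (simp add: distr_distr o_def)
  also have "\<dots> = distr (distr P S X \<Otimes>\<^sub>M distr P S' Y) (R \<Otimes>\<^sub>M R') (\<lambda>(x, y). (f x, g y))"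
    by (rule pair_measure_distr) 
      (simp_all add: distr_distr o_def prob_space_distr prob_space_imp_sigma_finite)
  also have "\<dots> = distr P (R \<Otimes>\<^sub>M R') (\<lambda>\<omega>. (f (X \<omega>), g (Y \<omega>)))"
    unfolding eq[symmetric] by (subst distr_distr) (auto simp: o_def)
  finally show ?thesis by (simp add: indep_var_distribution_eq)
qed

section \<open>Mean square distance\<close>

text \<open>
  The square of the \<open>L\<^sup>2\<close> distance, with value \<open>\<infinity>\<close> allowed: convergence of approximations is
  expressed before square integrability is known.
\<close>

definition sqdist :: "'a measure \<Rightarrow> ('a \<Rightarrow> real) \<Rightarrow> ('a \<Rightarrow> real) \<Rightarrow> ennreal" where
  "sqdist M f g = (\<integral>\<^sup>+ x. ennreal ((f x - g x)\<^sup>2) \<partial>M)"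

lemma sqdist_commute: "sqdist M f g = sqdist M g f"
  by (simp add: sqdist_def power2_commute)

lemma sqdist_self [simp]: "sqdist M f f = 0"
  by (simp add: sqdist_def)

lemma sqdist_cong_AE:
  "AE x in M. f x = f' x \<Longrightarrow> AE x in M. g x = g' x \<Longrightarrow> sqdist M f g = sqdist M f' g'"
  unfolding sqdist_def by (rule nn_integral_cong_AE) auto

lemma sqdist_add:
  assumes [measurable]: "f \<in> borel_measurable M" "g \<in> borel_measurable M"
    "f' \<in> borel_measurable M" "g' \<in> borel_measurable M"
  shows "sqdist M (\<lambda>x. f x + f' x) (\<lambda>x. g x + g' x) \<le> 2 * sqdist M f g + 2 * sqdist M f' g'"
proof -
  have "ennreal ((f x + f' x - (g x + g' x))\<^sup>2) \<le> 2 * ennreal ((f x - g x)\<^sup>2) + 2 * ennreal ((f' x - g' x)\<^sup>2)" for x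
  proof -
    have "(f x + f' x - (g x + g' x))\<^sup>2 \<le> 2 * (f x - g x)\<^sup>2 + 2 * (f' x - g' x)\<^sup>2"
      using sum_squares_bound[of "f x - g x" "f' x - g' x"] by (simp add: power2_eq_square algebra_simps)
    then have "ennreal ((f x + f' x - (g x + g' x))\<^sup>2) \<le> ennreal (2 * (f x - g x)\<^sup>2 + 2 * (f' x - g' x)\<^sup>2)"
      by (rule ennreal_leI)
    then show ?thesis by (simp add: ennreal_plus ennreal_mult)
  qed
  then have "sqdist M (\<lambda>x. f x + f' x) (\<lambda>x. g x + g' x) \<le>
      (\<integral>\<^sup>+x. 2 * ennreal ((f x - g x)\<^sup>2) + 2 * ennreal ((f' x - g' x)\<^sup>2) \<partial>M)"
    unfolding sqdist_def by (rule nn_integral_mono)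
  also have "\<dots> = 2 * sqdist M f g + 2 * sqdist M f' g'"
    unfolding sqdist_def by (simp add: nn_integral_add nn_integral_cmult)
  finally show ?thesis .
qed

lemma sqdist_triangle:
  assumes "f \<in> borel_measurable M" "g \<in> borel_measurable M" "h \<in> borel_measurable M"
  shows "sqdist M f h \<le> 2 * sqdist M f g + 2 * sqdist M g h"
proof -
  have "sqdist M f h = sqdist M (\<lambda>x. f x + g x) (\<lambda>x. g x + h x)"
    unfolding sqdist_def by (simp add: algebra_simps)
  also have "\<dots> \<le> 2 * sqdist M f g + 2 * sqdist M g h"
    using assms by (intro sqdist_add) auto
  finally show ?thesis .
qed

lemma sqdist_cmult:
  assumes [measurable]: "f \<in> borel_measurable M" "g \<in> borel_measurable M"
  shows "sqdist M (\<lambda>x. c * f x) (\<lambda>x. c * g x) = ennreal (c\<^sup>2) * sqdist M f g"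
  unfolding sqdist_def right_diff_distrib[symmetric] power_mult_distrib
  by (subst nn_integral_cmult[symmetric]) (auto simp: ennreal_mult)

lemma square_integrable_iff:
  assumes [measurable]: "f \<in> borel_measurable M"
  shows "integrable M (\<lambda>x. (f x)\<^sup>2) \<longleftrightarrow> sqdist M f (\<lambda>_. 0) < \<infinity>"
  unfolding integrable_iff_bounded sqdist_def by simp

lemma square_integrable_mult:
  fixes f g :: "'a \<Rightarrow> real"
  assumes [measurable]: "f \<in> borel_measurable M" "g \<in> borel_measurable M"
    and "integrable M (\<lambda>x. (f x)\<^sup>2)" "integrable M (\<lambda>x. (g x)\<^sup>2)"
  shows "integrable M (\<lambda>x. f x * g x)"
proof (rule Bochner_Integration.integrable_bound[OF Bochner_Integration.integrable_add[OF assms(3,4)]])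
  show "AE x in M. norm (f x * g x) \<le> norm ((f x)\<^sup>2 + (g x)\<^sup>2)"
  proof (rule AE_I2)
    fix x
    have "2 * (\<bar>f x\<bar> * \<bar>g x\<bar>) \<le> \<bar>f x\<bar>\<^sup>2 + \<bar>g x\<bar>\<^sup>2" using sum_squares_bound[of "\<bar>f x\<bar>" "\<bar>g x\<bar>"] by simp
    moreover have "0 \<le> \<bar>f x\<bar> * \<bar>g x\<bar>" by simp
    ultimately have "\<bar>f x\<bar> * \<bar>g x\<bar> \<le> (f x)\<^sup>2 + (g x)\<^sup>2" unfolding power2_abs by linarith
    then show "norm (f x * g x) \<le> norm ((f x)\<^sup>2 + (g x)\<^sup>2)" unfolding real_norm_def abs_mult by simp
  qed
qed simp

lemma ennreal_square_le_D: "(x::ennreal)\<^sup>2 \<le> y\<^sup>2 \<Longrightarrow> x \<le> y"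
proof (rule ccontr)
  assume "x\<^sup>2 \<le> y\<^sup>2" "\<not> x \<le> y"
  then have "y < x" by simp
  then have "y \<noteq> top" by auto
  then have "y\<^sup>2 < x\<^sup>2"
    using \<open>y < x\<close> by (cases x; cases y) (auto simp: ennreal_power ennreal_less_iff power_strict_mono)
  then show False using \<open>x\<^sup>2 \<le> y\<^sup>2\<close> by simp
qed

lemma tendsto_0_of_square_le:
  fixes x a :: "nat \<Rightarrow> ennreal"
  assumes "a \<longlonglongrightarrow> 0" "\<And>n. (x n)\<^sup>2 \<le> a n"
  shows "x \<longlonglongrightarrow> 0"
proof (rule order_tendstoI)
  fix e :: ennreal assume "0 < e"
  then have "0 < e\<^sup>2" by (simp add: zero_less_iff_neq_zero)
  then have "eventually (\<lambda>n. a n < e\<^sup>2) sequentially" using order_tendstoD(2)[OF assms(1)] by blast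
  then show "eventually (\<lambda>n. x n < e) sequentially"
  proof eventually_elim
    case (elim n)
    have "\<not> e \<le> x n"
    proof
      assume "e \<le> x n"
      then have "e\<^sup>2 \<le> (x n)\<^sup>2" by (intro power_mono) auto
      then show False using assms(2)[of n] elim by (meson leD order_trans)
    qed
    then show ?case by simp
  qed
qed simp

lemma tendsto_0_mono:
  fixes x a :: "nat \<Rightarrow> ennreal"
  assumes "a \<longlonglongrightarrow> 0" "\<And>n. x n \<le> a n"
  shows "x \<longlonglongrightarrow> 0"
  by (rule tendsto_sandwich[OF _ _ tendsto_const assms(1)]) (simp_all add: assms(2))

lemma tendsto_0_cmult:
  fixes a :: "nat \<Rightarrow> ennreal"
  assumes "a \<longlonglongrightarrow> 0" "c < \<infinity>"
  shows "(\<lambda>n. c * a n) \<longlonglongrightarrow> 0"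
  using ennreal_tendsto_cmult[of c a 0] assms by simp

lemma tendsto_0_add:
  fixes a :: "nat \<Rightarrow> ennreal"
  assumes "a \<longlonglongrightarrow> 0" "b \<longlonglongrightarrow> 0"
  shows "(\<lambda>n. a n + b n) \<longlonglongrightarrow> 0"
  using tendsto_add[OF assms] by simp

lemma L1_le_sqdist:
  assumes [measurable]: "f \<in> borel_measurable M" "g \<in> borel_measurable M"
  shows "(\<integral>\<^sup>+x. ennreal \<bar>f x - g x\<bar> \<partial>M)\<^sup>2 \<le> emeasure M (space M) * sqdist M f g"
proof -
  have "(\<integral>\<^sup>+x. 1 * ennreal \<bar>f x - g x\<bar> \<partial>M)\<^sup>2 \<le> (\<integral>\<^sup>+x. 1\<^sup>2 \<partial>M) * (\<integral>\<^sup>+x. (ennreal \<bar>f x - g x\<bar>)\<^sup>2 \<partial>M)"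
    by (rule Cauchy_Schwarz_nn_integral) auto
  then show ?thesis by (simp add: sqdist_def ennreal_power)
qed

text \<open>
  By Cauchy-Schwarz, \<open>(\<integral> \<bar>g\<^sub>n\<^sup>2 - f\<^sup>2\<bar>)\<^sup>2 \<le> \<integral> (f - g\<^sub>n)\<^sup>2 \<integral> (g\<^sub>n + f)\<^sup>2\<close>, where the last factor stays
  bounded since \<open>g\<^sub>n + f = (g\<^sub>n - f) + 2 f\<close>.
\<close>

lemma sqdist_tendsto_integral_square:
  assumes [measurable]: "f \<in> borel_measurable M" "\<And>n. g n \<in> borel_measurable M"
    and g2: "\<And>n. integrable M (\<lambda>x. (g n x)\<^sup>2)" and lim: "(\<lambda>n. sqdist M f (g n)) \<longlonglongrightarrow> 0"
  shows "integrable M (\<lambda>x. (f x)\<^sup>2)" "(\<lambda>n. \<integral>x. (g n x)\<^sup>2 \<partial>M) \<longlonglongrightarrow> (\<integral>x. (f x)\<^sup>2 \<partial>M)"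
proof -
  have "eventually (\<lambda>n. sqdist M f (g n) < 1) sequentially"
    using order_tendstoD(2)[OF lim, of 1] by simp
  then obtain n where n: "sqdist M f (g n) < 1" by (auto simp: eventually_sequentially)
  have "sqdist M f (\<lambda>_. 0) \<le> 2 * sqdist M f (g n) + 2 * sqdist M (g n) (\<lambda>_. 0)"
    by (intro sqdist_triangle) auto
  also have "\<dots> < \<infinity>"
    using n g2[of n] by (auto simp: square_integrable_iff ennreal_mult_eq_top_iff less_top[symmetric])
  finally show f2: "integrable M (\<lambda>x. (f x)\<^sup>2)" by (simp add: square_integrable_iff)
  define B where "B = sqdist M (\<lambda>x. 2 * f x) (\<lambda>_. 0)"
  have B: "B < \<infinity>" using sqdist_cmult[of f M "\<lambda>_. 0" 2] f2
    by (simp add: B_def square_integrable_iff ennreal_mult_less_top)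
  define a where "a n = sqdist M f (g n)" for n
  have "(\<integral>\<^sup>+x. norm ((g n x)\<^sup>2 - (f x)\<^sup>2) \<partial>M)\<^sup>2 \<le> a n * (2 * a n + 2 * B)" for n
  proof -
    have "(\<integral>\<^sup>+x. norm ((g n x)\<^sup>2 - (f x)\<^sup>2) \<partial>M)\<^sup>2 =
        (\<integral>\<^sup>+x. ennreal \<bar>f x - g n x\<bar> * ennreal \<bar>g n x + f x\<bar> \<partial>M)\<^sup>2"
    proof -
      have "norm ((g n x)\<^sup>2 - (f x)\<^sup>2) = \<bar>f x - g n x\<bar> * \<bar>g n x + f x\<bar>" for x
      proof -
        have "(g n x)\<^sup>2 - (f x)\<^sup>2 = - ((f x - g n x) * (g n x + f x))" by (simp add: power2_eq_square algebra_simps)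
        then show ?thesis by (simp only: real_norm_def abs_minus abs_mult)
      qed
      then show ?thesis by (simp only: ennreal_mult abs_ge_zero)
    qed
    also have "\<dots> \<le> (\<integral>\<^sup>+x. (ennreal \<bar>f x - g n x\<bar>)\<^sup>2 \<partial>M) * (\<integral>\<^sup>+x. (ennreal \<bar>g n x + f x\<bar>)\<^sup>2 \<partial>M)"
      by (rule Cauchy_Schwarz_nn_integral) auto
    also have "(\<integral>\<^sup>+x. (ennreal \<bar>f x - g n x\<bar>)\<^sup>2 \<partial>M) = a n"
      by (simp add: a_def sqdist_def ennreal_power)
    also have "(\<integral>\<^sup>+x. (ennreal \<bar>g n x + f x\<bar>)\<^sup>2 \<partial>M) = sqdist M (\<lambda>x. g n x + 2 * f x) (\<lambda>x. f x + 0)"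
      by (simp add: sqdist_def ennreal_power algebra_simps)
    also have "\<dots> \<le> 2 * a n + 2 * B"
      using sqdist_add[of "g n" M f "\<lambda>x. 2 * f x" "\<lambda>x. 0"] by (simp add: a_def B_def sqdist_commute)
    finally show ?thesis by (simp add: mult_left_mono)
  qed
  moreover have "(\<lambda>n. a n * (2 * a n + 2 * B)) \<longlonglongrightarrow> 0"
  proof -
    have a: "a \<longlonglongrightarrow> 0" using lim by (simp add: a_def[abs_def])
    have "(\<lambda>n. 2 * a n + 2 * B) \<longlonglongrightarrow> 2 * 0 + 2 * B"
      by (intro tendsto_add tendsto_const ennreal_tendsto_cmult a) simp
    then have "(\<lambda>n. a n * (2 * a n + 2 * B)) \<longlonglongrightarrow> 0 * (2 * 0 + 2 * B)"
      using B by (intro tendsto_mult_ennreal a) (auto simp: ennreal_mult_eq_top_iff)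
    then show ?thesis by simp
  qed
  ultimately have "(\<lambda>n. \<integral>\<^sup>+x. norm ((g n x)\<^sup>2 - (f x)\<^sup>2) \<partial>M) \<longlonglongrightarrow> 0"
    by (rule tendsto_0_of_square_le[rotated])
  then show "(\<lambda>n. \<integral>x. (g n x)\<^sup>2 \<partial>M) \<longlonglongrightarrow> (\<integral>x. (f x)\<^sup>2 \<partial>M)"
    by (intro tendsto_L1_int g2 f2)
qed

text \<open>
  Convergence in mean square implies convergence in \<open>L\<^sup>1\<close>, and \<open>x \<mapsto> exp (i u x)\<close> is Lipschitz, so the
  characteristic functions converge.
\<close>

lemma centered_normal_limit:
  assumes "prob_space P" and Y: "Y \<in> borel_measurable P"
    and lim: "(\<lambda>n. sqdist P Y (Z n)) \<longlonglongrightarrow> 0"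
    and Z: "\<And>n. centered_normal P (Z n) (v n)" and v: "v \<longlonglongrightarrow> w"
  shows "centered_normal P Y w"
proof -
  interpret prob_space P by fact
  note Y[measurable]
  have [measurable]: "Z n \<in> borel_measurable P" for n using Z by (simp add: centered_normal_def)
  have "char (distr P borel Y) u = complex_of_real (exp (- (u\<^sup>2 * w / 2)))" for u
  proof -
    have L1: "(\<lambda>n. \<integral>\<^sup>+x. ennreal \<bar>Y x - Z n x\<bar> \<partial>P) \<longlonglongrightarrow> 0"
      by (rule tendsto_0_of_square_le[OF lim]) (use L1_le_sqdist[of Y P] in \<open>simp add: emeasure_space_1\<close>)
    have "(\<lambda>n. \<integral>\<omega>. iexp (u * Z n \<omega>) \<partial>P) \<longlonglongrightarrow> (\<integral>\<omega>. iexp (u * Y \<omega>) \<partial>P)"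
    proof (rule tendsto_L1_int)
      show "integrable P (\<lambda>\<omega>. iexp (u * Z n \<omega>))" "integrable P (\<lambda>\<omega>. iexp (u * Y \<omega>))" for n
        by (rule integrable_const_bound[where B=1]; simp)+
      have "(\<integral>\<^sup>+\<omega>. norm (iexp (u * Z n \<omega>) - iexp (u * Y \<omega>)) \<partial>P) \<le> ennreal \<bar>u\<bar> * (\<integral>\<^sup>+x. ennreal \<bar>Y x - Z n x\<bar> \<partial>P)" for n
      proof -
        have "norm (iexp (u * Z n \<omega>) - iexp (u * Y \<omega>)) \<le> \<bar>u\<bar> * \<bar>Y \<omega> - Z n \<omega>\<bar>" for \<omega>
        proof -
          have "iexp (u * Z n \<omega>) - iexp (u * Y \<omega>) = iexp (u * Y \<omega>) * (iexp (u * Z n \<omega> - u * Y \<omega>) - 1)"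
            by (simp add: algebra_simps exp_add[symmetric])
          then have "norm (iexp (u * Z n \<omega>) - iexp (u * Y \<omega>)) = norm (iexp (u * Z n \<omega> - u * Y \<omega>) - 1)"
            by (simp add: norm_mult)
          also have "\<dots> \<le> \<bar>u * Z n \<omega> - u * Y \<omega>\<bar>"
            using iexp_approx1[of "u * Z n \<omega> - u * Y \<omega>" 0] by simp
          also have "\<dots> = \<bar>u\<bar> * \<bar>Y \<omega> - Z n \<omega>\<bar>"
            by (simp add: right_diff_distrib[symmetric] abs_mult abs_minus_commute)
          finally show ?thesis .
        qed
        then have "(\<integral>\<^sup>+\<omega>. norm (iexp (u * Z n \<omega>) - iexp (u * Y \<omega>)) \<partial>P) \<le> (\<integral>\<^sup>+\<omega>. ennreal \<bar>u\<bar> * ennreal \<bar>Y \<omega> - Z n \<omega>\<bar> \<partial>P)"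
          by (intro nn_integral_mono) (simp add: ennreal_mult[symmetric] ennreal_leI)
        then show ?thesis by (simp add: nn_integral_cmult)
      qed
      then show "(\<lambda>n. \<integral>\<^sup>+\<omega>. norm (iexp (u * Z n \<omega>) - iexp (u * Y \<omega>)) \<partial>P) \<longlonglongrightarrow> 0"
        by (rule tendsto_0_mono[rotated]) (rule tendsto_0_cmult[OF L1], simp)
    qed
    moreover have "(\<integral>\<omega>. iexp (u * Z n \<omega>) \<partial>P) = complex_of_real (exp (- (u\<^sup>2 * v n / 2)))" for n
      using Z[of n] unfolding centered_normal_def char_def by (subst (asm) integral_distr) auto
    moreover have "(\<lambda>n. complex_of_real (exp (- (u\<^sup>2 * v n / 2)))) \<longlonglongrightarrow> complex_of_real (exp (- (u\<^sup>2 * w / 2)))"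
      by (intro tendsto_intros v) simp
    ultimately have "(\<integral>\<omega>. iexp (u * Y \<omega>) \<partial>P) = complex_of_real (exp (- (u\<^sup>2 * w / 2)))"
      using LIMSEQ_unique by simp
    then show ?thesis unfolding char_def by (subst integral_distr) auto
  qed
  then show ?thesis by (simp add: centered_normal_def)
qed

text \<open>
  For a Cauchy sequence with geometric rate the increments have a finite sum of \<open>L\<^sup>1\<close> norms, so the
  sequence converges almost surely; Fatou's lemma then bounds the distance to the limit.
\<close>

lemma sqdist_complete:
  assumes "prob_space P" and [measurable]: "\<And>n. I n \<in> borel_measurable P" and c: "0 \<le> c"
    and cauchy: "\<And>n m. n \<le> m \<Longrightarrow> sqdist P (I n) (I m) \<le> ennreal (c * (1 / 4) ^ n)"
  shows "\<exists>J\<in>borel_measurable P. (\<lambda>n. sqdist P J (I n)) \<longlonglongrightarrow> 0"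
proof -
  interpret prob_space P by fact
  have L1: "(\<integral>\<^sup>+x. ennreal \<bar>I (Suc n) x - I n x\<bar> \<partial>P) \<le> ennreal (sqrt c * (1 / 2) ^ n)" for n
  proof (rule ennreal_square_le_D)
    have "(\<integral>\<^sup>+x. ennreal \<bar>I (Suc n) x - I n x\<bar> \<partial>P)\<^sup>2 \<le> sqdist P (I n) (I (Suc n))"
      using L1_le_sqdist[of "I (Suc n)" P "I n"] by (simp add: emeasure_space_1 sqdist_commute)
    also have "\<dots> \<le> ennreal (c * (1 / 4) ^ n)" by (rule cauchy) simp
    also have "c * (1 / 4) ^ n = (sqrt c * (1 / 2) ^ n)\<^sup>2"
    proof -
      have "(1 / 4 :: real) ^ n = ((1 / 2) ^ n)\<^sup>2"
        unfolding power2_eq_square power_mult_distrib[symmetric] by simp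
      then show ?thesis using c by (simp only: power_mult_distrib real_sqrt_pow2)
    qed
    finally show "(\<integral>\<^sup>+x. ennreal \<bar>I (Suc n) x - I n x\<bar> \<partial>P)\<^sup>2 \<le> (ennreal (sqrt c * (1 / 2) ^ n))\<^sup>2"
      using c by (simp add: ennreal_power)
  qed
  have "(\<integral>\<^sup>+x. (\<Sum>n. ennreal \<bar>I (Suc n) x - I n x\<bar>) \<partial>P) = (\<Sum>n. \<integral>\<^sup>+x. ennreal \<bar>I (Suc n) x - I n x\<bar> \<partial>P)"
    by (rule nn_integral_suminf) simp
  also have "\<dots> \<le> (\<Sum>n. ennreal (sqrt c * (1 / 2) ^ n))"
    by (intro suminf_le L1 summableI)
  also have "\<dots> < \<infinity>"
  proof -
    have "summable (\<lambda>n. sqrt c * (1 / 2) ^ n :: real)" by (intro summable_mult summable_geometric) simp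
    then have "(\<Sum>n. ennreal (sqrt c * (1 / 2) ^ n)) \<noteq> top" using c by (intro ennreal_suminf_neq_top) auto
    then show ?thesis by (simp only: less_top infinity_ennreal_def)
  qed
  finally have "AE x in P. (\<Sum>n. ennreal \<bar>I (Suc n) x - I n x\<bar>) \<noteq> \<infinity>"
    by (intro nn_integral_PInf_AE) auto
  then have conv: "AE x in P. (\<lambda>n. I n x) \<longlonglongrightarrow> lim (\<lambda>n. I n x)"
  proof eventually_elim
    case (elim x)
    then have "summable (\<lambda>n. \<bar>I (Suc n) x - I n x\<bar>)"
      by (intro summable_suminf_not_top) auto
    then have "summable (\<lambda>n. I (Suc n) x - I n x)" by (rule summable_rabs_cancel)
    then have "convergent (\<lambda>n. \<Sum>k<n. I (Suc k) x - I k x)" by (simp add: summable_iff_convergent)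
    then have "convergent (\<lambda>n. I n x - I 0 x + I 0 x)"
      unfolding sum_lessThan_telescope[of "\<lambda>n. I n x"] by (intro convergent_add convergent_const)
    then show ?case by (simp add: convergent_LIMSEQ_iff)
  qed
  define J where "J x = lim (\<lambda>n. I n x)" for x
  have [measurable]: "J \<in> borel_measurable P" unfolding J_def by simp
  have bound: "sqdist P J (I n) \<le> ennreal (c * (1 / 4) ^ n)" for n
  proof -
    have "sqdist P J (I n) = (\<integral>\<^sup>+x. liminf (\<lambda>m. ennreal ((I m x - I n x)\<^sup>2)) \<partial>P)"
      unfolding sqdist_def
    proof (rule nn_integral_cong_AE)
      show "AE x in P. ennreal ((J x - I n x)\<^sup>2) = liminf (\<lambda>m. ennreal ((I m x - I n x)\<^sup>2))"
        using conv
      proof eventually_elim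
        case (elim x)
        then have "(\<lambda>m. ennreal ((I m x - I n x)\<^sup>2)) \<longlonglongrightarrow> ennreal ((J x - I n x)\<^sup>2)"
          unfolding J_def by (intro tendsto_ennrealI tendsto_intros)
        then show ?case by (intro lim_imp_Liminf[symmetric]) auto
      qed
    qed
    also have "\<dots> \<le> liminf (\<lambda>m. \<integral>\<^sup>+x. ennreal ((I m x - I n x)\<^sup>2) \<partial>P)"
      by (rule nn_integral_liminf) simp
    also have "\<dots> \<le> limsup (\<lambda>m. sqdist P (I m) (I n))"
      unfolding sqdist_def by (rule Liminf_le_Limsup) simp
    also have "\<dots> \<le> ennreal (c * (1 / 4) ^ n)"
      by (rule Limsup_bounded) (auto simp: eventually_sequentially sqdist_commute[of P _ "I n"] intro!: exI[of _ n] cauchy)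
    finally show ?thesis .
  qed
  have "(\<lambda>n. ennreal (c * (1 / 4) ^ n)) \<longlonglongrightarrow> ennreal (c * 0)"
    by (intro tendsto_ennrealI tendsto_intros LIMSEQ_power_zero) simp
  then have "(\<lambda>n. ennreal (c * (1 / 4) ^ n)) \<longlonglongrightarrow> 0" by simp
  then have "(\<lambda>n. sqdist P J (I n)) \<longlonglongrightarrow> 0" by (rule tendsto_0_mono) (rule bound)
  moreover have "J \<in> borel_measurable P" by simp
  ultimately show ?thesis by blast
qed

lemma sqdist_dominated:
  assumes [measurable]: "f \<in> borel_measurable M" "\<And>n. h n \<in> borel_measurable M"
    and lim: "AE x in M. (\<lambda>n. h n x) \<longlonglongrightarrow> f x"
    and dom: "\<And>n. AE x in M. \<bar>h n x - f x\<bar> \<le> w x"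
    and w[measurable]: "w \<in> borel_measurable M" and w2: "integrable M (\<lambda>x. (w x)\<^sup>2)"
  shows "(\<lambda>n. sqdist M f (h n)) \<longlonglongrightarrow> 0"
proof -
  have "(\<lambda>n. \<integral>\<^sup>+x. ennreal ((f x - h n x)\<^sup>2) \<partial>M) \<longlonglongrightarrow> (\<integral>\<^sup>+x. 0 \<partial>M)"
  proof (rule nn_integral_dominated_convergence[where w="\<lambda>x. ennreal ((w x)\<^sup>2)"])
    show "AE x in M. ennreal ((f x - h n x)\<^sup>2) \<le> ennreal ((w x)\<^sup>2)" for n
      using dom[of n] by eventually_elim (auto intro!: ennreal_leI abs_le_square_iff[THEN iffD1])
    show "(\<integral>\<^sup>+x. ennreal ((w x)\<^sup>2) \<partial>M) < \<infinity>" using w2 by (simp add: integrable_iff_bounded)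
    show "AE x in M. (\<lambda>n. ennreal ((f x - h n x)\<^sup>2)) \<longlonglongrightarrow> 0"
      using lim
    proof eventually_elim
      case (elim x)
      then have "(\<lambda>n. ennreal ((f x - h n x)\<^sup>2)) \<longlonglongrightarrow> ennreal ((f x - f x)\<^sup>2)"
        by (intro tendsto_ennrealI tendsto_intros)
      then show ?case by simp
    qed
  qed auto
  then show ?thesis by (simp add: sqdist_def)
qed

section \<open>Step functions are dense\<close>

lemma step_fun_simps [simp]:
  "step_fun [] s = 0"
  "step_fun ((c, a, b) # \<phi>) s = c * indicator {a<..b} s + step_fun \<phi> s"
  "step_fun (\<phi> @ \<psi>) s = step_fun \<phi> s + step_fun \<psi> s"
  by (simp_all add: step_fun_def)

lemma step_integral_simps [simp]:
  "step_integral X [] \<omega> = 0"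
  "step_integral X ((c, a, b) # \<phi>) \<omega> = c * (X b \<omega> - X a \<omega>) + step_integral X \<phi> \<omega>"
  "step_integral X (\<phi> @ \<psi>) \<omega> = step_integral X \<phi> \<omega> + step_integral X \<psi> \<omega>"
  by (simp_all add: step_integral_def)

lemma step_on_simps [simp]:
  "step_on T []"
  "step_on T ((c, a, b) # \<phi>) \<longleftrightarrow> 0 \<le> a \<and> a \<le> b \<and> b \<le> T \<and> step_on T \<phi>"
  "step_on T (\<phi> @ \<psi>) \<longleftrightarrow> step_on T \<phi> \<and> step_on T \<psi>"
  by (simp_all add: step_on_def ball_Un)

definition step_scale :: "real \<Rightarrow> step \<Rightarrow> step" where
  "step_scale r \<phi> = map (\<lambda>(c, a, b). (r * c, a, b)) \<phi>"

lemma step_scale_simps [simp]: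
  "step_fun (step_scale r \<phi>) s = r * step_fun \<phi> s"
  "step_integral X (step_scale r \<phi>) \<omega> = r * step_integral X \<phi> \<omega>"
  "step_on T (step_scale r \<phi>) \<longleftrightarrow> step_on T \<phi>"
  by (induction \<phi>) (auto simp: step_scale_def algebra_simps)

lemma step_fun_borel [measurable]: "step_fun \<phi> \<in> borel_measurable borel"
  by (induction \<phi>) (auto simp: step_fun_def[abs_def])

lemma step_fun_bounded: "\<exists>B. \<forall>s. \<bar>step_fun \<phi> s\<bar> \<le> B"
proof (induction \<phi>)
  case (Cons x \<phi>)
  obtain c a b where x: "x = (c, a, b)" by (cases x)
  from Cons obtain B where B: "\<And>s. \<bar>step_fun \<phi> s\<bar> \<le> B" by blast
  have "\<bar>step_fun (x # \<phi>) s\<bar> \<le> \<bar>c\<bar> + B" for s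
    using B[of s] by (auto simp: x indicator_def)
  then show ?case by blast
qed auto

text \<open>
  Step functions are built from intervals \<open>(a, b]\<close> with \<open>0 \<le> a\<close> and vanish at \<open>0\<close>; they can be dense
  only if the point \<open>0\<close> has no mass.
\<close>

locale compact_interval_measure = finite_measure \<mu> for \<mu> :: "real measure" and T :: real +
  assumes T_pos: "0 < T"
    and sets_mu: "sets \<mu> = sets (restrict_space borel {0..T})"
    and null_0: "emeasure \<mu> {0} = 0"
begin

lemma space_mu: "space \<mu> = {0..T}"
  using sets_eq_imp_space_eq[OF sets_mu] by (simp add: space_restrict_space)

lemma borel_measurable_mu: "f \<in> borel_measurable borel \<Longrightarrow> f \<in> borel_measurable \<mu>"
  unfolding measurable_cong_sets[OF sets_mu refl] by (rule measurable_restrict_space1)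

lemma sets_mu_iff: "A \<in> sets \<mu> \<longleftrightarrow> A \<subseteq> {0..T} \<and> A \<in> sets borel"
  unfolding sets_mu by (subst sets_restrict_space_iff) auto

lemma step_fun_measurable [measurable]: "step_fun \<phi> \<in> borel_measurable \<mu>"
  by (rule borel_measurable_mu) simp

lemma step_fun_square_integrable: "integrable \<mu> (\<lambda>s. (step_fun \<phi> s)\<^sup>2)"
proof -
  obtain B where B: "\<And>s. \<bar>step_fun \<phi> s\<bar> \<le> B" using step_fun_bounded by blast
  have "(step_fun \<phi> s)\<^sup>2 \<le> B\<^sup>2" for s using power_mono[OF B[of s], of 2] by simp
  then show ?thesis by (intro integrable_const_bound[where B="B\<^sup>2"]) auto
qed

text \<open>
  The \<open>L\<^sup>2(\<mu>)\<close> closure of the step functions, as a predicate on functions rather than classes.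
\<close>

definition step_approx :: "(real \<Rightarrow> real) \<Rightarrow> bool" where
  "step_approx f \<longleftrightarrow> f \<in> borel_measurable \<mu> \<and>
     (\<forall>e>0. \<exists>\<phi>. step_on T \<phi> \<and> sqdist \<mu> f (step_fun \<phi>) < e)"

lemma step_approx_AE:
  assumes "step_approx f" and [measurable]: "g \<in> borel_measurable \<mu>" and ae: "AE x in \<mu>. f x = g x"
  shows "step_approx g"
proof -
  have "sqdist \<mu> f h = sqdist \<mu> g h" for h by (rule sqdist_cong_AE[OF ae]) simp
  then show ?thesis using assms(1,2) by (simp add: step_approx_def)
qed

lemma step_approx_step: "step_on T \<phi> \<Longrightarrow> step_approx (step_fun \<phi>)"
  unfolding step_approx_def by (auto intro!: exI[of _ \<phi>])

lemma step_approx_limit: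
  assumes [measurable]: "f \<in> borel_measurable \<mu>"
    and g: "\<And>n::nat. step_approx (g n)" and lim: "(\<lambda>n. sqdist \<mu> f (g n)) \<longlonglongrightarrow> 0"
  shows "step_approx f"
  unfolding step_approx_def
proof (intro conjI allI impI)
  fix e :: ennreal assume e: "0 < e"
  have [measurable]: "g n \<in> borel_measurable \<mu>" for n using g by (simp add: step_approx_def)
  obtain r where r: "0 < r" "ennreal r \<le> e"
    using e by (cases e) (auto intro: that[of 1])
  then have e4: "0 < ennreal (r / 4)" by simp
  from order_tendstoD(2)[OF lim e4] obtain n where n: "sqdist \<mu> f (g n) < ennreal (r / 4)"
    by (auto simp: eventually_sequentially)
  from g[of n] e4 obtain \<phi> where \<phi>: "step_on T \<phi>" "sqdist \<mu> (g n) (step_fun \<phi>) < ennreal (r / 4)"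
    unfolding step_approx_def by blast
  have "sqdist \<mu> f (step_fun \<phi>) \<le> 2 * sqdist \<mu> f (g n) + 2 * sqdist \<mu> (g n) (step_fun \<phi>)"
    by (intro sqdist_triangle) auto
  also have "\<dots> \<le> 2 * sqdist \<mu> f (g n) + 2 * ennreal (r / 4)"
    using \<phi>(2) by (intro add_mono mult_left_mono) auto
  also have "\<dots> < ennreal r"
  proof -
    obtain a where a: "0 \<le> a" "sqdist \<mu> f (g n) = ennreal a"
      using n by (cases "sqdist \<mu> f (g n)") auto
    then have ar: "a < r / 4" using n by (simp add: ennreal_less_iff)
    have e: "2 * sqdist \<mu> f (g n) + 2 * ennreal (r / 4) = ennreal (2 * a + 2 * (r / 4))"
      using a r by (simp only: ennreal_plus ennreal_mult ennreal_numeral)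
    show ?thesis unfolding e using a ar by (subst ennreal_less_iff) auto
  qed
  also note r(2)
  finally show "\<exists>\<phi>. step_on T \<phi> \<and> sqdist \<mu> f (step_fun \<phi>) < e" using \<phi>(1) by blast
qed simp

lemma step_approx_seq:
  assumes "step_approx f"
  shows "\<exists>\<phi>. \<forall>n. step_on T (\<phi> n) \<and> sqdist \<mu> f (step_fun (\<phi> n)) < ennreal ((1 / 4) ^ n)"
proof (rule choice, rule allI)
  fix n :: nat
  have "(0::ennreal) < ennreal ((1 / 4) ^ n)" by simp
  then show "\<exists>\<phi>. step_on T \<phi> \<and> sqdist \<mu> f (step_fun \<phi>) < ennreal ((1 / 4) ^ n)"
    using assms unfolding step_approx_def by blast
qed

lemma sqdist_quarter_tendsto_0:
  assumes "\<And>n. sqdist M f (g n) < ennreal ((1 / 4) ^ n)"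
  shows "(\<lambda>n. sqdist M f (g n)) \<longlonglongrightarrow> 0"
proof (rule tendsto_0_mono)
  have "(\<lambda>n. ennreal ((1 / 4) ^ n)) \<longlonglongrightarrow> ennreal 0"
    by (intro tendsto_ennrealI LIMSEQ_power_zero) simp
  then show "(\<lambda>n. ennreal ((1 / 4) ^ n)) \<longlonglongrightarrow> 0" by simp
qed (use assms less_imp_le in blast)

lemma step_approx_add:
  assumes "step_approx f" "step_approx g"
  shows "step_approx (\<lambda>x. f x + g x)"
proof -
  from step_approx_seq[OF assms(1)] obtain \<phi> where \<phi>: "\<And>n. step_on T (\<phi> n)" "\<And>n. sqdist \<mu> f (step_fun (\<phi> n)) < ennreal ((1 / 4) ^ n)" by blast
  from step_approx_seq[OF assms(2)] obtain \<psi> where \<psi>: "\<And>n. step_on T (\<psi> n)" "\<And>n. sqdist \<mu> g (step_fun (\<psi> n)) < ennreal ((1 / 4) ^ n)" by blast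
  have [measurable]: "f \<in> borel_measurable \<mu>" "g \<in> borel_measurable \<mu>" using assms by (auto simp: step_approx_def)
  have lim: "(\<lambda>n. sqdist \<mu> (\<lambda>x. f x + g x) (\<lambda>x. step_fun (\<phi> n) x + step_fun (\<psi> n) x)) \<longlonglongrightarrow> 0"
  proof (rule tendsto_0_mono)
    show "(\<lambda>n. 2 * sqdist \<mu> f (step_fun (\<phi> n)) + 2 * sqdist \<mu> g (step_fun (\<psi> n))) \<longlonglongrightarrow> 0"
      by (intro tendsto_0_add tendsto_0_cmult sqdist_quarter_tendsto_0 \<phi> \<psi>) auto
  qed (rule sqdist_add; simp)
  have st: "step_approx (\<lambda>x. step_fun (\<phi> n) x + step_fun (\<psi> n) x)" for n
  proof -
    have "step_fun (\<phi> n @ \<psi> n) = (\<lambda>x. step_fun (\<phi> n) x + step_fun (\<psi> n) x)" by (simp add: fun_eq_iff)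
    then show ?thesis using step_approx_step[of "\<phi> n @ \<psi> n"] \<phi>(1) \<psi>(1) by simp
  qed
  show ?thesis by (rule step_approx_limit[OF _ st lim]) simp
qed

lemma step_approx_cmult:
  assumes "step_approx f"
  shows "step_approx (\<lambda>x. c * f x)"
proof -
  from step_approx_seq[OF assms(1)] obtain \<phi> where \<phi>: "\<And>n. step_on T (\<phi> n)" "\<And>n. sqdist \<mu> f (step_fun (\<phi> n)) < ennreal ((1 / 4) ^ n)" by blast
  have [measurable]: "f \<in> borel_measurable \<mu>" using assms by (auto simp: step_approx_def)
  have lim: "(\<lambda>n. sqdist \<mu> (\<lambda>x. c * f x) (\<lambda>x. c * step_fun (\<phi> n) x)) \<longlonglongrightarrow> 0"
    by (subst sqdist_cmult) (auto intro!: tendsto_0_cmult sqdist_quarter_tendsto_0 \<phi>)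
  have st: "step_approx (\<lambda>x. c * step_fun (\<phi> n) x)" for n
  proof -
    have "step_fun (step_scale c (\<phi> n)) = (\<lambda>x. c * step_fun (\<phi> n) x)" by (simp add: fun_eq_iff)
    then show ?thesis using step_approx_step[of "step_scale c (\<phi> n)"] \<phi>(1) by simp
  qed
  show ?thesis by (rule step_approx_limit[OF _ st lim]) simp
qed

lemma step_approx_0: "step_approx (\<lambda>_. 0)"
proof -
  have "step_fun [] = (\<lambda>_. 0)" by (simp add: fun_eq_iff)
  then show ?thesis using step_approx_step[of "[]"] by simp
qed

lemma step_approx_sum:
  "finite S \<Longrightarrow> (\<And>y. y \<in> S \<Longrightarrow> step_approx (f y)) \<Longrightarrow> step_approx (\<lambda>x. \<Sum>y\<in>S. f y x)"
proof (induction S rule: finite_induct)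
  case empty
  then show ?case using step_approx_0 by simp
qed (simp add: step_approx_add)

lemma AE_pos: "AE x in \<mu>. 0 < x"
proof -
  have "{0} \<in> sets \<mu>" using T_pos by (simp add: sets_mu_iff)
  then have "{0} \<in> null_sets \<mu>" using null_0 by auto
  then have "AE x in \<mu>. x \<notin> {0}" by (rule AE_not_in)
  moreover have "AE x in \<mu>. 0 \<le> x" by (rule AE_I2) (auto simp: space_mu)
  ultimately show ?thesis by eventually_elim auto
qed

text \<open>
  The Borel sets whose indicator lies in the closure form a Dynkin system that contains the half-open
  intervals; complements use that the constant \<open>1\<close> agrees almost everywhere with the step function
  \<open>1\<^bsub>(0,T]\<^esub>\<close>.
\<close>

lemma step_approx_indicator:
  assumes "A \<in> sets borel"
  shows "step_approx (indicator A)"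
proof -
  have one: "step_approx (\<lambda>_. 1)"
  proof (rule step_approx_AE)
    show "step_approx (step_fun [(1, 0, T)])" using T_pos by (intro step_approx_step) simp
    show "AE x in \<mu>. step_fun [(1, 0, T)] x = 1"
      using AE_pos by (rule AE_mp) (auto intro!: AE_I2 simp: space_mu)
  qed simp
  have A: "A \<in> sigma_sets UNIV (range (\<lambda>(a, b). {a<..b::real}))"
    using assms by (subst (asm) borel_sigma_sets_Ioc) simp
  have Int: "Int_stable (range (\<lambda>(a, b). {a<..b::real}))"
  proof (rule Int_stableI_image)
    fix p q :: "real \<times> real"
    obtain a b c d where "p = (a, b)" "q = (c, d)" by (cases p; cases q)
    then show "\<exists>r\<in>UNIV. (case p of (a, b) \<Rightarrow> {a<..b}) \<inter> (case q of (a, b) \<Rightarrow> {a<..b}) = (case r of (a, b) \<Rightarrow> {a<..b})"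
      by (intro bexI[of _ "(max a c, min b d)"]) auto
  qed
  have sub: "range (\<lambda>(a, b). {a<..b::real}) \<subseteq> Pow UNIV" by simp
  show ?thesis
    using Int sub A
  proof (induction A rule: sigma_sets_induct_disjoint)
    case (basic A)
    then obtain a b where A: "A = {a<..b}" by auto
    \<comment> \<open>Cutting off at \<open>0\<close> and \<open>T\<close> changes the indicator only outside \<open>(0, T]\<close>.\<close>
    define a' b' where "a' = max 0 a" and "b' = min b T"
    show ?case
    proof (rule step_approx_AE)
      show "step_approx (step_fun (if a' \<le> b' then [(1, a', b')] else []))"
        by (intro step_approx_step) (simp add: a'_def b'_def)
      show "AE x in \<mu>. step_fun (if a' \<le> b' then [(1, a', b')] else []) x = indicator A x"
        using AE_pos by (rule AE_mp) (auto intro!: AE_I2 simp: space_mu A a'_def b'_def indicator_def)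
      show "indicator A \<in> borel_measurable \<mu>" by (rule borel_measurable_mu) (simp add: A)
    qed
  next
    case empty
    show ?case using step_approx_0 by (simp add: indicator_def)
  next
    case (compl A)
    have "step_approx (\<lambda>x. 1 + (-1) * indicator A x)"
      by (intro step_approx_add one step_approx_cmult compl)
    moreover have "(\<lambda>x. 1 + (-1) * indicator A x :: real) = indicator (UNIV - A)"
      by (auto simp: indicator_def fun_eq_iff)
    ultimately show ?case by simp
  next
    case (union A)
    have Ab: "A i \<in> sets borel" for i
      using union(2) by (subst borel_sigma_sets_Ioc) auto
    have m: "(indicator B :: real \<Rightarrow> real) \<in> borel_measurable \<mu>" if "B \<in> sets borel" for B
      by (rule borel_measurable_mu, rule borel_measurable_indicator, rule that)
    have s: "(\<lambda>x. \<Sum>i<n. indicator (A i) x :: real) = indicator (\<Union>i<n. A i)" for n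
      using disjoint_family_on_mono[OF subset_UNIV union(1), of "{..<n}"]
      by (intro ext indicator_UN_disjoint[symmetric]) simp_all
    show ?case
    proof (rule step_approx_limit)
      show "step_approx (indicator (\<Union>i<n. A i))" for n
        unfolding s[symmetric] by (intro step_approx_sum union) auto
      show "(indicator (\<Union>i. A i) :: real \<Rightarrow> real) \<in> borel_measurable \<mu>" using Ab by (intro m) auto
      show "(\<lambda>n. sqdist \<mu> (indicator (\<Union>i. A i)) (indicator (\<Union>i<n. A i))) \<longlonglongrightarrow> 0"
      proof (rule sqdist_dominated)
        show "AE x in \<mu>. (\<lambda>n. indicator (\<Union>i<n. A i) x :: real) \<longlonglongrightarrow> indicator (\<Union>i. A i) x"
          by (intro AE_I2 LIMSEQ_indicator_UN)
        show "AE x in \<mu>. \<bar>indicator (\<Union>i<n. A i) x - indicator (\<Union>i. A i) x\<bar> \<le> (1::real)" for n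
          by (intro AE_I2) (simp add: indicator_def)
      qed (use Ab in \<open>auto intro!: m\<close>)
    qed
  qed
qed

text \<open>
  Simple functions bounded by \<open>2 \<bar>f\<bar>\<close> that converge pointwise to \<open>f\<close> converge in \<open>L\<^sup>2\<close> by dominated
  convergence.
\<close>

lemma step_approx_square_integrable:
  assumes f[measurable]: "f \<in> borel_measurable \<mu>" and f2: "integrable \<mu> (\<lambda>x. (f x)\<^sup>2)"
  shows "step_approx f"
proof -
  obtain F where F: "\<And>i. simple_function \<mu> (F i)" "\<And>x. x \<in> space \<mu> \<Longrightarrow> (\<lambda>i. F i x) \<longlonglongrightarrow> f x"
    "\<And>i x. x \<in> space \<mu> \<Longrightarrow> dist (F i x) 0 \<le> 2 * dist (f x) 0"
    using borel_measurable_implies_sequence_metric[OF f, of 0] by blast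
  have Fm[measurable]: "F i \<in> borel_measurable \<mu>" for i using F(1) by (rule borel_measurable_simple_function)
  have "step_approx (F i)" for i
  proof (rule step_approx_AE)
    show "step_approx (\<lambda>x. \<Sum>y\<in>F i ` space \<mu>. y * indicator (F i -` {y} \<inter> space \<mu>) x)"
    proof (intro step_approx_sum step_approx_cmult step_approx_indicator)
      show "finite (F i ` space \<mu>)" using F(1) by (rule simple_functionD)
      show "F i -` {y} \<inter> space \<mu> \<in> sets borel" for y
        using simple_functionD(2)[OF F(1), of i "{y}"] by (simp add: sets_mu_iff)
    qed
    show "AE x in \<mu>. (\<Sum>y\<in>F i ` space \<mu>. y * indicator (F i -` {y} \<inter> space \<mu>) x) = F i x"
      using simple_function_indicator_representation_banach[OF F(1), symmetric]
      by (intro AE_I2) (simp only: real_scaleR_def mult.commute)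
  qed simp
  then show ?thesis
  proof (rule step_approx_limit[rotated])
    show "(\<lambda>n. sqdist \<mu> f (F n)) \<longlonglongrightarrow> 0"
    proof (rule sqdist_dominated)
      show "AE x in \<mu>. (\<lambda>n. F n x) \<longlonglongrightarrow> f x" using F(2) by (intro AE_I2)
      show "AE x in \<mu>. \<bar>F n x - f x\<bar> \<le> 3 * \<bar>f x\<bar>" for n
      proof (rule AE_I2)
        fix x assume "x \<in> space \<mu>"
        from F(3)[OF this, of n] show "\<bar>F n x - f x\<bar> \<le> 3 * \<bar>f x\<bar>" by simp
      qed
      show "integrable \<mu> (\<lambda>x. (3 * \<bar>f x\<bar>)\<^sup>2)" using f2 by (simp add: power_mult_distrib)
    qed auto
  qed simp
qed

end

section \<open>Wiener integrals of a Gaussian integrator\<close>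

text \<open>
  The only probabilistic input of the Wiener integral is the law of integrals of step functions.
  Stated for a general measure \<open>\<mu>\<close>, it applies to Brownian motion (\<open>\<mu>\<close> Lebesgue measure) and to
  \<open>M\<close> (\<open>\<mu> = d\<langle>M\<rangle>\<close>).
\<close>

locale gaussian_integrator = P: prob_space P + compact_interval_measure \<mu> T
  for P :: "'a measure" and \<mu> :: "real measure" and T :: real +
  fixes X :: "real \<Rightarrow> 'a \<Rightarrow> real"
  assumes X_measurable: "t \<in> {0..T} \<Longrightarrow> X t \<in> borel_measurable P"
    and step_normal: "step_on T \<phi> \<Longrightarrow>
      centered_normal P (step_integral X \<phi>) (\<integral>s. (step_fun \<phi> s)\<^sup>2 \<partial>\<mu>)"
begin

abbreviation "wiener \<equiv> is_wiener_integral P \<mu> T X"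

lemma wiener_iff:
  "wiener f I \<longleftrightarrow> f \<in> borel_measurable \<mu> \<and> I \<in> borel_measurable P \<and>
     (\<exists>\<phi>. (\<forall>n. step_on T (\<phi> n)) \<and> (\<lambda>n. sqdist \<mu> f (step_fun (\<phi> n))) \<longlonglongrightarrow> 0 \<and>
        (\<lambda>n. sqdist P I (step_integral X (\<phi> n))) \<longlonglongrightarrow> 0)"
  by (simp add: is_wiener_integral_def sqdist_def)

lemma wienerE:
  assumes "wiener f I"
  obtains \<phi> where "\<And>n. step_on T (\<phi> n)" "(\<lambda>n. sqdist \<mu> f (step_fun (\<phi> n))) \<longlonglongrightarrow> 0"
    "(\<lambda>n. sqdist P I (step_integral X (\<phi> n))) \<longlonglongrightarrow> 0"
  using assms unfolding wiener_iff by blast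

lemma wiener_measurable:
  assumes "wiener f I" shows "f \<in> borel_measurable \<mu>" "I \<in> borel_measurable P"
  using assms by (auto simp: wiener_iff)

lemma step_integral_measurable: "step_on T \<phi> \<Longrightarrow> step_integral X \<phi> \<in> borel_measurable P"
  using step_normal by (simp add: centered_normal_def)

text \<open>
  The difference of two step functions is a step function, whose integral has the prescribed
  variance.
\<close>

lemma step_isometry:
  assumes \<phi>: "step_on T \<phi>" and \<psi>: "step_on T \<psi>"
  shows "sqdist P (step_integral X \<phi>) (step_integral X \<psi>) = sqdist \<mu> (step_fun \<phi>) (step_fun \<psi>)"
proof -
  define \<xi> where "\<xi> = \<phi> @ step_scale (-1) \<psi>"
  have \<xi>: "step_on T \<xi>" using assms by (simp add: \<xi>_def)
  have f: "step_fun \<xi> s = step_fun \<phi> s - step_fun \<psi> s" for s by (simp add: \<xi>_def)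
  have i: "step_integral X \<xi> \<omega> = step_integral X \<phi> \<omega> - step_integral X \<psi> \<omega>" for \<omega> by (simp add: \<xi>_def)
  have v: "0 \<le> (\<integral>s. (step_fun \<xi> s)\<^sup>2 \<partial>\<mu>)" by simp
  note m = centered_normal_moments[OF P.prob_space_axioms step_normal[OF \<xi>] v]
  have "sqdist P (step_integral X \<phi>) (step_integral X \<psi>) = ennreal (\<integral>\<omega>. (step_integral X \<xi> \<omega>)\<^sup>2 \<partial>P)"
    unfolding sqdist_def i[symmetric] using m(1) by (intro nn_integral_eq_integral) auto
  also have "\<dots> = ennreal (\<integral>s. (step_fun \<xi> s)\<^sup>2 \<partial>\<mu>)" by (simp only: m(2))
  also have "\<dots> = sqdist \<mu> (step_fun \<phi>) (step_fun \<psi>)"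
    unfolding sqdist_def f[symmetric] by (intro nn_integral_eq_integral[symmetric] step_fun_square_integrable) auto
  finally show ?thesis .
qed

text \<open>
  Step functions with \<open>\<parallel>f - \<phi>\<^sub>n\<parallel>\<^sup>2 < 4\<^bsup>-n\<^esup>\<close> have integrals with distances of the same order by the
  isometry, and these converge by completeness.
\<close>

lemma wiener_exists:
  assumes f[measurable]: "f \<in> borel_measurable \<mu>" and f2: "integrable \<mu> (\<lambda>s. (f s)\<^sup>2)"
  shows "\<exists>I. wiener f I"
proof -
  from step_approx_seq[OF step_approx_square_integrable[OF assms]]
  obtain \<phi> where \<phi>: "\<And>n. step_on T (\<phi> n)" "\<And>n. sqdist \<mu> f (step_fun (\<phi> n)) < ennreal ((1 / 4) ^ n)" by blast
  have "\<exists>J\<in>borel_measurable P. (\<lambda>n. sqdist P J (step_integral X (\<phi> n))) \<longlonglongrightarrow> 0"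
  proof (rule sqdist_complete[OF P.prob_space_axioms, where c = 4])
    fix n m :: nat assume nm: "n \<le> m"
    have "sqdist P (step_integral X (\<phi> n)) (step_integral X (\<phi> m)) = sqdist \<mu> (step_fun (\<phi> n)) (step_fun (\<phi> m))"
      by (rule step_isometry) (rule \<phi>)+
    also have "\<dots> \<le> 2 * sqdist \<mu> (step_fun (\<phi> n)) f + 2 * sqdist \<mu> f (step_fun (\<phi> m))"
      by (rule sqdist_triangle) auto
    also have "\<dots> \<le> 2 * ennreal ((1 / 4) ^ n) + 2 * ennreal ((1 / 4) ^ n)"
    proof (intro add_mono mult_left_mono)
      show "sqdist \<mu> (step_fun (\<phi> n)) f \<le> ennreal ((1 / 4) ^ n)"
        using \<phi>(2)[of n] by (simp add: sqdist_commute)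
      have "sqdist \<mu> f (step_fun (\<phi> m)) \<le> ennreal ((1 / 4) ^ m)" using \<phi>(2)[of m] by simp
      also have "\<dots> \<le> ennreal ((1 / 4) ^ n)" using nm by (intro ennreal_leI power_decreasing) auto
      finally show "sqdist \<mu> f (step_fun (\<phi> m)) \<le> ennreal ((1 / 4) ^ n)" .
    qed auto
    also have "\<dots> = ennreal (4 * (1 / 4) ^ n)"
    proof -
      have "2 * x + 2 * x = 4 * x" for x :: ennreal by (simp flip: distrib_right)
      then show ?thesis by (simp only: ennreal_mult' ennreal_numeral zero_le_numeral)
    qed
    finally show "sqdist P (step_integral X (\<phi> n)) (step_integral X (\<phi> m)) \<le> ennreal (4 * (1 / 4) ^ n)" .
  qed (use step_integral_measurable \<phi> in auto)
  then obtain J where "J \<in> borel_measurable P" "(\<lambda>n. sqdist P J (step_integral X (\<phi> n))) \<longlonglongrightarrow> 0" by blast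
  then show ?thesis
    unfolding wiener_iff using f \<phi>(1) sqdist_quarter_tendsto_0[OF \<phi>(2)] by blast
qed

lemma wiener_normal:
  assumes "wiener f I"
  shows "integrable \<mu> (\<lambda>s. (f s)\<^sup>2)" "centered_normal P I (\<integral>s. (f s)\<^sup>2 \<partial>\<mu>)"
proof -
  obtain \<phi> where \<phi>: "\<And>n. step_on T (\<phi> n)" and l: "(\<lambda>n. sqdist \<mu> f (step_fun (\<phi> n))) \<longlonglongrightarrow> 0"
    "(\<lambda>n. sqdist P I (step_integral X (\<phi> n))) \<longlonglongrightarrow> 0" using wienerE[OF assms] by metis
  note m = wiener_measurable[OF assms]
  note t = sqdist_tendsto_integral_square[OF m(1) step_fun_measurable step_fun_square_integrable l(1)]
  show "integrable \<mu> (\<lambda>s. (f s)\<^sup>2)" by (rule t)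
  show "centered_normal P I (\<integral>s. (f s)\<^sup>2 \<partial>\<mu>)"
    by (rule centered_normal_limit[OF P.prob_space_axioms m(2) l(2) step_normal[OF \<phi>] t(2)])
qed

lemma wiener_add:
  assumes "wiener f I" "wiener g J"
  shows "wiener (\<lambda>s. f s + g s) (\<lambda>\<omega>. I \<omega> + J \<omega>)"
proof -
  from assms(1) obtain \<phi> where \<phi>: "\<And>n. step_on T (\<phi> n)" "(\<lambda>n. sqdist \<mu> f (step_fun (\<phi> n))) \<longlonglongrightarrow> 0"
    "(\<lambda>n. sqdist P I (step_integral X (\<phi> n))) \<longlonglongrightarrow> 0" using wienerE by metis
  from assms(2) obtain \<psi> where \<psi>: "\<And>n. step_on T (\<psi> n)" "(\<lambda>n. sqdist \<mu> g (step_fun (\<psi> n))) \<longlonglongrightarrow> 0"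
    "(\<lambda>n. sqdist P J (step_integral X (\<psi> n))) \<longlonglongrightarrow> 0" using wienerE by metis
  note [measurable] = wiener_measurable[OF assms(1)] wiener_measurable[OF assms(2)]
    step_integral_measurable[OF \<phi>(1)] step_integral_measurable[OF \<psi>(1)]
  have e: "step_fun (\<phi> n @ \<psi> n) = (\<lambda>s. step_fun (\<phi> n) s + step_fun (\<psi> n) s)"
    "step_integral X (\<phi> n @ \<psi> n) = (\<lambda>\<omega>. step_integral X (\<phi> n) \<omega> + step_integral X (\<psi> n) \<omega>)" for n
    by (simp_all add: fun_eq_iff)
  have "(\<lambda>n. sqdist \<mu> (\<lambda>s. f s + g s) (step_fun (\<phi> n @ \<psi> n))) \<longlonglongrightarrow> 0" unfolding e
    by (rule tendsto_0_mono[OF tendsto_0_add[OF tendsto_0_cmult[OF \<phi>(2)] tendsto_0_cmult[OF \<psi>(2)]] sqdist_add]) simp_all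
  moreover have "(\<lambda>n. sqdist P (\<lambda>\<omega>. I \<omega> + J \<omega>) (step_integral X (\<phi> n @ \<psi> n))) \<longlonglongrightarrow> 0" unfolding e
    by (rule tendsto_0_mono[OF tendsto_0_add[OF tendsto_0_cmult[OF \<phi>(3)] tendsto_0_cmult[OF \<psi>(3)]] sqdist_add]) simp_all
  ultimately show ?thesis unfolding wiener_iff using \<phi>(1) \<psi>(1) by (auto intro!: exI[of _ "\<lambda>n. \<phi> n @ \<psi> n"])
qed

lemma wiener_cmult:
  assumes "wiener f I"
  shows "wiener (\<lambda>s. c * f s) (\<lambda>\<omega>. c * I \<omega>)"
proof -
  from assms(1) obtain \<phi> where \<phi>: "\<And>n. step_on T (\<phi> n)" "(\<lambda>n. sqdist \<mu> f (step_fun (\<phi> n))) \<longlonglongrightarrow> 0"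
    "(\<lambda>n. sqdist P I (step_integral X (\<phi> n))) \<longlonglongrightarrow> 0" using wienerE by metis
  note [measurable] = wiener_measurable[OF assms(1)] step_integral_measurable[OF \<phi>(1)]
  have e: "step_fun (step_scale c (\<phi> n)) = (\<lambda>s. c * step_fun (\<phi> n) s)"
    "step_integral X (step_scale c (\<phi> n)) = (\<lambda>\<omega>. c * step_integral X (\<phi> n) \<omega>)" for n
    by (simp_all add: fun_eq_iff)
  have "(\<lambda>n. sqdist \<mu> (\<lambda>s. c * f s) (step_fun (step_scale c (\<phi> n)))) \<longlonglongrightarrow> 0" unfolding e
    by (subst sqdist_cmult) (auto intro!: tendsto_0_cmult \<phi>)
  moreover have "(\<lambda>n. sqdist P (\<lambda>\<omega>. c * I \<omega>) (step_integral X (step_scale c (\<phi> n)))) \<longlonglongrightarrow> 0" unfolding e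
    by (subst sqdist_cmult) (auto intro!: tendsto_0_cmult \<phi>)
  ultimately show ?thesis unfolding wiener_iff using \<phi>(1)
    by (auto intro!: exI[of _ "\<lambda>n. step_scale c (\<phi> n)"] wiener_measurable[OF assms] borel_measurable_times)
qed

lemma wiener_diff:
  assumes "wiener f I" "wiener g J"
  shows "wiener (\<lambda>s. f s - g s) (\<lambda>\<omega>. I \<omega> - J \<omega>)"
  using wiener_add[OF assms(1) wiener_cmult[OF assms(2), of "-1"]] by simp

lemma wiener_step: "step_on T \<phi> \<Longrightarrow> wiener (step_fun \<phi>) (step_integral X \<phi>)"
  unfolding wiener_iff by (auto intro!: exI[of _ "\<lambda>_. \<phi>"] step_integral_measurable)

lemma wiener_sum:
  assumes "finite J" "\<And>j. j \<in> J \<Longrightarrow> wiener (f j) (I j)"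
  shows "wiener (\<lambda>s. \<Sum>j\<in>J. c j * f j s) (\<lambda>\<omega>. \<Sum>j\<in>J. c j * I j \<omega>)"
  using assms
proof (induction J rule: finite_induct)
  case empty
  have "step_fun [] = (\<lambda>s. 0)" "step_integral X [] = (\<lambda>\<omega>. 0)" by (simp_all add: fun_eq_iff)
  then show ?case using wiener_step[of "[]"] by simp
next
  case (insert j J)
  then show ?case using wiener_add[OF wiener_cmult[of "f j" "I j" "c j"]] by simp
qed

lemma wiener_cong_AE:
  assumes "wiener f I" "AE s in \<mu>. f s = g s" "AE \<omega> in P. I \<omega> = J \<omega>"
    "g \<in> borel_measurable \<mu>" "J \<in> borel_measurable P"
  shows "wiener g J"
proof -
  have "sqdist \<mu> f h = sqdist \<mu> g h" for h by (rule sqdist_cong_AE[OF assms(2)]) simp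
  moreover have "sqdist P I h = sqdist P J h" for h by (rule sqdist_cong_AE[OF assms(3)]) simp
  ultimately show ?thesis using assms by (simp add: wiener_iff)
qed

text \<open>
  A linear combination of Wiener integrals is the Wiener integral of the linear combination, so its
  variance is the square norm, which is bilinear in the coefficients.
\<close>

lemma wiener_gaussian_family:
  assumes "\<And>i. i \<in> K \<Longrightarrow> wiener (f i) (I i)"
  shows "gaussian_family P K I (\<lambda>i j. \<integral>s. f i s * f j s \<partial>\<mu>)"
  unfolding gaussian_family_def
proof (intro allI impI)
  fix J u assume J: "finite J" "J \<subseteq> K"
  have w: "wiener (f i) (I i)" if "i \<in> J" for i using assms that J by blast
  have i: "integrable \<mu> (\<lambda>s. f i s * f j s)" if "i \<in> J" "j \<in> J" for i j
    using w[OF that(1)] w[OF that(2)] by (intro square_integrable_mult wiener_normal wiener_measurable)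
  have "(\<integral>s. (\<Sum>j\<in>J. u j * f j s)\<^sup>2 \<partial>\<mu>) = (\<integral>s. (\<Sum>i\<in>J. \<Sum>j\<in>J. u i * u j * (f i s * f j s)) \<partial>\<mu>)"
    by (simp add: power2_eq_square sum_product ac_simps)
  also have "\<dots> = (\<Sum>i\<in>J. \<Sum>j\<in>J. u i * u j * (\<integral>s. f i s * f j s \<partial>\<mu>))"
    using i by (subst Bochner_Integration.integral_sum; (intro Bochner_Integration.integrable_sum)?; simp)
  finally show "centered_normal P (\<lambda>\<omega>. \<Sum>j\<in>J. u j * I j \<omega>) (\<Sum>i\<in>J. \<Sum>j\<in>J. u i * u j * (\<integral>s. f i s * f j s \<partial>\<mu>))"
    using wiener_normal(2)[OF wiener_sum[OF J(1), of f I u, OF w]] by simp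
qed

lemma wiener_integral_wiener:
  assumes "f \<in> borel_measurable \<mu>" "integrable \<mu> (\<lambda>s. (f s)\<^sup>2)"
  shows "wiener f (wiener_integral P \<mu> T X f)"
  unfolding wiener_integral_def using someI_ex[OF wiener_exists[OF assms]] .

end

section \<open>Brownian motion and the martingale M as Gaussian integrators\<close>

text \<open>
  The sum telescopes over the cells of the partition between \<open>\<tau> j\<close> and \<open>\<tau> k\<close>; cells of length \<open>0\<close>
  contribute nothing whether or not they are selected.
\<close>

lemma telescope_indicator:
  fixes \<tau> :: "nat \<Rightarrow> real" and F :: "real \<Rightarrow> real"
  assumes "mono \<tau>" "j \<le> k" "k \<le> N"
  shows "F (\<tau> k) - F (\<tau> j) = (\<Sum>m<N. indicator {\<tau> j<..\<tau> k} (\<tau> (Suc m)) * (F (\<tau> (Suc m)) - F (\<tau> m)))"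
proof -
  have "(\<Sum>m<N. indicator {\<tau> j<..\<tau> k} (\<tau> (Suc m)) * (F (\<tau> (Suc m)) - F (\<tau> m))) =
      (\<Sum>m<N. if m \<in> {j..<k} then F (\<tau> (Suc m)) - F (\<tau> m) else 0)"
  proof (rule sum.cong[OF refl])
    fix m
    show "indicator {\<tau> j<..\<tau> k} (\<tau> (Suc m)) * (F (\<tau> (Suc m)) - F (\<tau> m)) =
        (if m \<in> {j..<k} then F (\<tau> (Suc m)) - F (\<tau> m) else 0)"
    proof (cases "\<tau> m = \<tau> (Suc m)")
      case False
      then have lt: "\<tau> m < \<tau> (Suc m)" using monoD[OF assms(1), of m "Suc m"] by simp
      have "\<tau> j < \<tau> (Suc m) \<longleftrightarrow> j \<le> m"
        using monoD[OF assms(1), of j m] monoD[OF assms(1), of "Suc m" j] lt by (cases "j \<le> m") auto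
      moreover have "\<tau> (Suc m) \<le> \<tau> k \<longleftrightarrow> m < k"
        using monoD[OF assms(1), of "Suc m" k] monoD[OF assms(1), of k m] lt by (cases "m < k") auto
      ultimately show ?thesis by (simp add: indicator_def)
    qed simp
  qed
  also have "\<dots> = (\<Sum>m\<in>{j..<k}. F (\<tau> (Suc m)) - F (\<tau> m))"
    using assms by (intro sum.mono_neutral_cong_right) auto
  also have "\<dots> = F (\<tau> k) - F (\<tau> j)"
    using assms(2) sum_Suc_diff'[of j k "\<lambda>m. F (\<tau> m)"] by simp
  finally show ?thesis by simp
qed

text \<open>
  An infinite monotone sequence, of which the first \<open>N\<close> cells matter: the shape in which independence
  of Brownian increments is formulated.
\<close>

definition adapted_partition :: "real \<Rightarrow> step \<Rightarrow> (nat \<Rightarrow> real) \<Rightarrow> nat \<Rightarrow> bool" where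
  "adapted_partition T \<phi> \<tau> N \<longleftrightarrow> mono \<tau> \<and> range \<tau> \<subseteq> {0..T} \<and>
     (\<forall>(c, a, b)\<in>set \<phi>. \<exists>j k. j \<le> k \<and> k \<le> N \<and> a = \<tau> j \<and> b = \<tau> k)"

text \<open>
  The sorted list of all end points, continued by its last element.
\<close>

lemma adapted_partition_exists:
  assumes "step_on T \<phi>" "0 \<le> T"
  shows "\<exists>\<tau> N. adapted_partition T \<phi> \<tau> N"
proof -
  define E where "E = insert 0 (\<Union>(c, a, b)\<in>set \<phi>. {a, b})"
  define L where "L = sorted_list_of_set E"
  define N where "N = length L - 1"
  define \<tau> where "\<tau> n = L ! min n N" for n
  have fin: "finite E" by (auto simp: E_def)
  then have L: "set L = E" "sorted L" by (simp_all add: L_def)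
  have ne: "L \<noteq> []" using L(1) by (auto simp: E_def)
  then have len: "length L = Suc N" by (cases L) (auto simp: N_def)
  have mono: "mono \<tau>"
  proof (rule monoI)
    fix m n :: nat assume "m \<le> n"
    then show "\<tau> m \<le> \<tau> n"
      unfolding \<tau>_def using len by (intro sorted_nth_mono[OF L(2)]) auto
  qed
  have rng: "range \<tau> \<subseteq> E"
    using L(1) len by (auto simp: \<tau>_def intro!: nth_mem)
  have ET: "E \<subseteq> {0..T}" using assms unfolding E_def step_on_def by fastforce
  have ix: "\<exists>i\<le>N. e = \<tau> i" if "e \<in> E" for e
  proof -
    from that obtain i where "i < length L" "e = L ! i" unfolding L(1)[symmetric] by (auto simp: in_set_conv_nth)
    then show ?thesis using len by (intro exI[of _ i]) (auto simp: \<tau>_def)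
  qed
  have "\<exists>j k. j \<le> k \<and> k \<le> N \<and> a = \<tau> j \<and> b = \<tau> k" if "(c, a, b) \<in> set \<phi>" for c a b
  proof -
    have "a \<in> E" "b \<in> E" using that by (force simp: E_def)+
    then obtain j k where jk: "j \<le> N" "a = \<tau> j" "k \<le> N" "b = \<tau> k" using ix by metis
    have ab: "a \<le> b" using assms(1) that by (auto simp: step_on_def)
    show ?thesis
    proof (cases "j \<le> k")
      case False
      then have "\<tau> k \<le> \<tau> j" using monoD[OF mono] by simp
      then have "a = b" using ab jk by simp
      then show ?thesis using jk by auto
    qed (use jk in auto)
  qed
  then have "adapted_partition T \<phi> \<tau> N"
    using mono rng ET by (auto simp: adapted_partition_def)
  then show ?thesis by blast
qed

text \<open>
  For \<open>F = W\<close> this writes a step integral in terms of independent increments; for the primitive \<open>F\<close>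
  of the step function it computes the variance.
\<close>

lemma step_sum_partition:
  fixes F :: "real \<Rightarrow> real"
  assumes "adapted_partition T \<phi> \<tau> N"
  shows "(\<Sum>(c, a, b)\<leftarrow>\<phi>. c * (F b - F a)) = (\<Sum>m<N. step_fun \<phi> (\<tau> (Suc m)) * (F (\<tau> (Suc m)) - F (\<tau> m)))"
  using assms
proof (induction \<phi>)
  case (Cons x \<phi>)
  obtain c a b where x: "x = (c, a, b)" by (cases x)
  from Cons.prems obtain j k where jk: "j \<le> k" "k \<le> N" "a = \<tau> j" "b = \<tau> k" and m: "mono \<tau>"
    by (auto simp: adapted_partition_def x)
  have "adapted_partition T \<phi> \<tau> N" using Cons.prems by (auto simp: adapted_partition_def)
  note IH = Cons.IH[OF this]
  have "(\<Sum>(c, a, b)\<leftarrow>x # \<phi>. c * (F b - F a)) = c * (F (\<tau> k) - F (\<tau> j)) + (\<Sum>(c, a, b)\<leftarrow>\<phi>. c * (F b - F a))"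
    by (simp add: x jk)
  also have "\<dots> = (\<Sum>m<N. step_fun (x # \<phi>) (\<tau> (Suc m)) * (F (\<tau> (Suc m)) - F (\<tau> m)))"
    unfolding telescope_indicator[OF m jk(1,2)] IH sum_distrib_left sum.distrib[symmetric]
    by (rule sum.cong) (simp_all add: x jk distrib_right)
  finally show ?case .
qed simp

lemma step_fun_partition:
  assumes "adapted_partition T \<phi> \<tau> N" and s: "\<tau> m < s" "s \<le> \<tau> (Suc m)"
  shows "step_fun \<phi> s = step_fun \<phi> (\<tau> (Suc m))"
  using assms(1)
proof (induction \<phi>)
  case (Cons x \<phi>)
  obtain c a b where x: "x = (c, a, b)" by (cases x)
  from Cons.prems obtain j k where jk: "j \<le> k" "a = \<tau> j" "b = \<tau> k" and m: "mono \<tau>"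
    by (auto simp: adapted_partition_def x)
  have "\<tau> j < s \<longleftrightarrow> \<tau> j < \<tau> (Suc m)"
    using s monoD[OF m, of j m] monoD[OF m, of "Suc m" j] by (cases "j \<le> m") auto
  moreover have "s \<le> \<tau> k \<longleftrightarrow> \<tau> (Suc m) \<le> \<tau> k"
    using s monoD[OF m, of "Suc m" k] monoD[OF m, of k m] by (cases "k \<le> m") auto
  moreover have "adapted_partition T \<phi> \<tau> N" using Cons.prems by (auto simp: adapted_partition_def)
  ultimately show ?case using Cons.IH by (simp add: x jk indicator_def)
qed simp

lemma lebesgue_interval_measure:
  assumes "0 < T"
  shows "compact_interval_measure (restrict_space lborel {0..T}) T"
proof (intro compact_interval_measure.intro compact_interval_measure_axioms.intro)
  show "finite_measure (restrict_space lborel {0..T})"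
    by (rule finite_measureI) (simp add: space_restrict_space emeasure_restrict_space emeasure_lborel_Icc_eq)
  show "sets (restrict_space lborel {0..T}) = sets (restrict_space borel {0..T})"
    by (rule sets_restrict_space_cong) simp
  show "emeasure (restrict_space lborel {0..T}) {0} = 0"
    using assms by (subst emeasure_restrict_space) auto
qed (fact assms)

text \<open>
  Apply the summation formula to \<open>F t = \<integral>\<^sub>0\<^sup>t \<phi>\<close>, whose increment over a cell is the value of \<open>\<phi>\<close> there
  times the length of the cell.
\<close>

lemma step_fun_square_integral:
  assumes "adapted_partition T \<phi> \<tau> N" "step_on T \<phi>" "0 < T"
  shows "(\<integral>s. (step_fun \<phi> s)\<^sup>2 \<partial>restrict_space lborel {0..T}) =
    (\<Sum>m<N. (step_fun \<phi> (\<tau> (Suc m)))\<^sup>2 * (\<tau> (Suc m) - \<tau> m))"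
proof -
  let ?L = "restrict_space lborel {0..T}"
  interpret compact_interval_measure ?L T by (rule lebesgue_interval_measure) fact
  define F where "F t = (\<integral>s. indicator {..t} s * step_fun \<phi> s \<partial>?L)" for t
  obtain B where "\<And>s. \<bar>step_fun \<phi> s\<bar> \<le> B" using step_fun_bounded by blast
  then have i1: "integrable ?L (step_fun \<phi>)"
    by (intro integrable_const_bound[where B=B]) auto
  have i: "integrable ?L (\<lambda>s. indicator A s * step_fun \<phi> s)" if "A \<in> sets borel" for A
  proof -
    have [measurable]: "(indicator A :: real \<Rightarrow> real) \<in> borel_measurable ?L"
      by (rule borel_measurable_mu, rule borel_measurable_indicator, rule that)
    show ?thesis
      by (rule Bochner_Integration.integrable_bound[OF i1], simp, rule AE_I2) (simp add: indicator_def)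
  qed
  have F: "(\<integral>s. indicator {a<..b} s * step_fun \<phi> s \<partial>?L) = F b - F a" if "a \<le> b" for a b
  proof -
    have "indicator {a<..b} s * step_fun \<phi> s = indicator {..b} s * step_fun \<phi> s - indicator {..a} s * step_fun \<phi> s" for s
      using that by (auto simp: indicator_def)
    then show ?thesis by (simp add: F_def i)
  qed
  have "(\<integral>s. step_fun \<psi> s * step_fun \<phi> s \<partial>?L) = (\<Sum>(c, a, b)\<leftarrow>\<psi>. c * (F b - F a)) \<and>
        integrable ?L (\<lambda>s. step_fun \<psi> s * step_fun \<phi> s)"
    if "step_on T \<psi>" for \<psi>
    using that
  proof (induction \<psi>)
    case (Cons x \<psi>)
    obtain c a b where x: "x = (c, a, b)" by (cases x)
    have ab: "a \<le> b" and st: "step_on T \<psi>" using Cons.prems by (simp_all add: x)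
    note IH = Cons.IH[OF st]
    have "(\<lambda>s. step_fun (x # \<psi>) s * step_fun \<phi> s) =
        (\<lambda>s. c * (indicator {a<..b} s * step_fun \<phi> s) + step_fun \<psi> s * step_fun \<phi> s)"
      by (simp add: x algebra_simps)
    then show ?case using IH i by (simp add: F[OF ab] x)
  qed simp
  from this[OF assms(2)] have "(\<integral>s. (step_fun \<phi> s)\<^sup>2 \<partial>?L) = (\<Sum>(c, a, b)\<leftarrow>\<phi>. c * (F b - F a))"
    by (simp add: power2_eq_square)
  also have "\<dots> = (\<Sum>m<N. step_fun \<phi> (\<tau> (Suc m)) * (F (\<tau> (Suc m)) - F (\<tau> m)))"
    by (rule step_sum_partition[OF assms(1)])
  also have "\<dots> = (\<Sum>m<N. (step_fun \<phi> (\<tau> (Suc m)))\<^sup>2 * (\<tau> (Suc m) - \<tau> m))"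
  proof (rule sum.cong[OF refl])
    fix m
    have le: "\<tau> m \<le> \<tau> (Suc m)"
      using assms(1) by (auto simp: adapted_partition_def dest: monoD[of _ m "Suc m"])
    have r: "\<tau> j \<in> {0..T}" for j using assms(1) unfolding adapted_partition_def by blast
    note rng = r[of m] r[of "Suc m"]
    have "F (\<tau> (Suc m)) - F (\<tau> m) = (\<integral>s. indicator {\<tau> m<..\<tau> (Suc m)} s * step_fun \<phi> s \<partial>?L)"
      by (rule F[OF le, symmetric])
    also have "\<dots> = (\<integral>s. step_fun \<phi> (\<tau> (Suc m)) * indicator {\<tau> m<..\<tau> (Suc m)} s \<partial>?L)"
      by (intro Bochner_Integration.integral_cong refl)
        (auto simp: indicator_def step_fun_partition[OF assms(1)])
    also have "\<dots> = step_fun \<phi> (\<tau> (Suc m)) * measure ?L {\<tau> m<..\<tau> (Suc m)}"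
    proof -
      have "{\<tau> m<..\<tau> (Suc m)} \<inter> {0..T} = {\<tau> m<..\<tau> (Suc m)}" using rng by auto
      then show ?thesis by simp
    qed
    also have "measure ?L {\<tau> m<..\<tau> (Suc m)} = \<tau> (Suc m) - \<tau> m"
      using rng le by (subst measure_restrict_space) auto
    finally show "step_fun \<phi> (\<tau> (Suc m)) * (F (\<tau> (Suc m)) - F (\<tau> m)) =
        (step_fun \<phi> (\<tau> (Suc m)))\<^sup>2 * (\<tau> (Suc m) - \<tau> m)" by (simp add: power2_eq_square)
  qed
  finally show ?thesis .
qed

lemma centered_normal_0:
  assumes "prob_space P" shows "centered_normal P (\<lambda>_. 0) 0"
proof -
  interpret prob_space P by fact
  show ?thesis by (simp add: centered_normal_def char_def integral_return)
qed

lemma centered_normal_cmult: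
  assumes "prob_space P" "centered_normal P Y v"
  shows "centered_normal P (\<lambda>\<omega>. c * Y \<omega>) (c\<^sup>2 * v)"
proof -
  have [measurable]: "Y \<in> borel_measurable P" using assms(2) by (simp add: centered_normal_def)
  have "char (distr P borel (\<lambda>\<omega>. c * Y \<omega>)) u = char (distr P borel Y) (u * c)" for u
    by (simp add: char_def integral_distr mult.assoc)
  then show ?thesis using assms(2) by (simp add: centered_normal_def power_mult_distrib mult.assoc)
qed

lemma centered_normal_distributed:
  assumes "prob_space P" "0 < \<sigma>" and D: "distributed P lborel Y (\<lambda>x. ennreal (normal_density 0 \<sigma> x))"
  shows "centered_normal P Y (\<sigma>\<^sup>2)"
proof -
  interpret prob_space P by fact
  have Ym[measurable]: "Y \<in> borel_measurable P" using distributed_measurable[OF D] by simp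
  have "distributed P lborel (\<lambda>x. (Y x - 0) / \<sigma>) (\<lambda>x. ennreal (std_normal_density x))"
    using D normal_standard_normal_convert[OF assms(2), of Y 0] by simp
  from distributed_distr_eq_density[OF this]
  have "distr P lborel (\<lambda>x. Y x / \<sigma>) = std_normal_distribution" by simp
  moreover have "distr P lborel (\<lambda>x. Y x / \<sigma>) = distr P borel (\<lambda>x. Y x / \<sigma>)"
    by (rule distr_cong) simp_all
  ultimately have d: "distr P borel (\<lambda>x. Y x / \<sigma>) = std_normal_distribution" by simp
  have "centered_normal P (\<lambda>x. Y x / \<sigma>) 1"
    unfolding centered_normal_def d by (simp add: char_std_normal_distribution)
  from centered_normal_cmult[OF assms(1) this, of \<sigma>] show ?thesis using assms(2) by simp
qed

text \<open>
  On an adapted partition the step integral is a linear combination of independent centered normal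
  increments, so its characteristic function is a product.
\<close>

lemma brownian_gaussian_integrator:
  assumes P: "prob_space P" and T: "0 < T" and W: "brownian_motion P T W"
  shows "gaussian_integrator P (restrict_space lborel {0..T}) T W"
proof (intro gaussian_integrator.intro gaussian_integrator_axioms.intro)
  interpret prob_space P by fact
  show "prob_space P" by fact
  show "compact_interval_measure (restrict_space lborel {0..T}) T" by (rule lebesgue_interval_measure[OF T])
  show m: "W t \<in> borel_measurable P" if "t \<in> {0..T}" for t
    using W that by (simp add: brownian_motion_def)
  fix \<phi> assume \<phi>: "step_on T \<phi>"
  obtain \<tau> N where tau: "adapted_partition T \<phi> \<tau> N" using adapted_partition_exists[OF \<phi>] T by auto
  have mono: "mono \<tau>" and rng: "range \<tau> \<subseteq> {0..T}" using tau by (auto simp: adapted_partition_def)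
  define D where "D k \<omega> = W (\<tau> (Suc k)) \<omega> - W (\<tau> k) \<omega>" for k \<omega>
  define d where "d k = step_fun \<phi> (\<tau> (Suc k))" for k
  have D: "centered_normal P (D k) (\<tau> (Suc k) - \<tau> k)" for k
  proof (cases "\<tau> k = \<tau> (Suc k)")
    case True
    then show ?thesis using centered_normal_0[OF P] by (simp add: D_def[abs_def])
  next
    case False
    then have lt: "\<tau> k < \<tau> (Suc k)" using monoD[OF mono, of k "Suc k"] by simp
    have "distributed P lborel (D k) (\<lambda>x. ennreal (normal_density 0 (sqrt (\<tau> (Suc k) - \<tau> k)) x))"
    proof -
      have r: "\<tau> j \<in> {0..T}" for j using rng by blast
      have "\<forall>s\<in>{0..T}. \<forall>t\<in>{0..T}. s < t \<longrightarrow> distributed P lborel (\<lambda>\<omega>. W t \<omega> - W s \<omega>)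
          (\<lambda>x. ennreal (normal_density 0 (sqrt (t - s)) x))"
        using W unfolding brownian_motion_def by blast
      from this[rule_format, OF r r lt] show ?thesis unfolding D_def[abs_def] .
    qed
    from centered_normal_distributed[OF P _ this] show ?thesis using lt by simp
  qed
  have "indep_vars (\<lambda>_. borel) D {..<N}"
    using W mono rng unfolding brownian_motion_def D_def[abs_def] by blast
  then have indep: "indep_vars (\<lambda>_. borel) (\<lambda>k \<omega>. d k * D k \<omega>) {..<N}"
    by (rule indep_vars_compose2[where Y="\<lambda>k x. d k * x"]) simp
  have SI: "step_integral W \<phi> = (\<lambda>\<omega>. \<Sum>k<N. d k * D k \<omega>)"
    using step_sum_partition[OF tau, of "\<lambda>t. W t _"] by (simp add: fun_eq_iff step_integral_def d_def D_def)
  have Dm: "D k \<in> borel_measurable P" for k using D[of k] by (simp add: centered_normal_def)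
  have "char (distr P borel (step_integral W \<phi>)) u =
      complex_of_real (exp (- (u\<^sup>2 * (\<Sum>k<N. (d k)\<^sup>2 * (\<tau> (Suc k) - \<tau> k)) / 2)))" for u
  proof -
    have "char (distr P borel (step_integral W \<phi>)) u = (\<Prod>k<N. char (distr P borel (\<lambda>\<omega>. d k * D k \<omega>)) u)"
      unfolding SI by (rule char_distr_sum[OF indep])
    also have "\<dots> = (\<Prod>k<N. complex_of_real (exp (- (u\<^sup>2 * ((d k)\<^sup>2 * (\<tau> (Suc k) - \<tau> k)) / 2))))"
      using centered_normal_cmult[OF P D] by (simp add: centered_normal_def)
    also have "\<dots> = complex_of_real (exp (\<Sum>k<N. - (u\<^sup>2 * ((d k)\<^sup>2 * (\<tau> (Suc k) - \<tau> k)) / 2)))"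
      by (simp add: exp_sum)
    also have "(\<Sum>k<N. - (u\<^sup>2 * ((d k)\<^sup>2 * (\<tau> (Suc k) - \<tau> k)) / 2)) = - (u\<^sup>2 * (\<Sum>k<N. (d k)\<^sup>2 * (\<tau> (Suc k) - \<tau> k)) / 2)"
      by (simp add: sum_negf sum_distrib_left sum_divide_distrib)
    finally show ?thesis .
  qed
  moreover have "step_integral W \<phi> \<in> borel_measurable P" unfolding SI using Dm by simp
  ultimately show "centered_normal P (step_integral W \<phi>) (\<integral>s. (step_fun \<phi> s)\<^sup>2 \<partial>restrict_space lborel {0..T})"
    unfolding centered_normal_def step_fun_square_integral[OF tau \<phi> T] d_def by simp
qed

locale deterministic_volatility =
  fixes T :: real and z :: "real \<Rightarrow> real"
  assumes T: "0 < T"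
    and z_meas: "z \<in> borel_measurable (restrict_space lborel {0..T})"
    and z_int: "set_integrable lborel {0..T} (\<lambda>s. (z s)\<^sup>2)"
    and z_nz: "AE s in lborel. s \<in> {0..T} \<longrightarrow> z s \<noteq> 0"
begin

abbreviation "L \<equiv> restrict_space lborel {0..T}"
abbreviation "\<mu> \<equiv> qv_measure T z"

sublocale L: compact_interval_measure L T by (rule lebesgue_interval_measure[OF T])

lemma z_L_integrable: "integrable L (\<lambda>s. (z s)\<^sup>2)"
  using z_int by (subst integrable_restrict_space) (auto simp: set_integrable_def)

lemma sets_qv_measure [measurable_cong]: "sets \<mu> = sets L"
  by (simp add: qv_measure_def)

lemma emeasure_qv_measure: "A \<in> sets L \<Longrightarrow> emeasure \<mu> A = (\<integral>\<^sup>+s. ennreal ((z s)\<^sup>2) * indicator A s \<partial>L)"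
  unfolding qv_measure_def using z_meas by (subst emeasure_density) auto

sublocale mu: compact_interval_measure \<mu> T
proof (intro compact_interval_measure.intro compact_interval_measure_axioms.intro)
  show s: "sets \<mu> = sets (restrict_space borel {0..T})"
    by (simp add: sets_qv_measure L.sets_mu)
  have "emeasure \<mu> (space L) = (\<integral>\<^sup>+s. ennreal ((z s)\<^sup>2) \<partial>L)"
    by (subst emeasure_qv_measure) (auto simp: L.sets_mu_iff L.space_mu intro!: nn_integral_cong)
  also have "\<dots> < \<infinity>" using z_L_integrable by (simp add: integrable_iff_bounded)
  finally show "finite_measure \<mu>"
    using sets_eq_imp_space_eq[OF sets_qv_measure] by (intro finite_measureI) auto
  have "AE s in L. ennreal ((z s)\<^sup>2) * indicator {0} s = 0"
    using L.AE_pos by eventually_elim simp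
  then have "(\<integral>\<^sup>+s. ennreal ((z s)\<^sup>2) * indicator {0} s \<partial>L) = (\<integral>\<^sup>+s. 0 \<partial>L)"
    by (rule nn_integral_cong_AE)
  moreover have "{0} \<in> sets L" using T by (simp add: L.sets_mu_iff)
  ultimately show "emeasure \<mu> {0} = 0" by (simp add: emeasure_qv_measure)
qed (fact T)

lemma integral_qv_measure:
  fixes f :: "real \<Rightarrow> real"
  assumes "f \<in> borel_measurable L"
  shows "(\<integral>s. f s \<partial>\<mu>) = (\<integral>s. (z s)\<^sup>2 * f s \<partial>L)"
  unfolding qv_measure_def using assms z_meas by (subst integral_density) auto

end

text \<open>
  The integral of a step function \<open>\<phi>\<close> against \<open>M\<close> is the Wiener integral of \<open>z \<phi>\<close> against \<open>W\<close>, with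
  variance \<open>\<integral> z\<^sup>2 \<phi>\<^sup>2\<close>, which is \<open>\<integral> \<phi>\<^sup>2 d\<langle>M\<rangle>\<close>.
\<close>

lemma (in deterministic_volatility) volatility_integral_gaussian_integrator:
  assumes P: "prob_space P" and W: "brownian_motion P T W"
    and M_meas: "\<And>t. t \<in> {0..T} \<Longrightarrow> M t \<in> borel_measurable P"
    and M: "\<And>t. t \<in> {0..T} \<Longrightarrow> AE \<omega> in P. M t \<omega> = wiener_integral P L T W (\<lambda>s. z s * indicator {0..t} s) \<omega>"
  shows "gaussian_integrator P \<mu> T M"
proof (intro gaussian_integrator.intro gaussian_integrator_axioms.intro)
  show "prob_space P" by fact
  show "compact_interval_measure \<mu> T" by unfold_locales
  show "\<And>t. t \<in> {0..T} \<Longrightarrow> M t \<in> borel_measurable P" by fact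
  interpret W: gaussian_integrator P L T W by (rule brownian_gaussian_integrator[OF P T W])
  note z_meas[measurable]
  have ind[measurable]: "(\<lambda>s. indicator {0..t} s :: real) \<in> borel_measurable L" for t
    by (rule L.borel_measurable_mu) simp
  have wM: "W.wiener (\<lambda>s. z s * indicator {0..t} s) (M t)" if t: "t \<in> {0..T}" for t
  proof (rule W.wiener_cong_AE[OF W.wiener_integral_wiener])
    show "(\<lambda>s. z s * indicator {0..t} s) \<in> borel_measurable L" by measurable
    then show "(\<lambda>s. z s * indicator {0..t} s) \<in> borel_measurable L" .
    show "integrable L (\<lambda>s. (z s * indicator {0..t} s)\<^sup>2)"
      by (rule Bochner_Integration.integrable_bound[OF z_L_integrable], measurable, rule AE_I2) (simp add: indicator_def)
    show "AE \<omega> in P. wiener_integral P L T W (\<lambda>s. z s * indicator {0..t} s) \<omega> = M t \<omega>"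
      using M[OF t] by eventually_elim simp
  qed (use M_meas t in auto)
  fix \<phi> assume \<phi>: "step_on T \<phi>"
  then have w: "W.wiener (\<lambda>s. z s * step_fun \<phi> s) (step_integral M \<phi>)"
  proof (induction \<phi>)
    case Nil
    have "step_fun [] = (\<lambda>s. 0)" "step_integral W [] = (\<lambda>\<omega>. 0)" "step_integral M [] = (\<lambda>\<omega>. 0)" by (simp_all add: fun_eq_iff)
    then show ?case using W.wiener_step[of "[]"] by simp
  next
    case (Cons x \<phi>)
    obtain c a b where x: "x = (c, a, b)" by (cases x)
    have ab: "0 \<le> a" "a \<le> b" "b \<le> T" "step_on T \<phi>" using Cons.prems by (simp_all add: x)
    have "W.wiener (\<lambda>s. c * (z s * indicator {0..b} s - z s * indicator {0..a} s) + z s * step_fun \<phi> s)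
        (\<lambda>\<omega>. c * (M b \<omega> - M a \<omega>) + step_integral M \<phi> \<omega>)"
      using ab by (intro W.wiener_add W.wiener_cmult W.wiener_diff wM Cons.IH) auto
    moreover have "(\<lambda>s. c * (z s * indicator {0..b} s - z s * indicator {0..a} s) + z s * step_fun \<phi> s) =
        (\<lambda>s. z s * step_fun (x # \<phi>) s)"
      using ab by (auto simp: x indicator_def algebra_simps fun_eq_iff)
    moreover have "(\<lambda>\<omega>. c * (M b \<omega> - M a \<omega>) + step_integral M \<phi> \<omega>) = step_integral M (x # \<phi>)"
      by (simp add: x fun_eq_iff)
    ultimately show ?case by simp
  qed
  have "(\<integral>s. (step_fun \<phi> s)\<^sup>2 \<partial>\<mu>) = (\<integral>s. (z s * step_fun \<phi> s)\<^sup>2 \<partial>L)"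
    by (subst integral_qv_measure) (auto simp: power_mult_distrib)
  with W.wiener_normal(2)[OF w] show "centered_normal P (step_integral M \<phi>) (\<integral>s. (step_fun \<phi> s)\<^sup>2 \<partial>\<mu>)"
    by simp
qed

section \<open>Two kernels on an interval\<close>

text \<open>
  The operator \<open>f \<mapsto> f - (1 / x) \<integral>\<^sub>0\<^sup>x f\<close> on \<open>L\<^sup>2[0, Q]\<close> maps the indicator of \<open>[0, y)\<close> to this
  function, almost everywhere.
\<close>

definition kernel_A :: "real \<Rightarrow> real \<Rightarrow> real" where
  "kernel_A y x = (if y < x then - (y / x) else 0)"

text \<open>
  The operator \<open>f \<mapsto> f - \<integral>\<^sub>x\<^sup>Q f(u) / u du\<close> on \<open>L\<^sup>2[0, Q]\<close> maps the indicator of \<open>[0, y)\<close> to this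
  function, almost everywhere.
\<close>

definition kernel_B :: "real \<Rightarrow> real \<Rightarrow> real" where
  "kernel_B y x = (if x < y then 1 + ln (x / y) else 0)"

lemma kernel_measurable [measurable]:
  "kernel_A y \<in> borel_measurable borel" "kernel_B y \<in> borel_measurable borel"
  unfolding kernel_A_def[abs_def] kernel_B_def[abs_def] by measurable

lemma has_bochner_integral_restrict_lborel:
  fixes f g :: "real \<Rightarrow> real"
  assumes "has_bochner_integral lborel g v" and f: "f \<in> borel_measurable borel"
    and "AE x in lborel. g x = indicator {0..Q} x * f x"
  shows "has_bochner_integral (restrict_space lborel {0..Q}) f v"
proof -
  have "has_bochner_integral lborel (\<lambda>x. indicator {0..Q} x *\<^sub>R f x) v"
  proof (rule has_bochner_integralI_AE[OF assms(1)])
    note f[measurable]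
    show "(\<lambda>x. indicator {0..Q} x *\<^sub>R f x) \<in> borel_measurable lborel" by measurable
  qed (use assms(3) in simp)
  then show ?thesis
    by (auto simp: has_bochner_integral_iff integrable_restrict_space integral_restrict_space set_lebesgue_integral_def)
qed

lemma kernel_A_inner:
  assumes "0 < Q" "a \<in> {0..Q}" "b \<in> {0..Q}"
  shows "has_bochner_integral (restrict_space lborel {0..Q}) (\<lambda>x. kernel_A a x * kernel_A b x) (min a b - a * b / Q)"
proof (cases "max a b = 0")
  case True
  then have "a = 0" "b = 0" using assms by auto
  then have "(\<lambda>x. kernel_A a x * kernel_A b x) = (\<lambda>x. 0)" by (simp add: kernel_A_def fun_eq_iff)
  then show ?thesis using \<open>a = 0\<close> \<open>b = 0\<close> has_bochner_integral_zero by simp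
next
  case False
  define m where "m = max a b"
  have m: "0 < m" "m \<le> Q" using False assms by (auto simp: m_def)
  have "has_bochner_integral lborel (\<lambda>x. (a * b / x\<^sup>2) * indicator {m..Q} x) ((- (a * b / Q)) - (- (a * b / m)))"
  proof (rule has_bochner_integral_FTC_Icc_real[OF m(2)])
    fix x assume "m \<le> x" "x \<le> Q"
    then have "x \<noteq> 0" using m by auto
    then show "((\<lambda>x. - (a * b / x)) has_real_derivative a * b / x\<^sup>2) (at x)"
      by (auto intro!: derivative_eq_intros simp: power2_eq_square)
    show "isCont (\<lambda>x. a * b / x\<^sup>2) x" using \<open>x \<noteq> 0\<close> by (intro continuous_intros) auto
  qed
  moreover have "- (a * b / Q) - (- (a * b / m)) = min a b - a * b / Q"
    using m(1) assms(2,3) by (cases "a \<le> b") (auto simp: m_def max_absorb1 max_absorb2 min_def)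
  ultimately have "has_bochner_integral lborel (\<lambda>x. (a * b / x\<^sup>2) * indicator {m..Q} x) (min a b - a * b / Q)"
    by simp
  then show ?thesis
  proof (rule has_bochner_integral_restrict_lborel)
    have "AE x in lborel. x \<noteq> m" by (rule AE_lborel_singleton)
    then show "AE x in lborel. a * b / x\<^sup>2 * indicator {m..Q} x = indicator {0..Q} x * (kernel_A a x * kernel_A b x)"
    proof eventually_elim
      case (elim x)
      then show ?case using m unfolding m_def
        by (auto simp: kernel_A_def indicator_def power2_eq_square max_def split: if_splits)
    qed
  qed measurable
qed

text \<open>
  The product \<open>(1 + l)(1 + l')\<close> with \<open>l = ln (x / a)\<close>, \<open>l' = ln (x / b)\<close> is the derivative of
  \<open>x + x l l'\<close>, because \<open>x l\<close> has derivative \<open>1 + l\<close>.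
\<close>

lemma kernel_B_primitive:
  assumes "0 < a" "0 < b" "0 < (x::real)"
  shows "((\<lambda>x. x + x * (ln (x / a) * ln (x / b))) has_real_derivative (1 + ln (x / a)) * (1 + ln (x / b))) (at x)"
  using assms by (auto intro!: derivative_eq_intros simp: field_simps)

lemma kernel_B_primitive_limits:
  assumes "0 < a" "0 < (b::real)"
  shows "((\<lambda>x. x + x * (ln (x / a) * ln (x / b))) \<longlongrightarrow> 0) (at_right 0)"
    and "((\<lambda>x. x + x * (ln (x / a) * ln (x / b))) \<longlongrightarrow> a) (at_left a)"
proof -
  have "((\<lambda>x::real. x + (x * (ln x)\<^sup>2 - (ln a + ln b) * (x * ln x) + (ln a * ln b) * x)) \<longlongrightarrow>
      0 + (0 - (ln a + ln b) * 0 + (ln a * ln b) * 0)) (at_right 0)"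
  proof (intro tendsto_add tendsto_diff tendsto_mult tendsto_const)
    show "((\<lambda>x::real. x) \<longlongrightarrow> 0) (at_right 0)" "((\<lambda>x::real. x) \<longlongrightarrow> 0) (at_right 0)" by real_asymp+
    show "((\<lambda>x::real. x * (ln x)\<^sup>2) \<longlongrightarrow> 0) (at_right 0)" by real_asymp
    show "((\<lambda>x::real. x * ln x) \<longlongrightarrow> 0) (at_right 0)" by real_asymp
  qed
  moreover have "\<forall>\<^sub>F x in at_right 0. x + (x * (ln x)\<^sup>2 - (ln a + ln b) * (x * ln x) + (ln a * ln b) * x) =
      x + x * (ln (x / a) * ln (x / b))"
    using eventually_at_right_less[of "0::real"]
  proof eventually_elim
    case (elim x)
    then show ?case using assms by (simp add: ln_div power2_eq_square algebra_simps)
  qed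
  ultimately show "((\<lambda>x. x + x * (ln (x / a) * ln (x / b))) \<longlongrightarrow> 0) (at_right 0)"
    by (auto intro: Lim_transform_eventually)
  have "isCont (\<lambda>x. x + x * (ln (x / a) * ln (x / b))) a"
    using kernel_B_primitive[OF assms assms(1)] by (rule DERIV_isCont)
  then have "((\<lambda>x. x + x * (ln (x / a) * ln (x / b))) \<longlongrightarrow> a) (at a)"
    using assms by (simp add: isCont_def)
  then show "((\<lambda>x. x + x * (ln (x / a) * ln (x / b))) \<longlongrightarrow> a) (at_left a)"
    by (rule filterlim_mono) (auto simp: at_le)
qed

text \<open>
  The primitive vanishes at \<open>0\<close> and equals \<open>a\<close> at \<open>a\<close>, where \<open>ln (x / a)\<close> vanishes.  The integrand may
  change sign near the singularity at \<open>0\<close>, so its integrability is first obtained from the two squares,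
  for which the fundamental theorem applies to nonnegative functions.
\<close>

lemma kernel_B_inner_le:
  assumes "0 \<le> a" "a \<le> b" "b \<le> Q"
  shows "has_bochner_integral (restrict_space lborel {0..Q}) (\<lambda>x. kernel_B a x * kernel_B b x) a"
proof (cases "a = 0")
  case True
  have "has_bochner_integral (restrict_space lborel {0..Q}) (\<lambda>x. 0::real) 0"
    by (rule has_bochner_integral_zero)
  then show ?thesis
    by (rule has_bochner_integral_cong[THEN iffD1, rotated 3])
      (auto simp: kernel_B_def True space_restrict_space)
next
  case False
  then have ab: "0 < a" "0 < b" using assms by auto
  have sq: "set_integrable lborel {0<..<a} (\<lambda>x. (1 + ln (x / c)) * (1 + ln (x / c)))" if c: "a \<le> c" "0 < c" for c
  proof -
    have "set_integrable lborel (einterval (ereal 0) (ereal c)) (\<lambda>x. (1 + ln (x / c)) * (1 + ln (x / c)))"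
    proof (rule interval_integral_FTC_nonneg(1))
      show "((\<lambda>x. x + x * (ln (x / c) * ln (x / c))) has_real_derivative (1 + ln (x / c)) * (1 + ln (x / c))) (at x)"
        if "ereal 0 < ereal x" for x
        using kernel_B_primitive[OF c(2) c(2)] that by simp
      show "(((\<lambda>x. x + x * (ln (x / c) * ln (x / c))) \<circ> real_of_ereal) \<longlongrightarrow> 0) (at_right (ereal 0))"
        "(((\<lambda>x. x + x * (ln (x / c) * ln (x / c))) \<circ> real_of_ereal) \<longlongrightarrow> c) (at_left (ereal c))"
        using kernel_B_primitive_limits[OF c(2) c(2)] by (simp_all only: ereal_tendsto_simps)
      show "isCont (\<lambda>x. (1 + ln (x / c)) * (1 + ln (x / c))) x" if "ereal 0 < ereal x" for x
        using that c by (intro continuous_intros) auto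
    qed (use c in auto)
    then show ?thesis
      by (rule set_integrable_subset) (use c in \<open>auto simp: einterval_eq\<close>)
  qed
  have int: "set_integrable lborel {0<..<a} (\<lambda>x. (1 + ln (x / a)) * (1 + ln (x / b)))"
  proof -
    have "integrable lborel (\<lambda>x. (indicator {0<..<a} x * (1 + ln (x / a))) * (indicator {0<..<a} x * (1 + ln (x / b))))"
    proof (rule square_integrable_mult)
      have *: "(indicator {0<..<a} x * y)\<^sup>2 = indicator {0<..<a} x *\<^sub>R (y * y)" for x y :: real
        by (auto simp: indicator_def power2_eq_square)
      show "integrable lborel (\<lambda>x. (indicator {0<..<a} x * (1 + ln (x / a)))\<^sup>2)"
        "integrable lborel (\<lambda>x. (indicator {0<..<a} x * (1 + ln (x / b)))\<^sup>2)"
        using sq[of a] sq[of b] ab assms unfolding * set_integrable_def by auto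
    qed measurable
    moreover have "(indicator {0<..<a} x * (1 + ln (x / a))) * (indicator {0<..<a} x * (1 + ln (x / b))) =
        indicator {0<..<a} x *\<^sub>R ((1 + ln (x / a)) * (1 + ln (x / b)))" for x
      by (auto simp: indicator_def)
    ultimately show ?thesis unfolding set_integrable_def by simp
  qed
  have "(LBINT x=ereal 0..ereal a. (1 + ln (x / a)) * (1 + ln (x / b))) = a - 0"
  proof (rule interval_integral_FTC_integrable)
    show "((\<lambda>x. x + x * (ln (x / a) * ln (x / b))) has_vector_derivative (1 + ln (x / a)) * (1 + ln (x / b))) (at x)"
      if "ereal 0 < ereal x" for x
      unfolding has_real_derivative_iff_has_vector_derivative[symmetric]
      using kernel_B_primitive[OF ab] that by simp
    show "isCont (\<lambda>x. (1 + ln (x / a)) * (1 + ln (x / b))) x" if "ereal 0 < ereal x" for x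
      using that ab by (intro continuous_intros) auto
    show "set_integrable lborel (einterval (ereal 0) (ereal a)) (\<lambda>x. (1 + ln (x / a)) * (1 + ln (x / b)))"
      using int by (simp add: einterval_eq)
    show "(((\<lambda>x. x + x * (ln (x / a) * ln (x / b))) \<circ> real_of_ereal) \<longlongrightarrow> 0) (at_right (ereal 0))"
      "(((\<lambda>x. x + x * (ln (x / a) * ln (x / b))) \<circ> real_of_ereal) \<longlongrightarrow> a) (at_left (ereal a))"
      using kernel_B_primitive_limits[OF ab] by (simp_all only: ereal_tendsto_simps)
  qed (use ab in auto)
  then have "(LBINT x:{0<..<a}. (1 + ln (x / a)) * (1 + ln (x / b))) = a"
    using ab by (simp add: interval_lebesgue_integral_le_eq einterval_eq)
  with int have "has_bochner_integral lborel (\<lambda>x. indicator {0<..<a} x *\<^sub>R ((1 + ln (x / a)) * (1 + ln (x / b)))) a"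
    by (simp add: has_bochner_integral_iff set_integrable_def set_lebesgue_integral_def)
  then show ?thesis
  proof (rule has_bochner_integral_restrict_lborel)
    have "AE x in lborel. x \<noteq> (0::real)" by (rule AE_lborel_singleton)
    then show "AE x in lborel. indicator {0<..<a} x *\<^sub>R ((1 + ln (x / a)) * (1 + ln (x / b))) =
        indicator {0..Q} x * (kernel_B a x * kernel_B b x)"
      by eventually_elim (use assms in \<open>auto simp: kernel_B_def indicator_def\<close>)
  qed measurable
qed

lemma kernel_B_inner:
  assumes "a \<in> {0..Q}" "b \<in> {0..Q}"
  shows "has_bochner_integral (restrict_space lborel {0..Q}) (\<lambda>x. kernel_B a x * kernel_B b x) (min a b)"
proof (cases "a \<le> b")
  case True
  then show ?thesis using kernel_B_inner_le[of a b Q] assms by (simp add: min_def)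
next
  case False
  then show ?thesis using kernel_B_inner_le[of b a Q] assms by (simp add: min_def mult.commute)
qed

section \<open>The clock of the martingale\<close>

lemma emeasure_density_indicator:
  assumes "A \<in> sets borel" "B \<in> sets borel"
  shows "emeasure (density lborel (indicator A)) B = emeasure lborel (A \<inter> B)"
  using assms by (simp add: emeasure_density indicator_inter_arith[symmetric])

context deterministic_volatility
begin

abbreviation "q \<equiv> qv z"
abbreviation "Q \<equiv> qv z T"

lemma qv_eq_L: "t \<in> {0..T} \<Longrightarrow> q t = (\<integral>s. (z s)\<^sup>2 * indicator {0..t} s \<partial>L)"
  unfolding qv_def set_lebesgue_integral_def
  by (subst integral_restrict_space)
    (auto simp: set_lebesgue_integral_def indicator_def intro!: Bochner_Integration.integral_cong)

lemma z2_indicator_integrable: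
  assumes "A \<in> sets L" shows "integrable L (\<lambda>s. (z s)\<^sup>2 * indicator A s)"
  using integrable_mult_indicator[OF assms z_L_integrable] by (simp add: mult.commute)

lemma measure_qv:
  assumes "A \<in> sets L" shows "measure \<mu> A = (\<integral>s. (z s)\<^sup>2 * indicator A s \<partial>L)"
proof -
  note z_meas[measurable] assms[measurable]
  have "measure \<mu> A = (\<integral>s. indicator A s \<partial>\<mu>)"
    using assms by (simp add: sets_qv_measure[THEN equalityD2, THEN subsetD] measure_def)
  also have "\<dots> = (\<integral>s. (z s)\<^sup>2 * indicator A s \<partial>L)"
    by (rule integral_qv_measure) measurable
  finally show ?thesis .
qed

lemma Icc_sets_L: "t \<in> {0..T} \<Longrightarrow> {0..t} \<in> sets L" "t \<in> {0..T} \<Longrightarrow> {t..T} \<in> sets L"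
  by (auto simp: L.sets_mu_iff)

lemma measure_Icc: "t \<in> {0..T} \<Longrightarrow> measure \<mu> {0..t} = q t"
  by (simp add: measure_qv Icc_sets_L qv_eq_L)

lemma AE_neq: "AE s in \<mu>. s \<noteq> t"
proof -
  have "AE s in lborel. s \<noteq> t" by (rule AE_lborel_singleton)
  then have "AE s in L. s \<noteq> t" by (subst AE_restrict_space_iff) (auto elim: eventually_mono)
  moreover have "absolutely_continuous L \<mu>"
    unfolding qv_measure_def using z_meas by (intro absolutely_continuousI_density) auto
  ultimately show ?thesis
    using absolutely_continuous_AE[OF sets_qv_measure] by blast
qed

lemma qv_0 [simp]: "q 0 = 0"
proof -
  have "measure \<mu> {0} = 0" using mu.null_0 by (simp add: measure_def)
  then show ?thesis using measure_Icc[of 0] T by simp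
qed

lemma measure_Ioc:
  assumes "s \<in> {0..T}" "t \<in> {0..T}" "s \<le> t" shows "measure \<mu> {s<..t} = q t - q s"
proof -
  have "{s<..t} = {0..t} - {0..s}" using assms by auto
  then have "measure \<mu> {s<..t} = measure \<mu> {0..t} - measure \<mu> {0..s}"
    using assms by (simp add: mu.finite_measure_Diff sets_qv_measure Icc_sets_L)
  then show ?thesis using assms by (simp add: measure_Icc)
qed

text \<open>
  If \<open>q\<close> were constant on \<open>[s, t]\<close>, then \<open>z\<close> would vanish almost everywhere on an interval of positive
  length.
\<close>

lemma qv_strict_mono:
  assumes "s \<in> {0..T}" "t \<in> {0..T}" "s < t" shows "q s < q t"
proof (rule ccontr)
  assume "\<not> q s < q t"
  then have "measure \<mu> {s<..t} \<le> 0" using measure_Ioc[OF assms(1,2)] assms(3) by simp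
  then have "measure \<mu> {s<..t} = 0" by (simp add: measure_le_0_iff)
  moreover have A: "{s<..t} \<in> sets L" using assms by (auto simp: L.sets_mu_iff)
  ultimately have "(\<integral>u. (z u)\<^sup>2 * indicator {s<..t} u \<partial>L) = 0" by (simp add: measure_qv)
  then have "AE u in L. (z u)\<^sup>2 * indicator {s<..t} u = 0"
    using z2_indicator_integrable[OF A] by (subst (asm) integral_nonneg_eq_0_iff_AE) auto
  moreover have "AE u in L. z u \<noteq> 0" using z_nz by (simp add: AE_restrict_space_iff)
  ultimately have "AE u in L. u \<notin> {s<..t}" by eventually_elim (auto simp: indicator_def)
  then have "AE u in lborel. u \<in> {0..T} \<longrightarrow> u \<notin> {s<..t}" by (simp add: AE_restrict_space_iff)
  then have "AE u in lborel. u \<notin> {s<..t}" by eventually_elim (use assms in auto)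
  then have "{s<..t} \<in> null_sets lborel" by (subst AE_iff_null_sets) auto
  then show False using assms(3) by (simp add: null_sets_def)
qed

lemma qv_mono: "s \<in> {0..T} \<Longrightarrow> t \<in> {0..T} \<Longrightarrow> s \<le> t \<Longrightarrow> q s \<le> q t"
  using qv_strict_mono[of s t] by (cases "s = t") auto

lemma qv_less_iff: "s \<in> {0..T} \<Longrightarrow> t \<in> {0..T} \<Longrightarrow> q s < q t \<longleftrightarrow> s < t"
  using qv_strict_mono[of s t] qv_mono[of t s] by (cases "s < t") auto

lemma qv_le_iff: "s \<in> {0..T} \<Longrightarrow> t \<in> {0..T} \<Longrightarrow> q s \<le> q t \<longleftrightarrow> s \<le> t"
  using qv_less_iff[of t s] by (metis not_less)

lemma qv_in: "t \<in> {0..T} \<Longrightarrow> q t \<in> {0..Q}"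
  using qv_mono[of 0 t] qv_mono[of t T] T by auto

lemma Q_pos: "0 < Q"
  using qv_strict_mono[of 0 T] T by simp

lemma qv_continuous: "continuous_on {0..T} q"
proof -
  have i: "(\<lambda>s. (z s)\<^sup>2) integrable_on {0..T}" by (rule set_borel_integral_eq_integral(1)[OF z_int])
  have "q t = integral {0..t} (\<lambda>s. (z s)\<^sup>2)" if "t \<in> {0..T}" for t
    unfolding qv_def using that
    by (intro set_borel_integral_eq_integral(2) set_integrable_subset[OF z_int]) auto
  moreover have "continuous_on {0..T} (\<lambda>t. integral {0..t} (\<lambda>s. (z s)\<^sup>2))"
    by (rule indefinite_integral_continuous_1[OF i])
  ultimately show ?thesis by (auto intro: continuous_on_eq)
qed

lemma qv_surj:
  assumes "x \<in> {0..Q}" obtains c where "c \<in> {0..T}" "q c = x"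
  using IVT'[of q 0 x T] qv_continuous assms T by auto

lemma qv_measurable [measurable]: "q \<in> borel_measurable L"
proof -
  have "q \<in> borel_measurable (restrict_space borel {0..T})"
    by (rule borel_measurable_continuous_on_restrict[OF qv_continuous])
  then show ?thesis using L.sets_mu by (simp cong: measurable_cong_sets)
qed

abbreviation "\<Lambda> \<equiv> restrict_space lborel {0..Q}"

text \<open>
  A measure on the line is determined by its values on the rays \<open>{x<..}\<close>.
\<close>

lemma measure_preservingI:
  assumes r[measurable]: "r \<in> borel_measurable \<mu>" and rng: "\<And>s. s \<in> {0..T} \<Longrightarrow> r s \<in> {0..Q}"
    and eq: "\<And>x. x \<in> {0..<Q} \<Longrightarrow> measure \<mu> {s\<in>{0..T}. x < r s} = Q - x"
  shows "r \<in> \<mu> \<rightarrow>\<^sub>M \<Lambda>" "distr \<mu> \<Lambda> r = \<Lambda>"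
proof -
  have Lb: "sets \<Lambda> = sets (restrict_space borel {0..Q})" by (rule sets_restrict_space_cong) simp
  have "r \<in> \<mu> \<rightarrow>\<^sub>M restrict_space borel {0..Q}"
    using rng by (intro measurable_restrict_space2) (auto simp: mu.space_mu)
  then show m[measurable]: "r \<in> \<mu> \<rightarrow>\<^sub>M \<Lambda>" using Lb by (simp cong: measurable_cong_sets)
  have top: "measure \<mu> {0..T} = Q" using measure_Icc[of T] T by simp
  have d: "distr \<mu> borel r = density lborel (indicator {0..Q})"
  proof (rule measure_eqI_lessThan)
    fix x :: real
    have *: "emeasure (distr \<mu> borel r) {x<..} = ennreal (measure \<mu> {s\<in>{0..T}. x < r s})"
      by (subst emeasure_distr) (auto simp: mu.emeasure_eq_measure mu.space_mu vimage_def Int_def conj_commute)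
    then show "emeasure (distr \<mu> borel r) {x<..} < \<infinity>" by simp
    have **: "emeasure (density lborel (indicator {0..Q})) {x<..} = emeasure lborel ({0..Q} \<inter> {x<..})"
      by (rule emeasure_density_indicator) auto
    consider "x < 0" | "x \<in> {0..<Q}" | "Q \<le> x" by fastforce
    then show "emeasure (distr \<mu> borel r) {x<..} = emeasure (density lborel (indicator {0..Q})) {x<..}"
    proof cases
      case 1
      have e: "{s\<in>{0..T}. x < r s} = {0..T}" "{0..Q} \<inter> {x<..} = {0..Q}" using 1 rng by force+
      show ?thesis unfolding * ** e top using Q_pos by (simp add: emeasure_lborel_Icc_eq)
    next
      case 2
      have e: "{0..Q} \<inter> {x<..} = {x<..Q}" using 2 by auto
      show ?thesis unfolding * ** e eq[OF 2] using 2 by simp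
    next
      case 3
      have e: "{s\<in>{0..T}. x < r s} = {}" "{0..Q} \<inter> {x<..} = {}" using 3 rng by force+
      show ?thesis unfolding * ** e by simp
    qed
  qed simp_all
  show "distr \<mu> \<Lambda> r = \<Lambda>"
  proof (rule measure_eqI)
    fix A assume "A \<in> sets (distr \<mu> \<Lambda> r)"
    then have A: "A \<in> sets \<Lambda>" "A \<subseteq> {0..Q}" "A \<in> sets borel" by (auto simp: Lb sets_restrict_space_iff)
    have "emeasure (distr \<mu> \<Lambda> r) A = emeasure (distr \<mu> borel r) A"
      unfolding emeasure_distr[OF m A(1)] emeasure_distr[OF r A(3)] ..
    also have "\<dots> = emeasure lborel A"
      unfolding d emeasure_density_indicator[OF atLeastAtMost_borel A(3)] Int_absorb1[OF A(2)] ..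
    also have "\<dots> = emeasure \<Lambda> A" using A by (subst emeasure_restrict_space) auto
    finally show "emeasure (distr \<mu> \<Lambda> r) A = emeasure \<Lambda> A" .
  qed simp
qed

lemma qv_measurable_mu [measurable]: "q \<in> borel_measurable \<mu>"
  using qv_measurable by (simp cong: measurable_cong_sets add: sets_qv_measure)

lemma qv_measure_preserving: "q \<in> \<mu> \<rightarrow>\<^sub>M \<Lambda>" "distr \<mu> \<Lambda> q = \<Lambda>"
proof -
  have "measure \<mu> {s\<in>{0..T}. x < q s} = Q - x" if x: "x \<in> {0..<Q}" for x
  proof -
    obtain c where c: "c \<in> {0..T}" "q c = x" using qv_surj[of x] x by auto
    have "{s\<in>{0..T}. x < q s} = {c<..T}" using c qv_less_iff[of c] by auto
    then show ?thesis using measure_Ioc[of c T] c by simp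
  qed
  note P = measure_preservingI[OF qv_measurable_mu qv_in this]
  show "q \<in> \<mu> \<rightarrow>\<^sub>M \<Lambda>" by (rule P(1))
  show "distr \<mu> \<Lambda> q = \<Lambda>" by (rule P(2))
qed

lemma measure_Ico:
  assumes "c \<in> {0..T}" shows "measure \<mu> {0..<c} = q c"
proof -
  have "measure \<mu> {0..<c} = measure \<mu> {0..c}"
  proof (rule mu.finite_measure_eq_AE)
    show "AE s in \<mu>. s \<in> {0..<c} \<longleftrightarrow> s \<in> {0..c}" using AE_neq[of c] by eventually_elim auto
    show "{0..<c} \<in> sets \<mu>" "{0..c} \<in> sets \<mu>" using assms by (auto simp: mu.sets_mu_iff)
  qed
  then show ?thesis using assms by (simp add: measure_Icc)
qed

text \<open>
  In reversed clock time the operators of index 2 take the form of those of index 1, while the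
  indicator of \<open>[0, t)\<close> becomes \<open>1\<close> minus that of \<open>[0, Q - q t)\<close>, up to an end point.
\<close>

lemma reverse_qv_measure_preserving: "(\<lambda>s. Q - q s) \<in> \<mu> \<rightarrow>\<^sub>M \<Lambda>" "distr \<mu> \<Lambda> (\<lambda>s. Q - q s) = \<Lambda>"
proof -
  have m: "measure \<mu> {s\<in>{0..T}. x < Q - q s} = Q - x" if x: "x \<in> {0..<Q}" for x
  proof -
    obtain c where c: "c \<in> {0..T}" "q c = Q - x" using qv_surj[of "Q - x"] x by auto
    have "{s\<in>{0..T}. x < Q - q s} = {0..<c}" 
    proof -
      have "x < Q - q s \<longleftrightarrow> s < c" if "s \<in> {0..T}" for s
        using qv_less_iff[OF that c(1)] c(2) by auto
      then show ?thesis using c by auto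
    qed
    then show ?thesis using measure_Ico[of c] c by simp
  qed
  have r: "Q - q s \<in> {0..Q}" if "s \<in> {0..T}" for s using qv_in[OF that] by auto
  have "(\<lambda>s. Q - q s) \<in> borel_measurable \<mu>" by measurable
  note P = measure_preservingI[OF this r m]
  show "(\<lambda>s. Q - q s) \<in> \<mu> \<rightarrow>\<^sub>M \<Lambda>" by (rule P(1))
  show "distr \<mu> \<Lambda> (\<lambda>s. Q - q s) = \<Lambda>" by (rule P(2))
qed

lemma has_bochner_integral_preserving:
  fixes f :: "real \<Rightarrow> real"
  assumes r: "r \<in> \<mu> \<rightarrow>\<^sub>M \<Lambda>" "distr \<mu> \<Lambda> r = \<Lambda>" and f: "has_bochner_integral \<Lambda> f v"
  shows "has_bochner_integral \<mu> (\<lambda>s. f (r s)) v"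
proof -
  have "has_bochner_integral (distr \<mu> \<Lambda> r) f v" unfolding r(2) by (rule f)
  then have f': "integrable (distr \<mu> \<Lambda> r) f" "(\<integral>x. f x \<partial>distr \<mu> \<Lambda> r) = v"
    unfolding has_bochner_integral_iff by blast+
  have "f \<in> borel_measurable \<Lambda>" using f unfolding has_bochner_integral_iff by blast
  then have "(\<integral>s. f (r s) \<partial>\<mu>) = v" unfolding f'(2)[symmetric] by (rule integral_distr[OF r(1), symmetric])
  then show ?thesis using integrable_distr[OF r(1) f'(1)] unfolding has_bochner_integral_iff by blast
qed

end

section \<open>The operators in clock time\<close>

context deterministic_volatility
begin

lemma sets_mu_Ico: "s \<in> {0..T} \<Longrightarrow> t \<in> {0..T} \<Longrightarrow> {s..<t} \<in> sets \<mu>"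
  by (auto simp: mu.sets_mu_iff)

lemma measure_Ico_between:
  assumes "s \<in> {0..T}" "t \<in> {0..T}" "s \<le> t" shows "measure \<mu> {s..<t} = q t - q s"
proof -
  have e: "{s..<t} = {0..<t} - {0..<s}" using assms by auto
  have "measure \<mu> {s..<t} = measure \<mu> {0..<t} - measure \<mu> {0..<s}"
    unfolding e using assms T by (intro mu.finite_measure_Diff sets_mu_Ico) auto
  then show ?thesis using assms by (simp add: measure_Ico)
qed

lemma qv_min: "s \<in> {0..T} \<Longrightarrow> t \<in> {0..T} \<Longrightarrow> q (min s t) = min (q s) (q t)"
  using qv_le_iff[of s t] by (simp add: min_def)

lemma indicator_borel_mu [measurable]: "(indicator {0..<t} :: real \<Rightarrow> real) \<in> borel_measurable \<mu>"
  by (rule mu.borel_measurable_mu) simp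

lemma set_integral_indicator:
  assumes "A \<inter> {0..<t} \<in> sets \<mu>"
  shows "(LINT u:A|\<mu>. (indicator {0..<t} u :: real)) = measure \<mu> (A \<inter> {0..<t})"
proof -
  have "(LINT u:A|\<mu>. (indicator {0..<t} u :: real)) = (\<integral>u. indicator (A \<inter> {0..<t}) u \<partial>\<mu>)"
    unfolding set_lebesgue_integral_def by (simp add: indicator_inter_arith)
  then show ?thesis using assms by simp
qed

lemma alpha_1_eq:
  assumes "s \<in> {0..T}" "t \<in> {0..T}"
  shows "alpha T z 1 (indicator {0..<t}) s = indicator {0..<t} s - 1 / q s * min (q s) (q t)"
proof -
  have "measure \<mu> ({0..s} \<inter> {0..<t}) = min (q s) (q t)"
  proof (cases "s < t")
    case True
    then have "{0..s} \<inter> {0..<t} = {0..s}" by auto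
    then show ?thesis using True assms qv_less_iff[OF assms] by (simp add: measure_Icc)
  next
    case False
    then have "{0..s} \<inter> {0..<t} = {0..<t}" by auto
    then show ?thesis using False assms qv_less_iff[OF assms] by (simp add: measure_Ico)
  qed
  moreover have "{0..s} \<inter> {0..<t} \<in> sets \<mu>" using assms by (auto simp: mu.sets_mu_iff)
  ultimately show ?thesis by (simp add: alpha_def set_integral_indicator)
qed

lemma alpha_2_eq:
  assumes "s \<in> {0..T}" "t \<in> {0..T}"
  shows "alpha T z 2 (indicator {0..<t}) s = indicator {0..<t} s - 1 / (Q - q s) * max 0 (q t - q s)"
proof -
  have "{s..T} \<inter> {0..<t} = {s..<t}" using assms by auto
  moreover have "measure \<mu> {s..<t} = max 0 (q t - q s)"
    using assms measure_Ico_between[OF assms] qv_less_iff[OF assms(2,1)] qv_le_iff[OF assms] by (cases "s \<le> t") auto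
  moreover have "{s..<t} \<in> sets \<mu>" using assms by (rule sets_mu_Ico)
  ultimately show ?thesis by (simp add: alpha_def set_integral_indicator)
qed

lemma AE_mu_off_points: "(\<And>s. s \<in> {0..T} \<Longrightarrow> s \<noteq> 0 \<Longrightarrow> s \<noteq> T \<Longrightarrow> s \<noteq> t \<Longrightarrow> R s) \<Longrightarrow> AE s in \<mu>. R s"
  using AE_neq[of 0] AE_neq[of T] AE_neq[of t] AE_space
  by eventually_elim (simp only: mu.space_mu)

text \<open>
  The values of \<open>alpha\<close> and the kernels differ at most at \<open>s = t\<close> and at the end points, where a
  denominator vanishes.  For index 2 only one kernel is left because the operator annihilates
  constants.
\<close>

lemma alpha_kernel:
  assumes t: "t \<in> {0..T}"
  shows "AE s in \<mu>. alpha T z 1 (indicator {0..<t}) s = kernel_A (q t) (q s)"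
    and "AE s in \<mu>. alpha T z 2 (indicator {0..<t}) s = - kernel_A (Q - q t) (Q - q s)"
proof -
  have TT: "0 \<in> {0..T}" "T \<in> {0..T}" using T by auto
  show "AE s in \<mu>. alpha T z 1 (indicator {0..<t}) s = kernel_A (q t) (q s)"
  proof (rule AE_mu_off_points)
    fix s assume s: "s \<in> {0..T}" "s \<noteq> 0" "s \<noteq> T" "s \<noteq> t"
    then have "0 < q s" using qv_less_iff[OF TT(1) s(1)] by auto
    then show "alpha T z 1 (indicator {0..<t}) s = kernel_A (q t) (q s)"
      unfolding alpha_1_eq[OF s(1) t]
      using s qv_less_iff[OF s(1) t] qv_less_iff[OF t s(1)]
      by (cases "s < t") (auto simp: kernel_A_def min_def)
  qed
  show "AE s in \<mu>. alpha T z 2 (indicator {0..<t}) s = - kernel_A (Q - q t) (Q - q s)"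
  proof (rule AE_mu_off_points)
    fix s assume s: "s \<in> {0..T}" "s \<noteq> 0" "s \<noteq> T" "s \<noteq> t"
    then have "q s < Q" using qv_less_iff[OF s(1) TT(2)] by auto
    then show "alpha T z 2 (indicator {0..<t}) s = - kernel_A (Q - q t) (Q - q s)"
      unfolding alpha_2_eq[OF s(1) t]
      using s qv_less_iff[OF s(1) t] qv_less_iff[OF t s(1)]
      by (cases "s < t") (auto simp: kernel_A_def max_def field_simps)
  qed
qed

text \<open>
  In clock time this is \<open>\<integral> dx / x\<close> from \<open>q s\<close> to \<open>q t\<close>.
\<close>

lemma integral_inverse_qv:
  assumes s: "s \<in> {0..T}" "0 < s" and t: "t \<in> {0..T}"
  shows "(LINT u:{s..T}|\<mu>. indicator {0..<t} u / q u) = (if s < t then ln (q t / q s) else 0)"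
proof (cases "s < t")
  case False
  then have "(\<lambda>u. indicator {s..T} u *\<^sub>R (indicator {0..<t} u / q u)) = (\<lambda>u. 0)"
    by (auto simp: indicator_def fun_eq_iff)
  then show ?thesis using False unfolding set_lebesgue_integral_def by simp
next
  case True
  have "0 \<in> {0..T}" using T by simp
  then have qs: "0 < q s" using qv_less_iff[of 0 s] s by simp
  have lt: "q s < q t" using True s t qv_less_iff by blast
  define g where "g x = indicator {q s..<q t} x / x" for x :: real
  have "has_bochner_integral lborel (\<lambda>x. (1 / x) * indicator {q s..q t} x) (ln (q t) - ln (q s))"
  proof (rule has_bochner_integral_FTC_Icc_real)
    fix x assume "q s \<le> x"
    then have "0 < x" using qs by simp
    then show "(ln has_real_derivative 1 / x) (at x)" by (auto intro!: derivative_eq_intros)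
    show "isCont (\<lambda>x. 1 / x) x" using \<open>0 < x\<close> by (intro continuous_intros) auto
  qed (use lt in simp)
  then have "has_bochner_integral \<Lambda> g (ln (q t) - ln (q s))"
  proof (rule has_bochner_integral_restrict_lborel)
    show "g \<in> borel_measurable borel" unfolding g_def by measurable
    have "AE x in lborel. x \<noteq> q t" by (rule AE_lborel_singleton)
    then show "AE x in lborel. 1 / x * indicator {q s..q t} x = indicator {0..Q} x * g x"
      by eventually_elim (use qs qv_in[OF t] in \<open>auto simp: g_def indicator_def\<close>)
  qed
  from has_bochner_integral_preserving[OF qv_measure_preserving this]
  have "(\<integral>u. g (q u) \<partial>\<mu>) = ln (q t) - ln (q s)" by (simp add: has_bochner_integral_iff)
  also have "\<dots> = ln (q t / q s)" using qs lt by (simp add: ln_div)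
  also have "(\<integral>u. g (q u) \<partial>\<mu>) = (LINT u:{s..T}|\<mu>. indicator {0..<t} u / q u)"
    unfolding set_lebesgue_integral_def
  proof (rule Bochner_Integration.integral_cong[OF refl])
    fix u assume "u \<in> space \<mu>"
    then have u: "u \<in> {0..T}" by (simp add: mu.space_mu)
    then show "g (q u) = indicator {s..T} u *\<^sub>R (indicator {0..<t} u / q u)"
      using qv_le_iff[OF s(1) u] qv_less_iff[OF u t] by (auto simp: g_def indicator_def)
  qed
  finally show ?thesis using True by simp
qed

text \<open>
  In clock time this is \<open>\<integral> dx / (Q - x)\<close> from \<open>0\<close> to \<open>min (q s) (q t)\<close>.
\<close>

lemma integral_inverse_reverse_qv:
  assumes s: "s \<in> {0..T}" "s < T" and t: "t \<in> {0..T}"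
  shows "(LINT u:{0..s}|\<mu>. indicator {0..<t} u / (Q - q u)) = ln (Q / (Q - min (q s) (q t)))"
proof -
  define m where "m = min (q s) (q t)"
  have "T \<in> {0..T}" using T by simp
  then have m: "0 \<le> m" "m < Q" using qv_less_iff[of s T] s qv_in[OF s(1)] qv_in[OF t] by (auto simp: m_def)
  define g where "g x = indicator {0..q s} x * indicator {0..<q t} x / (Q - x)" for x :: real
  have "has_bochner_integral lborel (\<lambda>x. (1 / (Q - x)) * indicator {0..m} x) ((- ln (Q - m)) - (- ln (Q - 0)))"
  proof (rule has_bochner_integral_FTC_Icc_real[OF m(1)])
    fix x assume "x \<le> m"
    then have "0 < Q - x" using m by simp
    then show "((\<lambda>x. - ln (Q - x)) has_real_derivative 1 / (Q - x)) (at x)" by (auto intro!: derivative_eq_intros)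
    show "isCont (\<lambda>x. 1 / (Q - x)) x" using \<open>0 < Q - x\<close> by (intro continuous_intros) auto
  qed
  then have "has_bochner_integral \<Lambda> g ((- ln (Q - m)) - (- ln (Q - 0)))"
  proof (rule has_bochner_integral_restrict_lborel)
    show "g \<in> borel_measurable borel" unfolding g_def by measurable
    have "AE x in lborel. x \<noteq> q t" by (rule AE_lborel_singleton)
    then show "AE x in lborel. 1 / (Q - x) * indicator {0..m} x = indicator {0..Q} x * g x"
      by eventually_elim (use m qv_in[OF t] in \<open>auto simp: g_def indicator_def m_def\<close>)
  qed
  from has_bochner_integral_preserving[OF qv_measure_preserving this]
  have "(\<integral>u. g (q u) \<partial>\<mu>) = ln Q - ln (Q - m)" by (simp add: has_bochner_integral_iff)
  also have "\<dots> = ln (Q / (Q - m))" using m Q_pos by (simp add: ln_div)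
  also have "(\<integral>u. g (q u) \<partial>\<mu>) = (LINT u:{0..s}|\<mu>. indicator {0..<t} u / (Q - q u))"
    unfolding set_lebesgue_integral_def
  proof (rule Bochner_Integration.integral_cong[OF refl])
    fix u assume "u \<in> space \<mu>"
    then have u: "u \<in> {0..T}" by (simp add: mu.space_mu)
    then show "g (q u) = indicator {0..s} u *\<^sub>R (indicator {0..<t} u / (Q - q u))"
      using qv_le_iff[OF u s(1)] qv_less_iff[OF u t] qv_in[OF u] by (auto simp: g_def indicator_def)
  qed
  finally show ?thesis by (simp add: m_def)
qed

lemma beta_1_eq:
  assumes "s \<in> {0..T}" "s \<noteq> 0" "t \<in> {0..T}"
  shows "beta T z 1 (indicator {0..<t}) s = indicator {0..<t} s - (if q s < q t then ln (q t / q s) else 0)"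
  using assms integral_inverse_qv[of s t] qv_less_iff[of s t] by (simp add: beta_def)

lemma beta_2_eq:
  assumes "s \<in> {0..T}" "s \<noteq> T" "t \<in> {0..T}"
  shows "beta T z 2 (indicator {0..<t}) s = indicator {0..<t} s - ln (Q / (Q - min (q s) (q t)))"
  using assms integral_inverse_reverse_qv[of s t] by (simp add: beta_def)

text \<open>
  For index 2 both terms of \<open>1\<^bsub>[0,Q)\<^esub> - 1\<^bsub>[0,Q - q t)\<^esub>\<close>, the reversed indicator, contribute a kernel,
  since the operator does not annihilate constants.
\<close>

lemma beta_kernel:
  assumes t: "t \<in> {0..T}"
  shows "AE s in \<mu>. beta T z 1 (indicator {0..<t}) s = kernel_B (q t) (q s)"
    and "AE s in \<mu>. beta T z 2 (indicator {0..<t}) s = kernel_B Q (Q - q s) - kernel_B (Q - q t) (Q - q s)"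
proof -
  have TT: "0 \<in> {0..T}" "T \<in> {0..T}" using T by auto
  show "AE s in \<mu>. beta T z 1 (indicator {0..<t}) s = kernel_B (q t) (q s)"
  proof (rule AE_mu_off_points)
    fix s assume s: "s \<in> {0..T}" "s \<noteq> 0" "s \<noteq> T" "s \<noteq> t"
    then have "0 < q s" using qv_less_iff[OF TT(1) s(1)] by auto
    then show "beta T z 1 (indicator {0..<t}) s = kernel_B (q t) (q s)"
      unfolding beta_1_eq[OF s(1,2) t]
      using s qv_less_iff[OF s(1) t] qv_less_iff[OF t s(1)]
      by (cases "s < t") (auto simp: kernel_B_def ln_div)
  qed
  show "AE s in \<mu>. beta T z 2 (indicator {0..<t}) s = kernel_B Q (Q - q s) - kernel_B (Q - q t) (Q - q s)"
  proof (rule AE_mu_off_points)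
    fix s assume s: "s \<in> {0..T}" "s \<noteq> 0" "s \<noteq> T" "s \<noteq> t"
    then have "0 < q s" "q s < Q" using qv_less_iff[OF TT(1) s(1)] qv_less_iff[OF s(1) TT(2)] by auto
    then show "beta T z 2 (indicator {0..<t}) s = kernel_B Q (Q - q s) - kernel_B (Q - q t) (Q - q s)"
      unfolding beta_2_eq[OF s(1,3) t]
      using s qv_less_iff[OF s(1) t] qv_less_iff[OF t s(1)] Q_pos
      by (cases "s < t") (auto simp: kernel_B_def ln_div min_def)
  qed
qed

text \<open>
  At one end point the integral that defines \<open>beta\<close> has no closed form, because a denominator vanishes
  there; a single point does not affect measurability.
\<close>

lemma borel_measurable_mu_off_point:
  assumes g: "g \<in> borel_measurable \<mu>" and eq: "\<And>s. s \<in> {0..T} \<Longrightarrow> s \<noteq> c \<Longrightarrow> f s = g s" and c: "c \<in> {0..T}"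
  shows "f \<in> borel_measurable \<mu>"
  by (rule measurable_discrete_difference[OF g, of "{c}"]) (use eq c in \<open>auto simp: mu.sets_mu_iff mu.space_mu\<close>)

lemma transforms_measurable:
  assumes i: "i \<in> {1, 2}" and t: "t \<in> {0..T}"
  shows "alpha T z i (indicator {0..<t}) \<in> borel_measurable \<mu>"
    "beta T z i (indicator {0..<t}) \<in> borel_measurable \<mu>"
proof -
  have TT: "0 \<in> {0..T}" "T \<in> {0..T}" using T by auto
  have "alpha T z 1 (indicator {0..<t}) \<in> borel_measurable \<mu>"
    by (rule borel_measurable_mu_off_point[OF _ alpha_1_eq[OF _ t] TT(1)]) measurable
  moreover have "alpha T z 2 (indicator {0..<t}) \<in> borel_measurable \<mu>"
    by (rule borel_measurable_mu_off_point[OF _ alpha_2_eq[OF _ t] TT(1)]) measurable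
  ultimately show "alpha T z i (indicator {0..<t}) \<in> borel_measurable \<mu>" using i by auto
  have "beta T z 1 (indicator {0..<t}) \<in> borel_measurable \<mu>"
    by (rule borel_measurable_mu_off_point[OF _ beta_1_eq[OF _ _ t] TT(1)]) measurable
  moreover have "beta T z 2 (indicator {0..<t}) \<in> borel_measurable \<mu>"
    by (rule borel_measurable_mu_off_point[OF _ beta_2_eq[OF _ _ t] TT(2)]) measurable
  ultimately show "beta T z i (indicator {0..<t}) \<in> borel_measurable \<mu>" using i by auto
qed

lemma has_bochner_integral_kernel_product:
  assumes r: "r \<in> \<mu> \<rightarrow>\<^sub>M \<Lambda>" "distr \<mu> \<Lambda> r = \<Lambda>"
    and k: "has_bochner_integral \<Lambda> (\<lambda>x. k x * l x) v"
    and f: "f \<in> borel_measurable \<mu>" "AE s in \<mu>. f s = k (r s)"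
    and g: "g \<in> borel_measurable \<mu>" "AE s in \<mu>. g s = l (r s)"
  shows "has_bochner_integral \<mu> (\<lambda>s. f s * g s) (v :: real)"
proof (rule has_bochner_integralI_AE[OF has_bochner_integral_preserving[OF r k]])
  show "(\<lambda>s. f s * g s) \<in> borel_measurable \<mu>" using f g by measurable
  show "AE s in \<mu>. k (r s) * l (r s) = f s * g s" using f(2) g(2) by eventually_elim simp
qed

lemma alpha_inner:
  assumes i: "i \<in> {1, 2}" and s: "s \<in> {0..T}" and t: "t \<in> {0..T}"
  shows "has_bochner_integral \<mu> (\<lambda>u. alpha T z i (indicator {0..<s}) u * alpha T z i (indicator {0..<t}) u)
    (q (min s t) - q s * q t / Q)"
proof -
  note m = transforms_measurable(1)
  consider "i = 1" | "i = 2" using i by auto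
  then show ?thesis
  proof cases
    case 1
    show ?thesis unfolding 1 qv_min[OF s t]
      by (rule has_bochner_integral_kernel_product[OF qv_measure_preserving
            kernel_A_inner[OF Q_pos qv_in[OF s] qv_in[OF t]] m alpha_kernel(1)[OF s] m alpha_kernel(1)[OF t]])
        (use s t in auto)
  next
    case 2
    have "Q - q s \<in> {0..Q}" "Q - q t \<in> {0..Q}" using qv_in[OF s] qv_in[OF t] by auto
    from kernel_A_inner[OF Q_pos this]
    have k: "has_bochner_integral \<Lambda> (\<lambda>x. (- kernel_A (Q - q s) x) * (- kernel_A (Q - q t) x))
        (min (Q - q s) (Q - q t) - (Q - q s) * (Q - q t) / Q)" by simp
    have "min (Q - q s) (Q - q t) - (Q - q s) * (Q - q t) / Q = min (q s) (q t) - q s * q t / Q"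
      using Q_pos by (auto simp: min_def field_simps)
    then show ?thesis unfolding 2 qv_min[OF s t]
      using has_bochner_integral_kernel_product[OF reverse_qv_measure_preserving k
            m alpha_kernel(2)[OF s] m alpha_kernel(2)[OF t]] s t by auto
  qed
qed

lemma beta_inner:
  assumes i: "i \<in> {1, 2}" and s: "s \<in> {0..T}" and t: "t \<in> {0..T}"
  shows "has_bochner_integral \<mu> (\<lambda>u. beta T z i (indicator {0..<s}) u * beta T z i (indicator {0..<t}) u)
    (q (min s t))"
proof -
  note m = transforms_measurable(2)
  consider "i = 1" | "i = 2" using i by auto
  then show ?thesis
  proof cases
    case 1
    show ?thesis unfolding 1 qv_min[OF s t]
      by (rule has_bochner_integral_kernel_product[OF qv_measure_preserving
            kernel_B_inner[OF qv_in[OF s] qv_in[OF t]] m beta_kernel(1)[OF s] m beta_kernel(1)[OF t]])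
        (use s t in auto)
  next
    case 2
    have r: "Q \<in> {0..Q}" "Q - q s \<in> {0..Q}" "Q - q t \<in> {0..Q}" using qv_in[OF s] qv_in[OF t] by auto
    have "has_bochner_integral \<Lambda> (\<lambda>x. kernel_B Q x * kernel_B Q x - kernel_B Q x * kernel_B (Q - q t) x
        - (kernel_B (Q - q s) x * kernel_B Q x - kernel_B (Q - q s) x * kernel_B (Q - q t) x))
        (min Q Q - min Q (Q - q t) - (min (Q - q s) Q - min (Q - q s) (Q - q t)))"
      by (intro has_bochner_integral_diff kernel_B_inner r)
    moreover have "min Q Q - min Q (Q - q t) - (min (Q - q s) Q - min (Q - q s) (Q - q t)) = min (q s) (q t)"
      using r by (auto simp: min_def)
    moreover have "kernel_B Q x * kernel_B Q x - kernel_B Q x * kernel_B (Q - q t) x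
        - (kernel_B (Q - q s) x * kernel_B Q x - kernel_B (Q - q s) x * kernel_B (Q - q t) x)
        = (kernel_B Q x - kernel_B (Q - q s) x) * (kernel_B Q x - kernel_B (Q - q t) x)" for x
      by (simp add: algebra_simps)
    ultimately have k: "has_bochner_integral \<Lambda> (\<lambda>x. (kernel_B Q x - kernel_B (Q - q s) x) * (kernel_B Q x - kernel_B (Q - q t) x))
        (min (q s) (q t))" by (simp only:)
    show ?thesis unfolding 2 qv_min[OF s t]
      by (rule has_bochner_integral_kernel_product[OF reverse_qv_measure_preserving k
            m beta_kernel(2)[OF s] m beta_kernel(2)[OF t]]) (use s t in auto)
  qed
qed

end

section \<open>Continuous modifications\<close>

lemma path_measurable:
  assumes "\<And>t. t \<in> {0..T} \<Longrightarrow> X t \<in> borel_measurable P"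
  shows "path T X \<in> P \<rightarrow>\<^sub>M Pi\<^sub>M {0..T} (\<lambda>_. borel)"
  unfolding path_def using assms by (intro measurable_restrict)

lemma uniformly_continuous_on_real_iff:
  fixes x :: "real \<Rightarrow> real"
  shows "uniformly_continuous_on E x \<longleftrightarrow>
    (\<forall>n. \<exists>m. \<forall>s\<in>E. \<forall>t\<in>E. \<bar>s - t\<bar> < 1 / real (Suc m) \<longrightarrow> \<bar>x s - x t\<bar> < 1 / real (Suc n))"
proof
  assume u: "uniformly_continuous_on E x"
  show "\<forall>n. \<exists>m. \<forall>s\<in>E. \<forall>t\<in>E. \<bar>s - t\<bar> < 1 / real (Suc m) \<longrightarrow> \<bar>x s - x t\<bar> < 1 / real (Suc n)"
  proof
    fix n
    have "0 < 1 / real (Suc n)" by simp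
    then obtain d where d: "0 < d" "\<And>s t. s \<in> E \<Longrightarrow> t \<in> E \<Longrightarrow> dist t s < d \<Longrightarrow> dist (x t) (x s) < 1 / real (Suc n)"
      using u unfolding uniformly_continuous_on_def by metis
    obtain m where "1 / real (Suc m) < d" using nat_approx_posE[OF d(1)] by blast
    then show "\<exists>m. \<forall>s\<in>E. \<forall>t\<in>E. \<bar>s - t\<bar> < 1 / real (Suc m) \<longrightarrow> \<bar>x s - x t\<bar> < 1 / real (Suc n)"
      using d(2) unfolding dist_real_def by (intro exI[of _ m]) force
  qed
next
  assume h: "\<forall>n. \<exists>m. \<forall>s\<in>E. \<forall>t\<in>E. \<bar>s - t\<bar> < 1 / real (Suc m) \<longrightarrow> \<bar>x s - x t\<bar> < 1 / real (Suc n)"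
  show "uniformly_continuous_on E x"
    unfolding uniformly_continuous_on_def
  proof (intro allI impI)
    fix e :: real assume "0 < e"
    then obtain n where n: "1 / real (Suc n) < e" using nat_approx_posE by blast
    from h obtain m where m: "\<forall>s\<in>E. \<forall>t\<in>E. \<bar>s - t\<bar> < 1 / real (Suc m) \<longrightarrow> \<bar>x s - x t\<bar> < 1 / real (Suc n)" by blast
    show "\<exists>d>0. \<forall>s\<in>E. \<forall>t\<in>E. dist t s < d \<longrightarrow> dist (x t) (x s) < e"
      using m n unfolding dist_real_def by (intro exI[of _ "1 / real (Suc m)"]) force
  qed
qed

lemma uniformly_continuous_on_real_subset:
  fixes x :: "real \<Rightarrow> real"
  assumes "uniformly_continuous_on E x" "D \<subseteq> E"
  shows "uniformly_continuous_on D x"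
  using assms unfolding uniformly_continuous_on_real_iff by (meson subsetD)

lemma uniformly_continuous_on_path:
  assumes "E \<subseteq> {0..T}"
  shows "uniformly_continuous_on E (path T X \<omega>) \<longleftrightarrow> uniformly_continuous_on E (\<lambda>t. X t \<omega>)"
proof -
  have p: "path T X \<omega> t = X t \<omega>" if "t \<in> E" for t using assms that by (auto simp: path_def)
  show ?thesis unfolding uniformly_continuous_on_def by (simp add: p cong: ball_cong_simp)
qed

lemma uniformly_continuous_on_sets:
  fixes X :: "real \<Rightarrow> 'a \<Rightarrow> real"
  assumes "countable E" and X: "\<And>t. t \<in> E \<Longrightarrow> X t \<in> borel_measurable N"
  shows "{\<omega>\<in>space N. uniformly_continuous_on E (\<lambda>t. X t \<omega>)} \<in> sets N"
proof -
  have c: "{\<omega>\<in>space N. \<bar>s - t\<bar> < a \<longrightarrow> \<bar>X s \<omega> - X t \<omega>\<bar> < b} \<in> sets N" if "s \<in> E" "t \<in> E" for s t a b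
    using X[OF that(1), measurable] X[OF that(2), measurable] by measurable
  show ?thesis
    unfolding uniformly_continuous_on_real_iff
    by (intro sets.sets_Collect_countable_All sets.sets_Collect_countable_Ex
        sets.sets_Collect_countable_All'[OF _ assms(1)] c)
qed

text \<open>
  Uniform continuity on a countable set is an event in the product \<open>\<sigma>\<close>-algebra, so its probability
  depends on the law only; for the continuous process it is \<open>1\<close> by compactness.
\<close>

lemma AE_uniformly_continuous_of_law:
  assumes X: "\<And>t. t \<in> {0..T} \<Longrightarrow> X t \<in> borel_measurable P"
    and Y: "\<And>t. t \<in> {0..T} \<Longrightarrow> Y t \<in> borel_measurable P'"
    and law: "law P T X = law P' T Y"
    and cont: "\<And>\<omega>. \<omega> \<in> space P' \<Longrightarrow> continuous_on {0..T} (\<lambda>t. Y t \<omega>)"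
    and E: "countable E" "E \<subseteq> {0..T}"
  shows "AE \<omega> in P. uniformly_continuous_on E (\<lambda>t. X t \<omega>)"
proof -
  let ?N = "Pi\<^sub>M {0..T} (\<lambda>_. borel :: real measure)"
  have S: "{x\<in>space ?N. uniformly_continuous_on E x} \<in> sets ?N"
    using E by (intro uniformly_continuous_on_sets[of E "\<lambda>t x. x t"]) auto
  have "AE x in law P' T Y. uniformly_continuous_on E x"
    unfolding law_def
  proof (subst AE_distr_iff[OF path_measurable S])
    show "AE \<omega> in P'. uniformly_continuous_on E (path T Y \<omega>)"
    proof (rule AE_I2)
      fix \<omega> assume "\<omega> \<in> space P'"
      then have "uniformly_continuous_on {0..T} (\<lambda>t. Y t \<omega>)"
        using cont by (intro compact_uniformly_continuous) auto
      then have "uniformly_continuous_on E (\<lambda>t. Y t \<omega>)" using E(2) by (rule uniformly_continuous_on_real_subset)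
      then show "uniformly_continuous_on E (path T Y \<omega>)"
        by (simp only: uniformly_continuous_on_path[OF E(2)])
    qed
  qed (use Y in auto)
  then have "AE x in law P T X. uniformly_continuous_on E x" by (simp only: law)
  then have "AE \<omega> in P. uniformly_continuous_on E (path T X \<omega>)"
    unfolding law_def by (subst (asm) AE_distr_iff[OF path_measurable S]) (use X in auto)
  then show ?thesis by (simp only: uniformly_continuous_on_path[OF E(2)])
qed

text \<open>
  The modification extends the process from the rational times by continuity.  It agrees with \<open>X t\<close>
  almost surely because \<open>X\<close> is also almost surely uniformly continuous on the rationals together
  with \<open>t\<close>.
\<close>

lemma continuous_modification_of_law:
  assumes T: "0 < T" and X: "\<And>t. t \<in> {0..T} \<Longrightarrow> X t \<in> borel_measurable P"
    and Y: "\<And>t. t \<in> {0..T} \<Longrightarrow> Y t \<in> borel_measurable P'"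
    and law: "law P T X = law P' T Y"
    and cont: "\<And>\<omega>. \<omega> \<in> space P' \<Longrightarrow> continuous_on {0..T} (\<lambda>t. Y t \<omega>)"
  shows "\<exists>Z. continuous_modification P T X Z"
proof -
  note uc = AE_uniformly_continuous_of_law[OF X Y law cont]
  define D where "D = {0..T} \<inter> \<rat>"
  have D: "countable D" "D \<subseteq> {0..T}" using countable_rat by (auto simp: D_def)
  have clD: "closure D = {0..T}"
  proof
    show "closure D \<subseteq> {0..T}" using D(2) by (intro closure_minimal) auto
    have "{0<..<T} \<subseteq> closure ({0<..<T} \<inter> \<rat>)"
      using open_Int_closure_subset[of "{0<..<T}" \<rat>] by (simp add: Rats_closure_real)
    also have "\<dots> \<subseteq> closure D" by (intro closure_mono) (auto simp: D_def)
    finally have "closure {0<..<T} \<subseteq> closure D" by (rule closure_minimal) simp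
    then show "{0..T} \<subseteq> closure D" using T by simp
  qed
  have "\<exists>d. (\<forall>n. d n \<in> D) \<and> d \<longlonglongrightarrow> t" if "t \<in> {0..T}" for t
    using that unfolding clD[symmetric] closure_sequential by blast
  then obtain d where d: "\<And>t n. t \<in> {0..T} \<Longrightarrow> d t n \<in> D" "\<And>t. t \<in> {0..T} \<Longrightarrow> d t \<longlonglongrightarrow> t"
    by metis
  define G where "G = {\<omega>\<in>space P. uniformly_continuous_on D (\<lambda>t. X t \<omega>)}"
  have G: "G \<in> sets P"
    unfolding G_def using D X by (intro uniformly_continuous_on_sets) auto
  define Z where "Z t \<omega> = (if \<omega> \<in> G then lim (\<lambda>n. X (d t n) \<omega>) else 0)" for t \<omega>
  have "continuous_modification P T X Z"
    unfolding continuous_modification_def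
  proof (intro conjI ballI)
    fix t assume t: "t \<in> {0..T}"
    have [measurable]: "X (d t n) \<in> borel_measurable P" for n using d(1)[OF t] D(2) X by blast
    note G[measurable]
    show "Z t \<in> borel_measurable P" unfolding Z_def[abs_def] by measurable
    have "AE \<omega> in P. uniformly_continuous_on (insert t D) (\<lambda>t. X t \<omega>)"
      by (rule uc) (use D t in auto)
    with AE_space show "AE \<omega> in P. Z t \<omega> = X t \<omega>"
    proof eventually_elim
      case (elim \<omega>)
      have "continuous_on (insert t D) (\<lambda>t. X t \<omega>)"
        using elim(2) by (rule uniformly_continuous_imp_continuous)
      then have "(\<lambda>n. X (d t n) \<omega>) \<longlonglongrightarrow> X t \<omega>"
        by (rule continuous_on_tendsto_compose[OF _ d(2)[OF t]]) (simp_all add: d(1)[OF t])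
      then have "lim (\<lambda>n. X (d t n) \<omega>) = X t \<omega>" by (rule limI)
      moreover have "\<omega> \<in> G" unfolding G_def using elim by (auto intro: uniformly_continuous_on_real_subset)
      ultimately show ?case by (simp add: Z_def)
    qed
  next
    fix \<omega> assume "\<omega> \<in> space P"
    show "continuous_on {0..T} (\<lambda>t. Z t \<omega>)"
    proof (cases "\<omega> \<in> G")
      case True
      then have "uniformly_continuous_on D (\<lambda>t. X t \<omega>)" by (simp add: G_def)
      then obtain g where g: "uniformly_continuous_on {0..T} g" "\<And>t. t \<in> D \<Longrightarrow> X t \<omega> = g t"
        using uniformly_continuous_on_extension_on_closure[of D "\<lambda>t. X t \<omega>"] unfolding clD by metis
      have gc: "continuous_on {0..T} g" using g(1) by (rule uniformly_continuous_imp_continuous)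
      have "g t = Z t \<omega>" if t: "t \<in> {0..T}" for t
      proof -
        have "(\<lambda>n. g (d t n)) \<longlonglongrightarrow> g t"
          by (rule continuous_on_tendsto_compose[OF gc d(2)[OF t] t])
            (rule always_eventually, use d(1)[OF t] D(2) in blast)
        then have "(\<lambda>n. X (d t n) \<omega>) \<longlonglongrightarrow> g t" using g(2)[OF d(1)[OF t]] by simp
        then show ?thesis using True by (simp add: Z_def limI)
      qed
      then show ?thesis using gc by (auto intro: continuous_on_eq)
    qed (simp add: Z_def)
  qed
  then show ?thesis by blast
qed

section \<open>Martingales from independent increments\<close>

lemma null_sets_completion_complete:
  assumes "complete_measure P" shows "null_sets (completion P) = null_sets P"
proof -
  interpret complete_measure P by fact
  show ?thesis
    using complete2 by (auto simp: null_sets_completion_iff2)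
qed

text \<open>
  Independence of the increment from the past is stated as a product law on the path space of
  \<open>[0, s]\<close>; the null sets of the completed filtration are added only afterwards.
\<close>

locale independent_increments = prob_space P for P :: "'a measure" +
  fixes T :: real and X :: "real \<Rightarrow> 'a \<Rightarrow> real" and v :: "real \<Rightarrow> real"
  assumes complete: "complete_measure P"
    and meas: "t \<in> {0..T} \<Longrightarrow> X t \<in> borel_measurable P"
    and square_int: "t \<in> {0..T} \<Longrightarrow> integrable P (\<lambda>\<omega>. (X t \<omega>)\<^sup>2)"
    and increment: "s \<in> {0..T} \<Longrightarrow> t \<in> {0..T} \<Longrightarrow> s \<le> t \<Longrightarrow>
      centered_normal P (\<lambda>\<omega>. X t \<omega> - X s \<omega>) (v t - v s)"
    and v_mono: "s \<in> {0..T} \<Longrightarrow> t \<in> {0..T} \<Longrightarrow> s \<le> t \<Longrightarrow> v s \<le> v t"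
    and indep: "s \<in> {0..T} \<Longrightarrow> t \<in> {0..T} \<Longrightarrow> s \<le> t \<Longrightarrow>
      distr P (Pi\<^sub>M {0..s} (\<lambda>_. borel) \<Otimes>\<^sub>M borel) (\<lambda>\<omega>. (\<lambda>u\<in>{0..s}. X u \<omega>, X t \<omega> - X s \<omega>)) =
      distr P (Pi\<^sub>M {0..s} (\<lambda>_. borel)) (\<lambda>\<omega>. \<lambda>u\<in>{0..s}. X u \<omega>) \<Otimes>\<^sub>M distr P borel (\<lambda>\<omega>. X t \<omega> - X s \<omega>)"
begin

abbreviation "F \<equiv> completed_natural_filtration P X"

definition generator :: "real \<Rightarrow> 'a set set" where
  "generator t = {X s -` B \<inter> space P | s B. 0 \<le> s \<and> s \<le> t \<and> B \<in> sets borel} \<union> null_sets (completion P)"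

lemma generator_sets: "t \<in> {0..T} \<Longrightarrow> generator t \<subseteq> sets P"
  unfolding generator_def null_sets_completion_complete[OF complete]
  by (auto intro!: measurable_sets[OF meas])

lemma generator_Pow: "generator t \<subseteq> Pow (space P)"
  unfolding generator_def null_sets_completion_complete[OF complete]
  by (auto dest: null_setsD2 sets.sets_into_space)

lemma sets_F: "sets (F t) = sigma_sets (space P) (generator t)"
  unfolding completed_natural_filtration_def generator_def[symmetric]
  using generator_Pow by (rule sets_measure_of)

lemma space_F: "space (F t) = space P"
  unfolding completed_natural_filtration_def generator_def[symmetric]
  using generator_Pow by (rule space_measure_of)

lemma subalgebra_F: "t \<in> {0..T} \<Longrightarrow> subalgebra P (F t)"
  unfolding subalgebra_def space_F sets_F
  using generator_sets by (auto intro: sets.sigma_sets_subset[THEN subsetD])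

lemma F_mono: "s \<le> t \<Longrightarrow> sets (F s) \<subseteq> sets (F t)"
proof -
  assume st: "s \<le> t"
  have "generator s \<subseteq> generator t"
    unfolding generator_def
  proof (intro Un_mono subset_refl subsetI)
    fix A assume "A \<in> {X u -` B \<inter> space P | u B. 0 \<le> u \<and> u \<le> s \<and> B \<in> sets borel}"
    then obtain u B where "A = X u -` B \<inter> space P" "0 \<le> u" "u \<le> t" "B \<in> sets borel"
      using st by fastforce
    then show "A \<in> {X u -` B \<inter> space P | u B. 0 \<le> u \<and> u \<le> t \<and> B \<in> sets borel}" by blast
  qed
  then show ?thesis unfolding sets_F by (rule sigma_sets_mono')
qed

lemma X_F_measurable: "t \<in> {0..T} \<Longrightarrow> X t \<in> borel_measurable (F t)"
proof (rule measurableI)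
  fix B :: "real set" assume t: "t \<in> {0..T}" and "B \<in> sets borel"
  then have "X t -` B \<inter> space P \<in> generator t" unfolding generator_def by fastforce
  then show "X t -` B \<inter> space (F t) \<in> sets (F t)" unfolding sets_F space_F by (rule sigma_sets.Basic)
qed simp

lemma past_measurable: "s \<in> {0..T} \<Longrightarrow> (\<lambda>\<omega>. \<lambda>u\<in>{0..s}. X u \<omega>) \<in> P \<rightarrow>\<^sub>M Pi\<^sub>M {0..s} (\<lambda>_. borel)"
  by (intro measurable_restrict meas) auto

text \<open>
  Up to a null set, the events of the completed filtration are events of the past path.
\<close>

lemma F_set_past:
  assumes s: "s \<in> {0..T}" and "A \<in> sets (F s)"
  shows "\<exists>B\<in>sets (Pi\<^sub>M {0..s} (\<lambda>_. borel)). AE \<omega> in P. \<omega> \<in> A \<longleftrightarrow> (\<lambda>u\<in>{0..s}. X u \<omega>) \<in> B"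
  using assms(2) unfolding sets_F
proof (induction A rule: sigma_sets.induct)
  let ?N = "Pi\<^sub>M {0..s} (\<lambda>_. borel :: real measure)"
  have sp: "(\<lambda>u\<in>{0..s}. X u \<omega>) \<in> space ?N" for \<omega> by (simp add: space_PiM)
  case (Basic A)
  then consider (ev) u B where "A = X u -` B \<inter> space P" "0 \<le> u" "u \<le> s" "B \<in> sets borel"
    | (null) "A \<in> null_sets P"
    by (auto simp: generator_def null_sets_completion_complete[OF complete])
  then show ?case
  proof cases
    case ev
    have "{x\<in>space ?N. x u \<in> B} \<in> sets ?N"
      using measurable_sets[OF measurable_component_singleton[of u "{0..s}" "\<lambda>_. borel"] ev(4)] ev(2,3)
      by (simp add: vimage_def Int_def conj_commute)
    moreover have "AE \<omega> in P. \<omega> \<in> A \<longleftrightarrow> (\<lambda>u\<in>{0..s}. X u \<omega>) \<in> {x\<in>space ?N. x u \<in> B}"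
      by (rule AE_I2) (use ev sp in auto)
    ultimately show ?thesis by blast
  next
    case null
    have "AE \<omega> in P. \<omega> \<in> A \<longleftrightarrow> (\<lambda>u\<in>{0..s}. X u \<omega>) \<in> {}"
      using AE_not_in[OF null] by eventually_elim simp
    then show ?thesis by blast
  qed
next
  case Empty
  show ?case by (rule bexI[of _ "{}"]) auto
next
  case (Compl A)
  let ?N = "Pi\<^sub>M {0..s} (\<lambda>_. borel :: real measure)"
  have sp: "(\<lambda>u\<in>{0..s}. X u \<omega>) \<in> space ?N" for \<omega> by (simp add: space_PiM)
  from Compl.IH obtain B where B: "B \<in> sets ?N" "AE \<omega> in P. \<omega> \<in> A \<longleftrightarrow> (\<lambda>u\<in>{0..s}. X u \<omega>) \<in> B" by blast
  have "AE \<omega> in P. \<omega> \<in> space P - A \<longleftrightarrow> (\<lambda>u\<in>{0..s}. X u \<omega>) \<in> space ?N - B"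
    using B(2) AE_space by eventually_elim (simp add: sp)
  then show ?case using B(1) by blast
next
  case (Union A)
  let ?N = "Pi\<^sub>M {0..s} (\<lambda>_. borel :: real measure)"
  have "\<forall>i. \<exists>B. B \<in> sets ?N \<and> (AE \<omega> in P. \<omega> \<in> A i \<longleftrightarrow> (\<lambda>u\<in>{0..s}. X u \<omega>) \<in> B)"
    using Union.IH by blast
  from choice[OF this] obtain B where B: "\<And>i. B i \<in> sets ?N"
    "\<And>i. AE \<omega> in P. \<omega> \<in> A i \<longleftrightarrow> (\<lambda>u\<in>{0..s}. X u \<omega>) \<in> B i" by blast
  have "AE \<omega> in P. \<forall>i. \<omega> \<in> A i \<longleftrightarrow> (\<lambda>u\<in>{0..s}. X u \<omega>) \<in> B i" using B(2) by (simp add: AE_all_countable)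
  then have "AE \<omega> in P. \<omega> \<in> (\<Union>i. A i) \<longleftrightarrow> (\<lambda>u\<in>{0..s}. X u \<omega>) \<in> (\<Union>i. B i)"
    by eventually_elim auto
  then show ?case using B(1) by blast
qed

lemma integrable_X: "t \<in> {0..T} \<Longrightarrow> integrable P (X t)"
  by (rule square_integrable_imp_integrable) (auto intro: meas square_int)

lemma integral_past_increment:
  assumes s: "s \<in> {0..T}" and t: "t \<in> {0..T}" and st: "s \<le> t" and A: "A \<in> sets (F s)"
    and g[measurable]: "g \<in> borel_measurable borel" and h[measurable]: "h \<in> borel_measurable borel"
    and gi: "integrable P (\<lambda>\<omega>. g (X s \<omega>))" and hi: "integrable P (\<lambda>\<omega>. h (X t \<omega> - X s \<omega>))"
  shows "integrable P (\<lambda>\<omega>. indicator A \<omega> * (g (X s \<omega>) * h (X t \<omega> - X s \<omega>) :: real))" (is ?int)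
    and "(\<integral>\<omega>. indicator A \<omega> * (g (X s \<omega>) * h (X t \<omega> - X s \<omega>)) \<partial>P) =
      (\<integral>\<omega>. indicator A \<omega> * g (X s \<omega>) \<partial>P) * (\<integral>\<omega>. h (X t \<omega> - X s \<omega>) \<partial>P)" (is ?eq)
proof -
  let ?N = "Pi\<^sub>M {0..s} (\<lambda>_. borel :: real measure)"
  let ?past = "\<lambda>\<omega>. \<lambda>u\<in>{0..s}. X u \<omega>"
  have s': "s \<in> {0..s}" using s by simp
  note [measurable] = past_measurable[OF s] meas[OF s] meas[OF t]
  have AP[measurable]: "A \<in> sets P" using A subalgebra_F[OF s] by (auto simp: subalgebra_def)
  from F_set_past[OF s A] obtain B where B[measurable]: "B \<in> sets ?N"
    and AB: "AE \<omega> in P. \<omega> \<in> A \<longleftrightarrow> ?past \<omega> \<in> B" by blast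
  define k where "k x = indicator B x * g (x s)" for x :: "real \<Rightarrow> real"
  have k: "k \<in> borel_measurable ?N"
    unfolding k_def using measurable_component_singleton[of s "{0..s}" "\<lambda>_. borel", OF s'] by measurable
  have ind: "indep_var borel (\<lambda>\<omega>. k (?past \<omega>)) borel (\<lambda>\<omega>. h (X t \<omega> - X s \<omega>))"
    by (rule indep_var_compose_pair[OF prob_space_axioms past_measurable[OF s] _ indep[OF s t st] k h]) measurable
  have ae: "AE \<omega> in P. k (?past \<omega>) = indicator A \<omega> * g (X s \<omega>)"
    using AB by eventually_elim (use s' in \<open>auto simp: k_def indicator_def\<close>)
  have km: "(\<lambda>\<omega>. k (?past \<omega>)) \<in> borel_measurable P" using k by (rule measurable_compose[OF past_measurable[OF s]])
  have Ai: "integrable P (\<lambda>\<omega>. indicator A \<omega> * g (X s \<omega>))"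
    using integrable_mult_indicator[OF AP gi] by simp
  have ki: "integrable P (\<lambda>\<omega>. k (?past \<omega>))"
    using Ai by (rule integrable_cong_AE[THEN iffD2, OF km _ ae, rotated]) measurable
  have ae2: "AE \<omega> in P. k (?past \<omega>) * h (X t \<omega> - X s \<omega>) = indicator A \<omega> * (g (X s \<omega>) * h (X t \<omega> - X s \<omega>))"
    using ae by eventually_elim simp
  have m2: "(\<lambda>\<omega>. k (?past \<omega>) * h (X t \<omega> - X s \<omega>)) \<in> borel_measurable P"
    "(\<lambda>\<omega>. indicator A \<omega> * (g (X s \<omega>) * h (X t \<omega> - X s \<omega>))) \<in> borel_measurable P"
    using km by measurable
  show ?int
    using indep_var_integrable[OF ind ki hi] by (rule integrable_cong_AE[THEN iffD1, OF m2 ae2])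
  have "(\<integral>\<omega>. indicator A \<omega> * (g (X s \<omega>) * h (X t \<omega> - X s \<omega>)) \<partial>P) = (\<integral>\<omega>. k (?past \<omega>) * h (X t \<omega> - X s \<omega>) \<partial>P)"
    by (rule integral_cong_AE[OF m2 ae2, symmetric])
  also have "\<dots> = (\<integral>\<omega>. k (?past \<omega>) \<partial>P) * (\<integral>\<omega>. h (X t \<omega> - X s \<omega>) \<partial>P)"
    by (rule indep_var_lebesgue_integral[OF ind ki hi])
  also have "(\<integral>\<omega>. k (?past \<omega>) \<partial>P) = (\<integral>\<omega>. indicator A \<omega> * g (X s \<omega>) \<partial>P)"
    by (rule integral_cong_AE[OF km _ ae]) measurable
  finally show ?eq .
qed

lemma increment_moments:
  assumes "s \<in> {0..T}" "t \<in> {0..T}" "s \<le> t"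
  shows "integrable P (\<lambda>\<omega>. (X t \<omega> - X s \<omega>)\<^sup>2)" "(\<integral>\<omega>. (X t \<omega> - X s \<omega>)\<^sup>2 \<partial>P) = v t - v s"
    "integrable P (\<lambda>\<omega>. X t \<omega> - X s \<omega>)" "(\<integral>\<omega>. X t \<omega> - X s \<omega> \<partial>P) = 0"
  using centered_normal_moments[OF prob_space_axioms increment[OF assms]] v_mono[OF assms] by auto

lemma cond_exp_charact:
  assumes s: "s \<in> {0..T}" and "integrable P f" "integrable P g" "g \<in> borel_measurable (F s)"
    and eq: "\<And>A. A \<in> sets (F s) \<Longrightarrow> (\<integral>\<omega>. indicator A \<omega> * (f \<omega> - g \<omega>) \<partial>P) = 0"
  shows "AE \<omega> in P. real_cond_exp P (F s) f \<omega> = g \<omega>"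
proof -
  interpret finite_measure_subalgebra P "F s"
    by unfold_locales (rule subalgebra_F[OF s])
  show ?thesis
  proof (rule real_cond_exp_charact)
    fix A assume A: "A \<in> sets (F s)"
    then have AP: "A \<in> sets P" using subalgebra_F[OF s] by (auto simp: subalgebra_def)
    have "integrable P (\<lambda>\<omega>. indicator A \<omega> * f \<omega>)" "integrable P (\<lambda>\<omega>. indicator A \<omega> * g \<omega>)"
      using integrable_mult_indicator[OF AP assms(2)] integrable_mult_indicator[OF AP assms(3)] by simp_all
    then show "(LINT \<omega>:A|P. f \<omega>) = (LINT \<omega>:A|P. g \<omega>)"
      using eq[OF A] by (simp add: set_lebesgue_integral_def right_diff_distrib)
  qed (fact assms)+
qed

lemma martingale: "martingale_on P T F X"
  unfolding martingale_on_def
proof (intro conjI ballI impI)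
  fix s t assume s: "s \<in> {0..T}" and t: "t \<in> {0..T}" and st: "s \<le> t"
  show "AE \<omega> in P. real_cond_exp P (F s) (X t) \<omega> = X s \<omega>"
  proof (rule cond_exp_charact[OF s integrable_X[OF t] integrable_X[OF s] X_F_measurable[OF s]])
    fix A assume A: "A \<in> sets (F s)"
    note m = increment_moments[OF s t st]
    have "(\<integral>\<omega>. indicator A \<omega> * (1 * (X t \<omega> - X s \<omega>)) \<partial>P) = (\<integral>\<omega>. indicator A \<omega> * 1 \<partial>P) * (\<integral>\<omega>. X t \<omega> - X s \<omega> \<partial>P)"
      by (rule integral_past_increment(2)[OF s t st A borel_measurable_const measurable_ident_sets[OF refl] integrable_const m(3)])
    then show "(\<integral>\<omega>. indicator A \<omega> * (X t \<omega> - X s \<omega>) \<partial>P) = 0"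
      by (simp only: m(4) mult_1_left mult_zero_right)
  qed
next
  fix t assume t: "t \<in> {0..T}"
  show "subalgebra P (F t)" "X t \<in> borel_measurable (F t)" "integrable P (X t)"
    by (fact subalgebra_F[OF t] X_F_measurable[OF t] integrable_X[OF t])+
next
  fix s t :: real assume "s \<le> t"
  then show "sets (F s) \<subseteq> sets (F t)" by (rule F_mono)
qed

text \<open>
  With \<open>D = X t - X s\<close> one has \<open>(X t)\<^sup>2 - (X s)\<^sup>2 = 2 X s D + D\<^sup>2\<close>; the increment is independent of the
  past, \<open>E D = 0\<close> and \<open>E D\<^sup>2 = v t - v s\<close>.
\<close>

lemma martingale_square: "martingale_on P T F (\<lambda>t \<omega>. (X t \<omega>)\<^sup>2 - v t)"
  unfolding martingale_on_def
proof (intro conjI ballI impI)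
  fix t assume t: "t \<in> {0..T}"
  note X_F_measurable[OF t, measurable]
  show "(\<lambda>\<omega>. (X t \<omega>)\<^sup>2 - v t) \<in> borel_measurable (F t)" by measurable
  show "integrable P (\<lambda>\<omega>. (X t \<omega>)\<^sup>2 - v t)" using square_int[OF t] by simp
next
  fix s t assume s: "s \<in> {0..T}" and t: "t \<in> {0..T}" and st: "s \<le> t"
  note X_F_measurable[OF s, measurable]
  show "AE \<omega> in P. real_cond_exp P (F s) (\<lambda>\<omega>. (X t \<omega>)\<^sup>2 - v t) \<omega> = (X s \<omega>)\<^sup>2 - v s"
  proof (rule cond_exp_charact[OF s])
    show "integrable P (\<lambda>\<omega>. (X t \<omega>)\<^sup>2 - v t)" "integrable P (\<lambda>\<omega>. (X s \<omega>)\<^sup>2 - v s)"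
      using square_int[OF t] square_int[OF s] by simp_all
    show "(\<lambda>\<omega>. (X s \<omega>)\<^sup>2 - v s) \<in> borel_measurable (F s)" by measurable
    fix A assume A: "A \<in> sets (F s)"
    note m = increment_moments[OF s t st]
    have i2: "integrable P (\<lambda>\<omega>. 2 * X s \<omega>)" using integrable_X[OF s] by (rule integrable_mult_right)
    have i3: "integrable P (\<lambda>\<omega>. (X t \<omega> - X s \<omega>)\<^sup>2 - (v t - v s))"
      using m(1) by (rule Bochner_Integration.integrable_diff) (rule integrable_const)
    have i1: "integrable P (\<lambda>\<omega>. 1 :: real)" by (rule integrable_const)
    have g: "(\<lambda>x::real. 2 * x) \<in> borel_measurable borel" "(\<lambda>x::real. x) \<in> borel_measurable borel"
      "(\<lambda>_::real. 1 :: real) \<in> borel_measurable borel" "(\<lambda>x::real. x\<^sup>2 - (v t - v s)) \<in> borel_measurable borel"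
      by measurable
    note p1 = integral_past_increment[OF s t st A g(1,2) i2 m(3)]
    note p2 = integral_past_increment[OF s t st A g(3,4) i1 i3]
    have "(\<integral>\<omega>. indicator A \<omega> * ((X t \<omega>)\<^sup>2 - v t - ((X s \<omega>)\<^sup>2 - v s)) \<partial>P) =
        (\<integral>\<omega>. indicator A \<omega> * (2 * X s \<omega> * (X t \<omega> - X s \<omega>)) + indicator A \<omega> * (1 * ((X t \<omega> - X s \<omega>)\<^sup>2 - (v t - v s))) \<partial>P)"
      by (intro Bochner_Integration.integral_cong refl) (simp add: power2_eq_square algebra_simps)
    also have "\<dots> = (\<integral>\<omega>. indicator A \<omega> * (2 * X s \<omega> * (X t \<omega> - X s \<omega>)) \<partial>P) +
        (\<integral>\<omega>. indicator A \<omega> * (1 * ((X t \<omega> - X s \<omega>)\<^sup>2 - (v t - v s))) \<partial>P)"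
      by (rule Bochner_Integration.integral_add[OF p1(1) p2(1)])
    also have "(\<integral>\<omega>. indicator A \<omega> * (2 * X s \<omega> * (X t \<omega> - X s \<omega>)) \<partial>P) = 0"
      unfolding p1(2) m(4) by (rule mult_zero_right)
    also have "(\<integral>\<omega>. indicator A \<omega> * (1 * ((X t \<omega> - X s \<omega>)\<^sup>2 - (v t - v s))) \<partial>P) = 0"
    proof -
      have "(\<integral>\<omega>. (X t \<omega> - X s \<omega>)\<^sup>2 - (v t - v s) \<partial>P) = 0"
        by (subst Bochner_Integration.integral_diff[OF m(1)]) (simp_all add: m(2) prob_space)
      then show ?thesis unfolding p2(2) by simp
    qed
    finally show "(\<integral>\<omega>. indicator A \<omega> * ((X t \<omega>)\<^sup>2 - v t - ((X s \<omega>)\<^sup>2 - v s)) \<partial>P) = 0" by simp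
  qed
next
  fix t assume "t \<in> {0..T}"
  then show "subalgebra P (F t)" by (rule subalgebra_F)
next
  fix s t :: real assume "s \<le> t"
  then show "sets (F s) \<subseteq> sets (F t)" by (rule F_mono)
qed

end

section \<open>Bridges\<close>

text \<open>
  As \<open>Y\<close> is independent of \<open>M T\<close>, freezing \<open>M T = x\<close> in \<open>M = Y + r M T\<close> gives a regular conditional
  law.  The paths that it charges are translates of those of \<open>Y\<close> by \<open>r x\<close>, so the integral of a
  bounded continuous function of countably many coordinates is continuous in \<open>x\<close> by dominated
  convergence.
\<close>

lemma bridge_of_independent_end:
  fixes Y :: "real \<Rightarrow> 'a \<Rightarrow> real" and r :: "real \<Rightarrow> real"
  assumes "prob_space P" "0 \<le> T"
    and M: "\<And>t. t \<in> {0..T} \<Longrightarrow> M t \<in> borel_measurable P"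
    and Y: "\<And>t. t \<in> {0..T} \<Longrightarrow> Y t \<in> borel_measurable P"
    and M_eq: "\<And>t \<omega>. t \<in> {0..T} \<Longrightarrow> M t \<omega> = Y t \<omega> + r t * M T \<omega>"
    and indep: "distr P (Pi\<^sub>M {0..T} (\<lambda>_. borel) \<Otimes>\<^sub>M borel) (\<lambda>\<omega>. (path T Y \<omega>, M T \<omega>)) = law P T Y \<Otimes>\<^sub>M distr P borel (M T)"
    and X: "\<And>t. t \<in> {0..T} \<Longrightarrow> X t \<in> borel_measurable P"
    and law: "law P T X = law P T Y"
  shows "is_bridge P T M X"
proof -
  interpret prob_space P by fact
  let ?N = "Pi\<^sub>M {0..T} (\<lambda>_. borel :: real measure)"
  define S where "S x y = (\<lambda>t\<in>{0..T}. y t + r t * x)" for x :: real and y :: "real \<Rightarrow> real"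
  define K where "K x = distr (law P T Y) ?N (S x)" for x
  have S2: "(\<lambda>(x, y). S x y) \<in> borel \<Otimes>\<^sub>M ?N \<rightarrow>\<^sub>M ?N"
  proof -
    have "(\<lambda>p. \<lambda>t\<in>{0..T}. snd p t + r t * fst p) \<in> borel \<Otimes>\<^sub>M ?N \<rightarrow>\<^sub>M ?N"
    proof (rule measurable_restrict)
      fix t assume "t \<in> {0..T}"
      then have [measurable]: "(\<lambda>y. y t) \<in> ?N \<rightarrow>\<^sub>M borel" by (rule measurable_component_singleton)
      show "(\<lambda>p. snd p t + r t * fst p) \<in> borel_measurable (borel \<Otimes>\<^sub>M ?N)" by measurable
    qed
    then show ?thesis by (simp add: S_def split_beta')
  qed
  have S1: "S x \<in> ?N \<rightarrow>\<^sub>M ?N" for x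
    using measurable_compose[OF measurable_Pair1'[of x borel ?N] S2] by simp
  have pY: "path T Y \<in> P \<rightarrow>\<^sub>M ?N" by (rule path_measurable[OF Y])
  have pM: "path T M \<in> P \<rightarrow>\<^sub>M ?N" by (rule path_measurable[OF M])
  have MT: "M T \<in> borel_measurable P" using M assms(2) by simp
  have lawY: "prob_space (law P T Y)" unfolding law_def by (rule prob_space_distr[OF pY])
  have setsL[measurable_cong]: "sets (law P T Y) = sets ?N" by (simp add: law_def)
  have Sl: "S x \<in> law P T Y \<rightarrow>\<^sub>M ?N" for x using S1 by (simp add: measurable_cong_sets[OF setsL refl])
  have path_M: "path T M \<omega> = S (M T \<omega>) (path T Y \<omega>)" for \<omega>
  proof (rule ext)
    fix t
    show "path T M \<omega> t = S (M T \<omega>) (path T Y \<omega>) t"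
      using M_eq[of t \<omega>] by (cases "t \<in> {0..T}") (simp_all only: path_def S_def restrict_apply if_True if_False)
  qed
  have "conditional_law_given_end P T M K"
    unfolding conditional_law_given_end_def
  proof (intro conjI ballI)
    have "(\<lambda>_. law P T Y) \<in> borel \<rightarrow>\<^sub>M prob_algebra ?N"
      using lawY setsL by (intro measurable_const) (auto simp: space_prob_algebra)
    then show "K \<in> borel \<rightarrow>\<^sub>M prob_algebra ?N"
      unfolding K_def using S2 by (rule measurable_distr_prob_space2)
    fix A and B :: "real set" assume A: "A \<in> sets ?N" and B: "B \<in> sets borel"
    \<comment> \<open>The event in question, in terms of the independent pair \<open>(Y, M T)\<close>.\<close>
    define H where "H = {p \<in> space (?N \<Otimes>\<^sub>M borel). S (snd p) (fst p) \<in> A \<and> snd p \<in> B}"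
    have "(\<lambda>p. S (snd p) (fst p)) \<in> ?N \<Otimes>\<^sub>M borel \<rightarrow>\<^sub>M ?N"
      using measurable_compose[OF measurable_Pair[OF measurable_snd measurable_fst] S2] by simp
    then have H: "H \<in> sets (?N \<Otimes>\<^sub>M borel)"
      unfolding H_def using A B by measurable
    have J: "(\<lambda>\<omega>. (path T Y \<omega>, M T \<omega>)) \<in> P \<rightarrow>\<^sub>M ?N \<Otimes>\<^sub>M borel" using pY MT by (rule measurable_Pair)
    interpret L: prob_space "law P T Y" by (rule lawY)
    interpret D: prob_space "distr P borel (M T)" by (rule prob_space_distr[OF MT])
    interpret LD: pair_prob_space "law P T Y" "distr P borel (M T)" ..
    have "{\<omega>\<in>space P. path T M \<omega> \<in> A \<and> M T \<omega> \<in> B} = (\<lambda>\<omega>. (path T Y \<omega>, M T \<omega>)) -` H \<inter> space P"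
      using measurable_space[OF J] by (auto simp: H_def path_M)
    then have "emeasure P {\<omega>\<in>space P. path T M \<omega> \<in> A \<and> M T \<omega> \<in> B} =
        emeasure (distr P (?N \<Otimes>\<^sub>M borel) (\<lambda>\<omega>. (path T Y \<omega>, M T \<omega>))) H"
      by (simp only: emeasure_distr[OF J H])
    also have "\<dots> = emeasure (law P T Y \<Otimes>\<^sub>M distr P borel (M T)) H" by (simp only: indep)
    also have "\<dots> = (\<integral>\<^sup>+x. emeasure (law P T Y) ((\<lambda>y. (y, x)) -` H) \<partial>distr P borel (M T))"
    proof (rule LD.emeasure_pair_measure_alt2)
      have "sets (law P T Y \<Otimes>\<^sub>M distr P borel (M T)) = sets (?N \<Otimes>\<^sub>M borel)"
        by (rule sets_pair_measure_cong) (simp_all add: setsL)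
      then show "H \<in> sets (law P T Y \<Otimes>\<^sub>M distr P borel (M T))" using H by simp
    qed
    also have "\<dots> = (\<integral>\<^sup>+x. emeasure (K x) A * indicator B x \<partial>distr P borel (M T))"
    proof (rule nn_integral_cong)
      fix x
      have sp: "space (law P T Y) = space ?N" by (rule sets_eq_imp_space_eq[OF setsL])
      have "(\<lambda>y. (y, x)) -` H = (if x \<in> B then S x -` A \<inter> space (law P T Y) else {})"
        unfolding sp by (auto simp: H_def space_pair_measure)
      then show "emeasure (law P T Y) ((\<lambda>y. (y, x)) -` H) = emeasure (K x) A * indicator B x"
        unfolding K_def emeasure_distr[OF Sl A] by simp
    qed
    finally show "emeasure P {\<omega>\<in>space P. path T M \<omega> \<in> A \<and> M T \<omega> \<in> B} =
        (\<integral>\<^sup>+x. emeasure (K x) A * indicator B x \<partial>distr P borel (M T))" .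
  qed
  moreover have "weakly_continuous_at_0 T K"
    unfolding weakly_continuous_at_0_def
  proof (intro allI impI)
    fix \<tau> :: "nat \<Rightarrow> real" and g :: "(nat \<Rightarrow> real) \<Rightarrow> real"
    assume \<tau>: "range \<tau> \<subseteq> {0..T}" and g: "continuous_on UNIV g" and bg: "bounded (range g)"
    have \<tau>': "\<tau> n \<in> {0..T}" for n using \<tau> by blast
    obtain C where C: "\<And>x. norm (g x) \<le> C" using bg by (auto simp: bounded_iff)
    have gm: "g \<in> borel_measurable borel" using g by (rule borel_measurable_continuous_onI)
    have ev: "(\<lambda>\<omega>. \<lambda>n. \<omega> (\<tau> n)) \<in> borel_measurable ?N"
      by (intro measurable_coordinatewise_then_product measurable_component_singleton \<tau>')
    have gev: "(\<lambda>\<omega>. g (\<lambda>n. \<omega> (\<tau> n))) \<in> borel_measurable ?N"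
      using measurable_compose[OF ev gm] .
    have K_int: "(\<integral>\<omega>. g (\<lambda>n. \<omega> (\<tau> n)) \<partial>K x) = (\<integral>y. g (\<lambda>n. y (\<tau> n) + r (\<tau> n) * x) \<partial>law P T Y)" for x
      unfolding K_def using \<tau>' by (subst integral_distr[OF Sl gev]) (simp add: S_def)
    have shift: "(\<lambda>y. g (\<lambda>n. y (\<tau> n) + r (\<tau> n) * x)) \<in> borel_measurable (law P T Y)" for x
      using measurable_compose[OF Sl gev, of x] \<tau>' by (simp add: S_def)
    have lim: "((\<lambda>x. g (\<lambda>n. y (\<tau> n) + r (\<tau> n) * x)) \<longlongrightarrow> g (\<lambda>n. y (\<tau> n) + r (\<tau> n) * 0)) (at 0)" for y
    proof -
      have "continuous_on UNIV (\<lambda>x::real. \<lambda>n. y (\<tau> n) + r (\<tau> n) * x)"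
        by (intro continuous_on_coordinatewise_then_product continuous_intros)
      then have "continuous_on UNIV (\<lambda>x. g (\<lambda>n. y (\<tau> n) + r (\<tau> n) * x))"
        by (rule continuous_on_compose2[OF g]) simp
      then have "isCont (\<lambda>x. g (\<lambda>n. y (\<tau> n) + r (\<tau> n) * x)) 0"
        by (simp add: continuous_on_eq_continuous_at)
      then show ?thesis by (simp only: isCont_def)
    qed
    show "((\<lambda>x. \<integral>\<omega>. g (\<lambda>n. \<omega> (\<tau> n)) \<partial>K x) \<longlongrightarrow> (\<integral>\<omega>. g (\<lambda>n. \<omega> (\<tau> n)) \<partial>K 0)) (at 0)"
      unfolding K_int tendsto_at_iff_sequentially o_def
    proof (intro allI impI)
      fix Z :: "nat \<Rightarrow> real" assume Z: "\<forall>i. Z i \<in> UNIV - {0}" "Z \<longlonglongrightarrow> 0"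
      interpret L: prob_space "law P T Y" by (rule lawY)
      show "(\<lambda>i. \<integral>y. g (\<lambda>n. y (\<tau> n) + r (\<tau> n) * Z i) \<partial>law P T Y) \<longlonglongrightarrow> (\<integral>y. g (\<lambda>n. y (\<tau> n) + r (\<tau> n) * 0) \<partial>law P T Y)"
      proof (rule integral_dominated_convergence[where w = "\<lambda>_. C"])
        show "AE y in law P T Y. (\<lambda>i. g (\<lambda>n. y (\<tau> n) + r (\<tau> n) * Z i)) \<longlonglongrightarrow> g (\<lambda>n. y (\<tau> n) + r (\<tau> n) * 0)"
          using lim Z unfolding tendsto_at_iff_sequentially o_def by (intro AE_I2) blast
      qed (use shift shift[of 0] C in auto)
    qed
  qed
  moreover have "law P T X = K 0"
  proof -
    have "K 0 = distr (law P T Y) (law P T Y) (\<lambda>y. y)"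
      unfolding K_def
    proof (rule distr_cong)
      fix y assume "y \<in> space (law P T Y)"
      then have "y \<in> extensional {0..T}" by (auto simp: law_def space_PiM PiE_def)
      then show "S 0 y = y" by (simp add: S_def extensional_restrict)
    qed (simp_all add: setsL)
    then show ?thesis using law distr_id[of "law P T Y"] by (simp add: id_def)
  qed
  ultimately show ?thesis unfolding is_bridge_def using X by blast
qed

section \<open>The transforms of the martingale\<close>

text \<open>
  Orthogonal integrands give independent Gaussian integrals.
\<close>

lemma (in gaussian_integrator) wiener_indep:
  fixes U :: "real set"
  assumes U: "U \<subseteq> {0..}" and f: "\<And>u. u \<in> U \<Longrightarrow> wiener (f u) (I u)" and h: "wiener h J"
    and orth: "\<And>u. u \<in> U \<Longrightarrow> (\<integral>s. f u s * h s \<partial>\<mu>) = 0"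
  shows "distr P (Pi\<^sub>M U (\<lambda>_. borel) \<Otimes>\<^sub>M borel) (\<lambda>\<omega>. (\<lambda>u\<in>U. I u \<omega>, J \<omega>)) =
    distr P (Pi\<^sub>M U (\<lambda>_. borel)) (\<lambda>\<omega>. \<lambda>u\<in>U. I u \<omega>) \<Otimes>\<^sub>M distr P borel J"
proof -
  \<comment> \<open>The additional variable gets the index \<open>-1\<close>, which is not a time.\<close>
  define f' where "f' u = (if u = -1 then h else f u)" for u
  define I' where "I' u = (if u = -1 then J else I u)" for u
  have j: "-1 \<notin> U" using U by auto
  have w: "wiener (f' u) (I' u)" if "u \<in> insert (-1) U" for u
    using that f h by (auto simp: f'_def I'_def)
  have r: "(\<lambda>u\<in>U. I' u \<omega>) = (\<lambda>u\<in>U. I u \<omega>)" for \<omega>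
    using j by (auto simp: I'_def restrict_def)
  have "distr P (Pi\<^sub>M U (\<lambda>_. borel) \<Otimes>\<^sub>M borel) (\<lambda>\<omega>. (\<lambda>u\<in>U. I' u \<omega>, I' (-1) \<omega>)) =
    distr P (Pi\<^sub>M U (\<lambda>_. borel)) (\<lambda>\<omega>. \<lambda>u\<in>U. I' u \<omega>) \<Otimes>\<^sub>M distr P borel (I' (-1))"
  proof (rule gaussian_family_indep[OF P.prob_space_axioms wiener_gaussian_family[OF w] j])
    fix u assume u: "u \<in> U"
    then have "u \<noteq> -1" using j by auto
    then show "(\<integral>s. f' u s * f' (-1) s \<partial>\<mu>) = 0" "(\<integral>s. f' (-1) s * f' u s \<partial>\<mu>) = 0"
      using orth[OF u] by (simp_all add: f'_def mult.commute)
  qed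
  moreover have "I' (-1) = J" by (simp add: I'_def)
  ultimately show ?thesis by (simp only: r)
qed

lemma (in gaussian_integrator) wiener_law_eq:
  assumes "\<And>t. t \<in> {0..T} \<Longrightarrow> wiener (f t) (I t)" "\<And>t. t \<in> {0..T} \<Longrightarrow> wiener (g t) (J t)"
    and "\<And>s t. s \<in> {0..T} \<Longrightarrow> t \<in> {0..T} \<Longrightarrow> (\<integral>u. f s u * f t u \<partial>\<mu>) = (\<integral>u. g s u * g t u \<partial>\<mu>)"
  shows "law P T I = law P T J"
  unfolding law_def path_def
  by (rule gaussian_family_law[OF P.prob_space_axioms P.prob_space_axioms
        wiener_gaussian_family[OF assms(1)] wiener_gaussian_family[OF assms(2)] assms(3)])

locale volatility_martingale = deterministic_volatility T z + G: gaussian_integrator P "qv_measure T z" T M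
  for T :: real and z :: "real \<Rightarrow> real" and P :: "'a measure" and M :: "real \<Rightarrow> 'a \<Rightarrow> real" +
  assumes P_complete: "complete_measure P"
    and M_0: "AE \<omega> in P. M 0 \<omega> = 0"
    and M_continuous: "\<And>\<omega>. \<omega> \<in> space P \<Longrightarrow> continuous_on {0..T} (\<lambda>t. M t \<omega>)"
begin

text \<open>
  The integral of \<open>1\<^bsub>(0,t]\<^esub>\<close> is \<open>M t - M 0\<close>, and \<open>M\<close> starts at \<open>0\<close> almost surely.
\<close>

lemma wiener_M:
  assumes t: "t \<in> {0..T}" shows "G.wiener (indicator {0<..t}) (M t)"
proof (rule G.wiener_cong_AE[OF G.wiener_step[of "[(1, 0, t)]"]])
  show "step_on T [(1, 0, t)]" using t by simp
  show "AE s in \<mu>. step_fun [(1, 0, t)] s = indicator {0<..t} s" by simp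
  show "AE \<omega> in P. step_integral M [(1, 0, t)] \<omega> = M t \<omega>"
    using M_0 by eventually_elim simp
  show "indicator {0<..t} \<in> borel_measurable \<mu>" by (rule mu.borel_measurable_mu) simp
  show "M t \<in> borel_measurable P" using t by (rule G.X_measurable)
qed

lemma indicator_inner:
  assumes s: "s \<in> {0..T}" and t: "t \<in> {0..T}"
  shows "has_bochner_integral \<mu> (\<lambda>u. indicator {0<..s} u * indicator {0<..t} u) (q (min s t))"
proof -
  have m: "min s t \<in> {0..T}" "{0<..min s t} \<in> sets \<mu>" using s t by (auto simp: mu.sets_mu_iff)
  have z: "0 \<in> {0..T}" using T by simp
  have "has_bochner_integral \<mu> (indicator {0<..min s t}) (measure \<mu> {0<..min s t})"
    by (rule has_bochner_integral_real_indicator[OF m(2)]) (simp add: mu.emeasure_eq_measure)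
  moreover have "measure \<mu> {0<..min s t} = q (min s t)"
    using measure_Ioc[OF z m(1)] m(1) by simp
  moreover have "indicator {0<..min s t} = (\<lambda>u. indicator {0<..s} u * (indicator {0<..t} u :: real))"
    by (auto simp: indicator_def fun_eq_iff)
  ultimately show ?thesis by (simp only:)
qed

lemma has_bochner_integral_value:
  assumes "has_bochner_integral \<mu> (\<lambda>u. f u * g u) v" shows "(\<integral>u. f u * g u \<partial>\<mu>) = v"
  using assms by (simp add: has_bochner_integral_iff)

lemma wiener_transform:
  assumes i: "i \<in> {1, 2}" and t: "t \<in> {0..T}"
  shows "G.wiener (beta T z i (indicator {0..<t})) (T_transform P T z M i t)"
    and "G.wiener (alpha T z i (indicator {0..<t})) (B_transform P T z M i t)"
proof -
  have "integrable \<mu> (\<lambda>s. (beta T z i (indicator {0..<t}) s)\<^sup>2)"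
    "integrable \<mu> (\<lambda>s. (alpha T z i (indicator {0..<t}) s)\<^sup>2)"
    using beta_inner[OF i t t] alpha_inner[OF i t t] unfolding has_bochner_integral_iff power2_eq_square by blast+
  then show "G.wiener (beta T z i (indicator {0..<t})) (T_transform P T z M i t)"
    "G.wiener (alpha T z i (indicator {0..<t})) (B_transform P T z M i t)"
    unfolding T_transform_def B_transform_def
    using transforms_measurable[OF i t] by (auto intro: G.wiener_integral_wiener)
qed

lemma T_transform_law:
  assumes i: "i \<in> {1, 2}"
  shows "law P T (T_transform P T z M i) = law P T M"
  by (rule G.wiener_law_eq[OF wiener_transform(1)[OF i] wiener_M])
    (simp_all only: has_bochner_integral_value[OF beta_inner[OF i]] has_bochner_integral_value[OF indicator_inner])

lemma T_transform_continuous_modification: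
  assumes i: "i \<in> {1, 2}"
  shows "\<exists>Y. continuous_modification P T (T_transform P T z M i) Y"
  by (rule continuous_modification_of_law[OF T _ G.X_measurable T_transform_law[OF i] M_continuous])
    (rule G.wiener_measurable(2)[OF wiener_transform(1)[OF i]])

lemma T_transform_0:
  assumes i: "i \<in> {1, 2}"
  shows "AE \<omega> in P. T_transform P T z M i 0 \<omega> = 0"
proof -
  have z: "0 \<in> {0..T}" using T by simp
  have "(\<integral>s. (beta T z i (indicator {0..<0}) s)\<^sup>2 \<partial>\<mu>) = 0"
    using has_bochner_integral_value[OF beta_inner[OF i z z]] by (simp add: power2_eq_square)
  with G.wiener_normal(2)[OF wiener_transform(1)[OF i z]]
  have "centered_normal P (T_transform P T z M i 0) 0" by simp
  then show ?thesis by (rule centered_normal_0_AE[OF G.P.prob_space_axioms])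
qed

text \<open>
  For \<open>u \<le> s \<le> t\<close> the integrand at time \<open>u\<close> is orthogonal to the increment of the integrands from \<open>s\<close>
  to \<open>t\<close>, because \<open>q (min u t) = q (min u s)\<close>.
\<close>

lemma T_transform_independent_increments:
  assumes i: "i \<in> {1, 2}"
  shows "independent_increments P T (T_transform P T z M i) q"
proof -
  let ?b = "\<lambda>t. beta T z i (indicator {0..<t})"
  let ?X = "T_transform P T z M i"
  note w = wiener_transform(1)[OF i] and inner = beta_inner[OF i]
  have ps: "prob_space P" by (rule G.P.prob_space_axioms)
  show ?thesis
  proof (intro independent_increments.intro independent_increments_axioms.intro)
    show "prob_space P" "complete_measure P" by (fact ps P_complete)+
    fix t assume t: "t \<in> {0..T}"
    show "?X t \<in> borel_measurable P" by (rule G.wiener_measurable(2)[OF w[OF t]])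
    show "integrable P (\<lambda>\<omega>. (?X t \<omega>)\<^sup>2)"
      by (rule centered_normal_moments(1)[OF ps G.wiener_normal(2)[OF w[OF t]]]) simp
  next
    fix s t assume s: "s \<in> {0..T}" and t: "t \<in> {0..T}" and st: "s \<le> t"
    show "q s \<le> q t" by (rule qv_mono[OF s t st])
    have d: "G.wiener (\<lambda>u. ?b t u - ?b s u) (\<lambda>\<omega>. ?X t \<omega> - ?X s \<omega>)"
      by (rule G.wiener_diff[OF w[OF t] w[OF s]])
    have "has_bochner_integral \<mu> (\<lambda>u. (?b t u * ?b t u - ?b s u * ?b t u) - (?b s u * ?b t u - ?b s u * ?b s u))
        ((q (min t t) - q (min s t)) - (q (min s t) - q (min s s)))"
      by (intro has_bochner_integral_diff inner s t)
    moreover have "(?b t u * ?b t u - ?b s u * ?b t u) - (?b s u * ?b t u - ?b s u * ?b s u) = (?b t u - ?b s u)\<^sup>2" for u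
      by (simp add: power2_eq_square algebra_simps)
    ultimately have "(\<integral>u. (?b t u - ?b s u)\<^sup>2 \<partial>\<mu>) = q t - q s"
      using st by (simp add: has_bochner_integral_iff min_def)
    then show "centered_normal P (\<lambda>\<omega>. ?X t \<omega> - ?X s \<omega>) (q t - q s)"
      using G.wiener_normal(2)[OF d] by simp
    have "(\<integral>v. ?b u v * (?b t v - ?b s v) \<partial>\<mu>) = 0" if u: "u \<in> {0..s}" for u
    proof -
      have u': "u \<in> {0..T}" using u s by auto
      have "has_bochner_integral \<mu> (\<lambda>v. ?b u v * ?b t v - ?b u v * ?b s v) (q (min u t) - q (min u s))"
        by (intro has_bochner_integral_diff inner s t u')
      then show ?thesis using u st by (simp add: has_bochner_integral_iff right_diff_distrib min_def)
    qed
    then show "distr P (Pi\<^sub>M {0..s} (\<lambda>_. borel) \<Otimes>\<^sub>M borel) (\<lambda>\<omega>. (\<lambda>u\<in>{0..s}. ?X u \<omega>, ?X t \<omega> - ?X s \<omega>)) =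
      distr P (Pi\<^sub>M {0..s} (\<lambda>_. borel)) (\<lambda>\<omega>. \<lambda>u\<in>{0..s}. ?X u \<omega>) \<Otimes>\<^sub>M distr P borel (\<lambda>\<omega>. ?X t \<omega> - ?X s \<omega>)"
      using s by (intro G.wiener_indep[OF _ w d]) auto
  qed
qed

lemma T_transform_quadratic_variation:
  assumes i: "i \<in> {1, 2}"
  shows "martingale_on P T (completed_natural_filtration P (T_transform P T z M i)) (T_transform P T z M i)"
    and "is_quadratic_variation P T (completed_natural_filtration P (T_transform P T z M i))
      (T_transform P T z M i) (\<lambda>t \<omega>. q t)"
proof -
  interpret X: independent_increments P T "T_transform P T z M i" q
    by (rule T_transform_independent_increments[OF i])
  show "martingale_on P T (completed_natural_filtration P (T_transform P T z M i)) (T_transform P T z M i)"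
    by (rule X.martingale)
  have "mono_on {0..T} q" using qv_mono by (auto intro: mono_onI)
  then show "is_quadratic_variation P T (completed_natural_filtration P (T_transform P T z M i))
      (T_transform P T z M i) (\<lambda>t \<omega>. q t)"
    unfolding is_quadratic_variation_def
    using X.martingale X.martingale_square X.square_int T_transform_continuous_modification[OF i] qv_continuous
    by simp
qed

text \<open>
  \<open>Y t = M t - (q t / Q) M T\<close> is the projection of \<open>M t\<close> orthogonal to \<open>M T\<close>, and its covariance is that
  of the transform by \<open>alpha_inner\<close>.
\<close>

lemma B_transform_bridge:
  assumes i: "i \<in> {1, 2}"
  shows "is_bridge P T M (B_transform P T z M i)"
proof -
  define r where "r t = q t / Q" for t
  define Y where "Y t \<omega> = M t \<omega> - r t * M T \<omega>" for t \<omega>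
  let ?e = "\<lambda>t u. indicator {0<..t} u :: real"
  let ?f = "\<lambda>t u. ?e t u - r t * ?e T u"
  have TT: "T \<in> {0..T}" using T by simp
  have wY: "G.wiener (?f t) (Y t)" if "t \<in> {0..T}" for t
    unfolding Y_def[abs_def] using that TT by (intro G.wiener_diff G.wiener_cmult wiener_M)
  have inner_Y: "has_bochner_integral \<mu> (\<lambda>u. ?f s u * ?f t u) (q (min s t) - q s * q t / Q)"
    if s: "s \<in> {0..T}" and t: "t \<in> {0..T}" for s t
  proof -
    have "has_bochner_integral \<mu> (\<lambda>u. (?e s u * ?e t u - r t * (?e s u * ?e T u)) - (r s * (?e T u * ?e t u) - r s * (r t * (?e T u * ?e T u))))
       ((q (min s t) - r t * q (min s T)) - (r s * q (min T t) - r s * (r t * q (min T T))))"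
      by (intro has_bochner_integral_diff has_bochner_integral_mult_right indicator_inner s t TT)
    moreover have "(?e s u * ?e t u - r t * (?e s u * ?e T u)) - (r s * (?e T u * ?e t u) - r s * (r t * (?e T u * ?e T u)))
        = ?f s u * ?f t u" for u
      by (simp add: algebra_simps)
    moreover have "(q (min s t) - r t * q (min s T)) - (r s * q (min T t) - r s * (r t * q (min T T))) = q (min s t) - q s * q t / Q"
      using s t Q_pos by (simp add: r_def min_absorb1 min_absorb2 field_simps)
    ultimately show ?thesis by (simp only:)
  qed
  have law_eq: "law P T (B_transform P T z M i) = law P T Y"
    by (rule G.wiener_law_eq[OF wiener_transform(2)[OF i] wY])
      (simp_all only: has_bochner_integral_value[OF alpha_inner[OF i]] has_bochner_integral_value[OF inner_Y])
  have orth: "(\<integral>u. ?f t u * ?e T u \<partial>\<mu>) = 0" if t: "t \<in> {0..T}" for t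
  proof -
    have "has_bochner_integral \<mu> (\<lambda>u. ?e t u * ?e T u - r t * (?e T u * ?e T u)) (q (min t T) - r t * q (min T T))"
      by (intro has_bochner_integral_diff has_bochner_integral_mult_right indicator_inner t TT)
    moreover have "?e t u * ?e T u - r t * (?e T u * ?e T u) = ?f t u * ?e T u" for u
      by (simp add: algebra_simps)
    moreover have "q (min t T) - r t * q (min T T) = 0"
      using t Q_pos by (simp add: r_def min_absorb1)
    ultimately show ?thesis by (simp only: has_bochner_integral_iff)
  qed
  have "distr P (Pi\<^sub>M {0..T} (\<lambda>_. borel) \<Otimes>\<^sub>M borel) (\<lambda>\<omega>. (\<lambda>u\<in>{0..T}. Y u \<omega>, M T \<omega>)) =
    distr P (Pi\<^sub>M {0..T} (\<lambda>_. borel)) (\<lambda>\<omega>. \<lambda>u\<in>{0..T}. Y u \<omega>) \<Otimes>\<^sub>M distr P borel (M T)"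
    by (rule G.wiener_indep[OF _ wY wiener_M[OF TT] orth]) auto
  then have indep: "distr P (Pi\<^sub>M {0..T} (\<lambda>_. borel) \<Otimes>\<^sub>M borel) (\<lambda>\<omega>. (path T Y \<omega>, M T \<omega>)) =
    law P T Y \<Otimes>\<^sub>M distr P borel (M T)"
    by (simp only: law_def path_def[abs_def])
  show ?thesis
  proof (rule bridge_of_independent_end[where Y = Y and r = r])
    show "M t \<omega> = Y t \<omega> + r t * M T \<omega>" for t \<omega> by (simp add: Y_def)
    show "distr P (Pi\<^sub>M {0..T} (\<lambda>_. borel) \<Otimes>\<^sub>M borel) (\<lambda>\<omega>. (path T Y \<omega>, M T \<omega>)) =
      law P T Y \<Otimes>\<^sub>M distr P borel (M T)" by (rule indep)
    show "law P T (B_transform P T z M i) = law P T Y" by (rule law_eq)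
    show "\<And>t. t \<in> {0..T} \<Longrightarrow> B_transform P T z M i t \<in> borel_measurable P"
      by (rule G.wiener_measurable(2)[OF wiener_transform(2)[OF i]])
    show "\<And>t. t \<in> {0..T} \<Longrightarrow> Y t \<in> borel_measurable P" by (rule G.wiener_measurable(2)[OF wY])
  qed (use G.P.prob_space_axioms T G.X_measurable in auto)
qed

end

text \<open>
  The integrand vanishes outside the point \<open>0\<close>, so the integral has variance \<open>0\<close>.
\<close>

lemma (in deterministic_volatility) volatility_integral_starts_at_0:
  assumes P: "prob_space P" and W: "brownian_motion P T W"
    and M: "AE \<omega> in P. M \<omega> = wiener_integral P L T W (\<lambda>s. z s * indicator {0..0} s) \<omega>"
  shows "AE \<omega> in P. M \<omega> = 0"
proof -
  interpret W: gaussian_integrator P L T W by (rule brownian_gaussian_integrator[OF P T W])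
  let ?f = "\<lambda>s. z s * indicator {0..0} s"
  note z_meas[measurable]
  have [measurable]: "(indicator {0..0} :: real \<Rightarrow> real) \<in> borel_measurable L" by (rule L.borel_measurable_mu) simp
  have m: "?f \<in> borel_measurable L" by measurable
  have ae: "AE s in L. (?f s)\<^sup>2 = 0" using L.AE_pos by eventually_elim (simp add: indicator_def)
  have m2: "(\<lambda>s. (?f s)\<^sup>2) \<in> borel_measurable L" using m by measurable
  have "integrable L (\<lambda>s. (?f s)\<^sup>2)"
    by (rule integrable_cong_AE[THEN iffD2, OF m2 _ ae]) simp_all
  then have w: "W.wiener ?f (wiener_integral P L T W ?f)" by (rule W.wiener_integral_wiener[OF m])
  have "(\<integral>s. (?f s)\<^sup>2 \<partial>L) = 0" using integral_cong_AE[OF m2 _ ae] by simp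
  with W.wiener_normal(2)[OF w] have "centered_normal P (wiener_integral P L T W ?f) 0" by simp
  from centered_normal_0_AE[OF P this] M show ?thesis by eventually_elim simp
qed

theorem theorem3p3:
  fixes T :: real
    and z :: "real \<Rightarrow> real"
    and P\<^sub>0 P :: "(real \<Rightarrow> real) measure"
    and W :: "real \<Rightarrow> (real \<Rightarrow> real) \<Rightarrow> real"
    and i :: nat
  assumes "T > 0"
    and "z \<in> borel_measurable (restrict_space lborel {0..T})"
    and "set_integrable lborel {0..T} (\<lambda>s. (z s)\<^sup>2)"
    and "AE s in lborel. s \<in> {0..T} \<longrightarrow> z s \<noteq> 0"
    and "prob_space P\<^sub>0"
    and "sets P\<^sub>0 = sets (path_space T)"
    and "P = completion P\<^sub>0"
    and "brownian_motion P T W"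
    and "\<forall>t\<in>{0..T}. AE \<omega> in P.
           coord t \<omega> = wiener_integral P (restrict_space lborel {0..T}) T W
                         (\<lambda>s. z s * indicator {0..t} s) \<omega>"
    and "i \<in> {1, 2}"
  shows "martingale_on P T (completed_natural_filtration P (T_transform P T z coord i))
           (T_transform P T z coord i) \<and>
         (AE \<omega> in P. T_transform P T z coord i 0 \<omega> = 0) \<and>
         is_quadratic_variation P T (completed_natural_filtration P (T_transform P T z coord i))
           (T_transform P T z coord i) (\<lambda>t \<omega>. qv z t) \<and>
         is_bridge P T coord (B_transform P T z coord i)"
proof -
  interpret deterministic_volatility T z using assms(1-4) by unfold_locales
  have P: "prob_space P" unfolding assms(7) by (rule prob_space.prob_space_completion[OF assms(5)])
  have space_P: "space P = {\<omega>\<in>space (Pi\<^sub>M {0..T} (\<lambda>_. borel)). continuous_on {0..T} \<omega>}"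
    unfolding assms(7) using sets_eq_imp_space_eq[OF assms(6)]
    by (auto simp: path_space_def space_restrict_space)
  have coord_meas: "coord t \<in> borel_measurable P" if t: "t \<in> {0..T}" for t
  proof -
    have "coord t \<in> borel_measurable (path_space T)"
      unfolding path_space_def coord_def[abs_def]
      by (rule measurable_restrict_space1[OF measurable_component_singleton[OF t]])
    then have "coord t \<in> borel_measurable P\<^sub>0" by (simp only: measurable_cong_sets[OF assms(6) refl])
    then show ?thesis unfolding assms(7) by (rule measurable_completion)
  qed
  interpret volatility_martingale T z P coord
  proof (intro volatility_martingale.intro volatility_martingale_axioms.intro)
    show "deterministic_volatility T z" by unfold_locales
    show "gaussian_integrator P \<mu> T coord"
      by (rule volatility_integral_gaussian_integrator[OF P assms(8) coord_meas]) (assumption, rule assms(9)[rule_format])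
    show "complete_measure P" unfolding assms(7) by (rule completion.complete_measure_axioms)
    show "AE \<omega> in P. coord 0 \<omega> = 0"
      by (rule volatility_integral_starts_at_0[OF P assms(8)], rule assms(9)[rule_format]) (use assms(1) in simp)
    show "continuous_on {0..T} (\<lambda>t. coord t \<omega>)" if "\<omega> \<in> space P" for \<omega>
      using that unfolding space_P coord_def by simp
  qed
  show ?thesis
    using T_transform_quadratic_variation[OF assms(10)] T_transform_0[OF assms(10)] B_transform_bridge[OF assms(10)]
    by blast
qed

end
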